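(* Let $\theta$ be an inner function on $\mathbb{C}_+$, and let $\mu$ be a positive regular Borel measure on $\mathbb{C}_+$ supported on $[0,\infty)$ (that is, concentrated on the positive real axis). Then the following are equivalent: (1) $\mu$ is a Carleson measure for $K^{\mathbb{C}_+}_\theta$, that is, the natural mapping $K^{\mathbb{C}_+}_\theta\to L^2(\mathbb{C}_+,\mu)$ is bounded; (2) there is a constant $c>0$ such that $$\int_0^\infty\frac{w}{|w+s|^2}\,d\mu(s)\le\frac{c}{1-|\theta(w)|}\qquad( * )$$ for all $w\in(0,\infty)$. Moreover, in case $0\notin\sigma(\theta)$, it suffices in (2) to check $( * )$ only for $w\ge\min\{\operatorname{dist}(0,\sigma(\theta))/2,\,1\}$; and in case $\infty\notin\sigma(\theta)$, it suffices to check $( * )$ only for $w\le 2\sup\{|z|:z\in\sigma(\theta)\}$.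
   Context: $\mathbb{C}_+=\{s\in\mathbb{C}:\operatorname{Re}s>0\}$. For an inner function $\theta\in H^\infty(\mathbb{C}_+)$, $K^{\mathbb{C}_+}_\theta=H^2(\mathbb{C}_+)\ominus\theta H^2(\mathbb{C}_+)$ is the model space, where $H^2(\mathbb{C}_+)$ is the Hardy space of the right half-plane; the natural mapping sends $f$ to $f$ regarded as an element of $L^2(\mathbb{C}_+,\mu)$. The spectrum of $\theta$ is $\sigma(\theta)=\{\zeta\in\overline{\mathbb{C}_+}\cup\{\infty\}:\liminf_{z\to\zeta,\ z\in\mathbb{C}_+}|\theta(z)|=0\}$. Here $\operatorname{dist}(0,\sigma(\theta))$ is the Euclidean distance to the finite points of $\sigma(\theta)$, equal to $+\infty$ if there are none. The right-hand side of $( * )$ is read as $+\infty$ if $|\theta(w)|=1$.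
   Formalization: In the last clause (∞ ∉ σ(θ)) the case σ(θ) = {0} is excluded: there 2 sup|z| = 0, so no w > 0 is checked, and the claim fails, e.g. for θ(s) = exp(-1/s) and μ = Σ eⁿ δ_n. *)

theory Defs
  imports "HOL-Complex_Analysis.Complex_Analysis"
begin

abbreviation right_half_plane :: "complex set"  (\<open>\<complex>\<^sub>+\<close>)
  where "\<complex>\<^sub>+ \<equiv> {s. 0 < Re s}"

(* Functions on the half-plane are total functions on the complex numbers;
   their values off the half-plane never matter. *)

definition h2_norm_sq :: "(complex \<Rightarrow> complex) \<Rightarrow> ennreal"
  where "h2_norm_sq f =
    (SUP x\<in>{0::real<..}. \<integral>\<^sup>+ y. ennreal ((cmod (f (Complex x y)))\<^sup>2) \<partial>lborel)"

definition hardy_H2 :: "(complex \<Rightarrow> complex) set"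
  where "hardy_H2 = {f. f holomorphic_on \<complex>\<^sub>+ \<and> h2_norm_sq f < \<infinity>}"

definition h2_norm :: "(complex \<Rightarrow> complex) \<Rightarrow> real"
  where "h2_norm f = sqrt (enn2real (h2_norm_sq f))"

(* For f, g in H2 the functions f(x + i.) and g(x + i.) converge in L2 to the boundary
   functions as x tends to 0 from the right, so the limit exists and is the L2 inner product
   of the boundary functions; it is the inner product inducing h2_norm. *)
definition h2_inner :: "(complex \<Rightarrow> complex) \<Rightarrow> (complex \<Rightarrow> complex) \<Rightarrow> complex"
  where "h2_inner f g =
    Lim (at_right 0) (\<lambda>x::real. \<integral>y. f (Complex x y) * cnj (g (Complex x y)) \<partial>lborel)"

definition inner_function :: "(complex \<Rightarrow> complex) \<Rightarrow> bool"
  where "inner_function \<theta> \<longleftrightarrow>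
    \<theta> holomorphic_on \<complex>\<^sub>+ \<and> bounded (\<theta> ` \<complex>\<^sub>+) \<and>
    (AE y in lborel. \<exists>l. ((\<lambda>x. \<theta> (Complex x y)) \<longlongrightarrow> l) (at_right 0) \<and> cmod l = 1)"

definition model_space :: "(complex \<Rightarrow> complex) \<Rightarrow> (complex \<Rightarrow> complex) set"
  where "model_space \<theta> =
    {f \<in> hardy_H2. \<forall>g\<in>hardy_H2. h2_inner f (\<lambda>s. \<theta> s * g s) = 0}"

(* Points of the extended plane: Some z is the finite point z, None is infinity. *)
fun half_plane_approach :: "complex option \<Rightarrow> complex filter"
  where
    "half_plane_approach (Some \<zeta>) = at \<zeta> within \<complex>\<^sub>+"
  | "half_plane_approach None = inf at_infinity (principal \<complex>\<^sub>+)"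

definition inner_spectrum :: "(complex \<Rightarrow> complex) \<Rightarrow> complex option set"
  where "inner_spectrum \<theta> =
    {\<zeta> \<in> insert None (Some ` closure \<complex>\<^sub>+).
       Liminf (half_plane_approach \<zeta>) (\<lambda>z. ennreal (cmod (\<theta> z))) = 0}"

(* Infimum and supremum are taken in [0,\<infinity>], so they are \<infinity> and 0 if there are no finite
   points. *)
definition spectrum_dist0 :: "(complex \<Rightarrow> complex) \<Rightarrow> ennreal"
  where "spectrum_dist0 \<theta> = (INF z\<in>{z. Some z \<in> inner_spectrum \<theta>}. ennreal (cmod z))"

definition spectrum_radius :: "(complex \<Rightarrow> complex) \<Rightarrow> ennreal"
  where "spectrum_radius \<theta> = (SUP z\<in>{z. Some z \<in> inner_spectrum \<theta>}. ennreal (cmod z))"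

definition regular_borel_measure_on :: "complex set \<Rightarrow> complex measure \<Rightarrow> bool"
  where "regular_borel_measure_on S \<mu> \<longleftrightarrow>
    sets \<mu> = sets (restrict_space borel S) \<and>
    (\<forall>E\<in>sets \<mu>.
      emeasure \<mu> E = (INF U\<in>{U. openin (top_of_set S) U \<and> E \<subseteq> U}. emeasure \<mu> U) \<and>
      emeasure \<mu> E = (SUP K\<in>{K. compact K \<and> K \<subseteq> E}. emeasure \<mu> K))"

definition carleson_measure_for :: "(complex \<Rightarrow> complex) set \<Rightarrow> complex measure \<Rightarrow> bool"
  where "carleson_measure_for X \<mu> \<longleftrightarrow>
    (\<exists>C. \<forall>f\<in>X. (\<integral>\<^sup>+ s. ennreal ((cmod (f s))\<^sup>2) \<partial>\<mu>) \<le> ennreal ((C * h2_norm f)\<^sup>2))"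

(* Division in ennreal: the right-hand side is \<infinity> if cmod (\<theta> w) = 1. *)
definition kernel_condition ::
    "(complex \<Rightarrow> complex) \<Rightarrow> complex measure \<Rightarrow> real set \<Rightarrow> bool"
  where "kernel_condition \<theta> \<mu> W \<longleftrightarrow>
    (\<exists>c::real. c > 0 \<and> (\<forall>w\<in>W.
       (\<integral>\<^sup>+ s. ennreal (w / (cmod (of_real w + s))\<^sup>2) \<partial>\<mu>)
         \<le> ennreal c / ennreal (1 - cmod (\<theta> (of_real w)))))"

end

theory Submission
  imports Defs "HOL-Probability.Sinc_Integral" "HOL-Real_Asymp.Real_Asymp"
begin

text \<open>
  Let \<open>defect w = 1 - |\<theta> w|^2\<close> and let \<open>k w z = (1 - cnj (\<theta> w) * \<theta> z) / (2 pi (z + cnj w))\<close> be the reproducing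
  kernel of the model space, so that the squared norm of \<open>k w\<close> is \<open>defect w / (4 pi Re w)\<close>. Since
  \<open>|1 - cnj (\<theta> w) * \<theta> s| \<ge> 1 - |\<theta> w|\<close>, a Carleson measure tested on \<open>k w\<close> satisfies the kernel condition
  (\<open>carleson_imp_kernel_condition\<close>). All of this rests on Cauchy's formula in the Hardy space
  (\<open>hardy_cauchy_formula\<close>); inner products are limits of integrals along the lines \<open>Re z = x\<close>, which exist
  because the norms along these lines are monotone (\<open>line_sq_antimono\<close>).

  For the converse, let \<open>f\<close> be in the model space. Replacing \<open>|f|\<close> on each dyadic block from \<open>2^n\<close> to
  \<open>2^(n+1)\<close> by its maximum, attained at \<open>s n\<close>, turns \<open>\<mu>\<close> into point masses \<open>m n\<close>. By duality the embedding
  is bounded as soon as the Gram matrix \<open>k (s i) (s j)\<close> is bounded on the sequence space with weights \<open>m\<close>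
  (\<open>model_space_gram_bound\<close>). Cauchy-Schwarz for the kernels yields the Schwarz-Pick inequality, and
  with it a bound for the entries of this matrix by \<open>2 * 2^(- max i j)\<close> times the sum of
  \<open>e k = defect (2^k)\<close> over \<open>k\<close> between \<open>i\<close> and \<open>j\<close>; it also shows that \<open>e\<close> changes by at most
  a bounded factor times \<open>2^|i - j|\<close> from \<open>i\<close> to \<open>j\<close>. The kernel condition says that
  \<open>e r * (\<Sum>n. m n * 2^r / (2^r + 2^(n+1))^2)\<close> is bounded.

  What remains is an inequality between positive sequences (\<open>carleson_kernel_sum_of_slowly_varying\<close>). A direct
  estimate of the sum over \<open>k\<close> loses a logarithm, because \<open>e k\<close> may be proportional to \<open>2^k\<close> or to \<open>2^-k\<close>
  over long ranges. But \<open>e\<close> is comparable to a sequence \<open>v\<close> that is concave relative to \<open>2^k\<close> and \<open>2^-k\<close>,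
  and its second difference \<open>D\<close> vanishes in these critical cases. Up to the end values, the sum
  of \<open>v\<close> over an interval is controlled by the sum of \<open>D\<close>, while the sum of \<open>2^-k * D k\<close> over \<open>k \<ge> r\<close> is
  bounded by \<open>2^-r * v r\<close> and the sum of \<open>2^k * D k\<close> over \<open>k \<le> r\<close> by \<open>2^r * v r\<close>. Hardy's inequality (\<open>hardy_min_kernel\<close>) for
  the end values and Cauchy-Schwarz for the part with \<open>D\<close> complete the argument.

  If 0 is not in the spectrum, Schwarz's reflection principle shows that \<open>1 - |\<theta> w|\<close> is at most of order \<open>w\<close> as
  \<open>w\<close> tends to 0 (\<open>modulus_at_zero\<close>), and then the kernel condition at one point implies it at all smaller
  points (\<open>kernel_condition_extend\<close>). The point at infinity is treated in the same way after the change of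
  variable \<open>z \<mapsto> 1/z\<close>. If the spectrum is empty, \<open>\<theta>\<close> has modulus 1 everywhere and the condition is void.
\<close>

section \<open>Cauchy's formula on rectangles\<close>

lemma contour_integral_horizontal:
  assumes "a < b"
  shows "contour_integral (linepath (Complex a c) (Complex b c)) h = integral {a..b} (\<lambda>u. h (Complex u c))"
proof -
  let ?g = "\<lambda>z. h (z + Complex 0 c)"
  have "contour_integral (linepath (Complex a c) (Complex b c)) h = contour_integral (linepath (of_real a) (of_real b)) ?g"
    unfolding contour_integral_integral
    by (simp add: linepath_def Complex_eq scaleR_conv_of_real algebra_simps)
  also have "\<dots> = integral {a..b} (\<lambda>u. ?g (of_real u))"
    using assms by (subst contour_integral_linepath_Reals_eq) auto
  finally show ?thesis by (simp add: Complex_eq)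
qed

lemma has_contour_integral_rectpath_imp:
  assumes ab: "a < b" and cd: "c < d"
    and I: "(h has_contour_integral I) (rectpath (Complex a c) (Complex b d))"
  shows "I = integral {a..b} (\<lambda>u. h (Complex u c)) - integral {a..b} (\<lambda>u. h (Complex u d))
    + \<i> * (integral {c..d} (\<lambda>y. h (Complex b y)) - integral {c..d} (\<lambda>y. h (Complex a y)))"
proof -
  have int: "h contour_integrable_on (rectpath (Complex a c) (Complex b d))" using I by (rule has_contour_integral_integrable)
  have int': "h contour_integrable_on (linepath (Complex a c) (Complex b c))"
    "h contour_integrable_on (linepath (Complex b c) (Complex b d))"
    "h contour_integrable_on (linepath (Complex b d) (Complex a d))"
    "h contour_integrable_on (linepath (Complex a d) (Complex a c))"
    using int unfolding rectpath_def Let_def by (simp_all add: contour_integrable_join)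
  have "I = contour_integral (rectpath (Complex a c) (Complex b d)) h" using I by (simp add: contour_integral_unique)
  also have "\<dots> = contour_integral (linepath (Complex a c) (Complex b c)) h
     + (contour_integral (linepath (Complex b c) (Complex b d)) h
     + (contour_integral (linepath (Complex b d) (Complex a d)) h
     + contour_integral (linepath (Complex a d) (Complex a c)) h))"
    unfolding rectpath_def Let_def using int'
    by (simp add: contour_integral_join contour_integrable_joinI)
  also have "contour_integral (linepath (Complex b d) (Complex a d)) h = - contour_integral (linepath (Complex a d) (Complex b d)) h"
    using int'(3) contour_integral_reversepath[of "linepath (Complex a d) (Complex b d)" h] by simp
  also have "contour_integral (linepath (Complex a d) (Complex a c)) h = - contour_integral (linepath (Complex a c) (Complex a d)) h"
    using int'(4) contour_integral_reversepath[of "linepath (Complex a c) (Complex a d)" h] by simp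
  finally show ?thesis
    using ab cd by (simp add: contour_integral_horizontal contour_integral_linepath_same_Re[of _ b _ c d] contour_integral_linepath_same_Re[of _ a _ c d] algebra_simps)
qed

text \<open>The four edges appear as integrals over real intervals because they are treated separately below:
  the left edge is moved to the boundary of the half-plane, the others to infinity.\<close>
lemma Cauchy_rectangle:
  assumes ab: "a < b" and cd: "c < d"
    and S: "convex S" "cbox (Complex a c) (Complex b d) \<subseteq> S" and f: "f holomorphic_on S"
    and w: "w \<notin> path_image (rectpath (Complex a c) (Complex b d))"
  shows "(if w \<in> box (Complex a c) (Complex b d) then 2 * pi * \<i> * f w else 0)
    = integral {a..b} (\<lambda>u. f (Complex u c) / (Complex u c - w)) - integral {a..b} (\<lambda>u. f (Complex u d) / (Complex u d - w))
    + \<i> * (integral {c..d} (\<lambda>y. f (Complex b y) / (Complex b y - w)) - integral {c..d} (\<lambda>y. f (Complex a y) / (Complex a y - w)))"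
proof -
  have pi: "path_image (rectpath (Complex a c) (Complex b d)) \<subseteq> cbox (Complex a c) (Complex b d)"
    using ab cd by (intro path_image_rectpath_subset_cbox) auto
  have "((\<lambda>z. f z / (z - w)) has_contour_integral (if w \<in> box (Complex a c) (Complex b d) then 2 * pi * \<i> * f w else 0))
    (rectpath (Complex a c) (Complex b d))"
  proof (cases "w \<in> box (Complex a c) (Complex b d)")
    case True
    have "w \<in> interior S" using True S(2) by (meson box_subset_cbox interior_maximal open_box subset_iff subset_trans)
    then have "((\<lambda>z. f z / (z - w)) has_contour_integral (2 * pi * \<i> * winding_number (rectpath (Complex a c) (Complex b d)) w * f w))
       (rectpath (Complex a c) (Complex b d))"
      using S f w pi by (intro Cauchy_integral_formula_convex_simple) auto
    then show ?thesis using True by (simp add: winding_number_rectpath)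
  next
    case False
    then have w': "w \<notin> cbox (Complex a c) (Complex b d)"
      using w ab cd by (simp add: path_image_rectpath_cbox_minus_box)
    have "(\<lambda>z. f z / (z - w)) holomorphic_on cbox (Complex a c) (Complex b d)"
      using w' by (intro holomorphic_intros holomorphic_on_subset[OF f S(2)]) auto
    then have "((\<lambda>z. f z / (z - w)) has_contour_integral 0) (rectpath (Complex a c) (Complex b d))"
      using pi by (intro Cauchy_theorem_convex_simple[of _ "cbox (Complex a c) (Complex b d)"]) auto
    then show ?thesis using False by simp
  qed
  from has_contour_integral_rectpath_imp[OF ab cd this] show ?thesis .
qed

section \<open>Square integrable functions on vertical lines\<close>

lemma poisson_mass:
  assumes a: "0 < a"
  shows "has_bochner_integral lborel (\<lambda>y. 1 / (a\<^sup>2 + (y - q)\<^sup>2)) (pi / a)"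
proof -
  have "has_bochner_integral lborel (\<lambda>y::real. inverse (1 + y\<^sup>2)) pi"
    using integrable_inverse_1_plus_square LBINT_inverse_1_plus_square
    by (simp add: has_bochner_integral_iff set_integrable_def interval_lebesgue_integral_def set_lebesgue_integral_def)
  then have "has_bochner_integral lborel (\<lambda>y. inverse (1 + (- q / a + (1 / a) * y)\<^sup>2)) (pi /\<^sub>R \<bar>1 / a\<bar>)"
    using a by (subst lborel_has_bochner_integral_real_affine_iff[symmetric]) auto
  then have "has_bochner_integral lborel (\<lambda>y. inverse (1 + (- q / a + (1 / a) * y)\<^sup>2) / a\<^sup>2) (pi /\<^sub>R \<bar>1 / a\<bar> / a\<^sup>2)"
    by (rule has_bochner_integral_divide_zero)
  moreover have "inverse (1 + (- q / a + (1 / a) * y)\<^sup>2) / a\<^sup>2 = 1 / (a\<^sup>2 + (y - q)\<^sup>2)" for y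
  proof -
    have "- q / a + (1 / a) * y = (y - q) / a" using a by (simp add: field_simps)
    moreover have "1 + (y - q)\<^sup>2 / a\<^sup>2 = (a\<^sup>2 + (y - q)\<^sup>2) / a\<^sup>2" using a by (simp add: field_simps)
    ultimately show ?thesis using a by (simp add: power_divide)
  qed
  moreover have "pi /\<^sub>R \<bar>1 / a\<bar> / a\<^sup>2 = pi / a" using a by (simp add: power2_eq_square)
  ultimately show ?thesis by simp
qed

lemma eventually_at_right_0: "(\<And>x::real. 0 < x \<Longrightarrow> P x) \<Longrightarrow> \<forall>\<^sub>F x in at_right 0. P x"
  using eventually_at_right_less[of "0::real"] by (rule eventually_mono)

lemma tendsto_at_right_0_cong:
  assumes "\<And>x::real. 0 < x \<Longrightarrow> f x = g x" "(g \<longlongrightarrow> l) (at_right 0)"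
  shows "(f \<longlongrightarrow> l) (at_right 0)"
  by (rule Lim_transform_eventually[OF assms(2)], rule eventually_at_right_0) (simp only: assms(1))

lemma cmod_add_power2_le: "(cmod (a + b))\<^sup>2 \<le> 2 * (cmod a)\<^sup>2 + 2 * (cmod b)\<^sup>2"
proof -
  have "(cmod (a + b))\<^sup>2 \<le> (cmod a + cmod b)\<^sup>2" by (intro power_mono norm_triangle_ineq) auto
  also have "\<dots> \<le> 2 * (cmod a)\<^sup>2 + 2 * (cmod b)\<^sup>2"
    using zero_le_power2[of "cmod a - cmod b"] by (simp add: power2_sum power2_diff)
  finally show ?thesis .
qed

definition sq_integrable :: "(real \<Rightarrow> complex) \<Rightarrow> bool"
  where "sq_integrable \<phi> \<longleftrightarrow> \<phi> \<in> borel_measurable lborel \<and> integrable lborel (\<lambda>y. (cmod (\<phi> y))\<^sup>2)"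

lemma sq_integrable_mult:
  assumes "sq_integrable \<phi>" "sq_integrable \<psi>"
  shows "integrable lborel (\<lambda>y. \<phi> y * \<psi> y)"
proof (rule Bochner_Integration.integrable_bound)
  show "integrable lborel (\<lambda>y. (cmod (\<phi> y))\<^sup>2 + (cmod (\<psi> y))\<^sup>2)"
    using assms by (auto simp: sq_integrable_def)
  show "(\<lambda>y. \<phi> y * \<psi> y) \<in> borel_measurable lborel" using assms by (auto simp: sq_integrable_def)
  have "cmod (\<phi> y * \<psi> y) \<le> (cmod (\<phi> y))\<^sup>2 + (cmod (\<psi> y))\<^sup>2" for y
  proof -
    have "0 \<le> (cmod (\<phi> y) - cmod (\<psi> y))\<^sup>2" "0 \<le> (cmod (\<phi> y))\<^sup>2" "0 \<le> (cmod (\<psi> y))\<^sup>2" "0 \<le> cmod (\<phi> y) * cmod (\<psi> y)" by auto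
    moreover have "(cmod (\<phi> y) - cmod (\<psi> y))\<^sup>2 = (cmod (\<phi> y))\<^sup>2 + (cmod (\<psi> y))\<^sup>2 - 2 * (cmod (\<phi> y) * cmod (\<psi> y))"
      by (simp add: power2_diff)
    ultimately show ?thesis unfolding norm_mult by linarith
  qed
  then show "AE y in lborel. cmod (\<phi> y * \<psi> y) \<le> norm ((cmod (\<phi> y))\<^sup>2 + (cmod (\<psi> y))\<^sup>2)" by simp
qed

lemma sq_integrable_cnj: "sq_integrable \<phi> \<Longrightarrow> sq_integrable (\<lambda>y. cnj (\<phi> y))"
  by (auto simp: sq_integrable_def intro: borel_measurable_continuous_on[of cnj, OF linear_continuous_on[OF bounded_linear_cnj]])

lemma sq_integrable_cmult: "sq_integrable \<phi> \<Longrightarrow> sq_integrable (\<lambda>y. c * \<phi> y)"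
  by (auto simp: sq_integrable_def norm_mult power_mult_distrib)

lemma sq_integrable_bounded_mult:
  assumes "sq_integrable \<phi>" "\<psi> \<in> borel_measurable lborel" "\<And>y. cmod (\<psi> y) \<le> B"
  shows "sq_integrable (\<lambda>y. \<psi> y * \<phi> y)"
  unfolding sq_integrable_def
proof
  show "(\<lambda>y. \<psi> y * \<phi> y) \<in> borel_measurable lborel" using assms by (auto simp: sq_integrable_def)
  show "integrable lborel (\<lambda>y. (cmod (\<psi> y * \<phi> y))\<^sup>2)"
  proof (rule Bochner_Integration.integrable_bound)
    show "integrable lborel (\<lambda>y. B\<^sup>2 * (cmod (\<phi> y))\<^sup>2)" using assms by (auto simp: sq_integrable_def)
    show "(\<lambda>y. (cmod (\<psi> y * \<phi> y))\<^sup>2) \<in> borel_measurable lborel" using assms by (auto simp: sq_integrable_def)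
    have "(cmod (\<psi> y))\<^sup>2 \<le> B\<^sup>2" for y using assms(3)[of y] by (intro power_mono) auto
    then show "AE y in lborel. norm ((cmod (\<psi> y * \<phi> y))\<^sup>2) \<le> norm (B\<^sup>2 * (cmod (\<phi> y))\<^sup>2)"
      by (intro AE_I2) (simp add: norm_mult power_mult_distrib mult_right_mono)
  qed
qed

lemma sq_integrable_add:
  assumes "sq_integrable \<phi>" "sq_integrable \<psi>"
  shows "sq_integrable (\<lambda>y. \<phi> y + \<psi> y)"
  unfolding sq_integrable_def
proof
  show "(\<lambda>y. \<phi> y + \<psi> y) \<in> borel_measurable lborel" using assms by (auto simp: sq_integrable_def)
  show "integrable lborel (\<lambda>y. (cmod (\<phi> y + \<psi> y))\<^sup>2)"
  proof (rule Bochner_Integration.integrable_bound)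
    show "integrable lborel (\<lambda>y. 2 * (cmod (\<phi> y))\<^sup>2 + 2 * (cmod (\<psi> y))\<^sup>2)" using assms by (auto simp: sq_integrable_def)
    show "(\<lambda>y. (cmod (\<phi> y + \<psi> y))\<^sup>2) \<in> borel_measurable lborel" using assms by (auto simp: sq_integrable_def)
    show "AE y in lborel. norm ((cmod (\<phi> y + \<psi> y))\<^sup>2) \<le> norm (2 * (cmod (\<phi> y))\<^sup>2 + 2 * (cmod (\<psi> y))\<^sup>2)"
      using cmod_add_power2_le by simp
  qed
qed

lemma Cauchy_Schwarz_line:
  assumes "sq_integrable \<phi>" "sq_integrable \<psi>"
  shows "(\<integral>y. cmod (\<phi> y * \<psi> y) \<partial>lborel)\<^sup>2 \<le> (\<integral>y. (cmod (\<phi> y))\<^sup>2 \<partial>lborel) * (\<integral>y. (cmod (\<psi> y))\<^sup>2 \<partial>lborel)"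
proof -
  note [measurable] = assms[unfolded sq_integrable_def, THEN conjunct1]
  note i = sq_integrable_mult[OF assms] assms[unfolded sq_integrable_def, THEN conjunct2]
  have "ennreal ((\<integral>y. cmod (\<phi> y * \<psi> y) \<partial>lborel)\<^sup>2) = (\<integral>\<^sup>+y. ennreal (cmod (\<phi> y)) * ennreal (cmod (\<psi> y)) \<partial>lborel)\<^sup>2"
    using integrable_norm[OF i(1)] by (simp add: ennreal_power[symmetric] nn_integral_eq_integral[symmetric] norm_mult ennreal_mult)
  also have "\<dots> \<le> (\<integral>\<^sup>+y. (ennreal (cmod (\<phi> y)))\<^sup>2 \<partial>lborel) * (\<integral>\<^sup>+y. (ennreal (cmod (\<psi> y)))\<^sup>2 \<partial>lborel)"
    by (rule Cauchy_Schwarz_nn_integral) auto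
  also have "\<dots> = ennreal ((\<integral>y. (cmod (\<phi> y))\<^sup>2 \<partial>lborel) * (\<integral>y. (cmod (\<psi> y))\<^sup>2 \<partial>lborel))"
    using i(2,3) by (simp add: ennreal_power nn_integral_eq_integral ennreal_mult)
  finally show ?thesis by (subst (asm) ennreal_le_iff) auto
qed

lemma Cauchy_Schwarz_line_integral:
  assumes "sq_integrable \<phi>" "sq_integrable \<psi>"
  shows "(cmod (\<integral>y. \<phi> y * \<psi> y \<partial>lborel))\<^sup>2 \<le> (\<integral>y. (cmod (\<phi> y))\<^sup>2 \<partial>lborel) * (\<integral>y. (cmod (\<psi> y))\<^sup>2 \<partial>lborel)"
  by (rule order_trans[OF power_mono[OF integral_norm_bound] Cauchy_Schwarz_line[OF assms]]) simp

lemma measurable_vertical_line: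
  assumes "continuous_on \<complex>\<^sub>+ f" "0 < x"
  shows "(\<lambda>y. f (Complex x y)) \<in> borel_measurable borel"
  using assms by (intro borel_measurable_continuous_onI continuous_on_compose2[OF assms(1)])
    (auto simp: Complex_eq intro!: continuous_intros)

section \<open>Norms along vertical lines\<close>

definition line_sq :: "(complex \<Rightarrow> complex) \<Rightarrow> real \<Rightarrow> real"
  where "line_sq f x = (\<integral>y. (cmod (f (Complex x y)))\<^sup>2 \<partial>lborel)"

lemma
  assumes f: "f \<in> hardy_H2"
  shows hardy_holomorphic: "f holomorphic_on \<complex>\<^sub>+"
    and hardy_continuous: "continuous_on \<complex>\<^sub>+ f"
    and hardy_sq_integrable: "0 < x \<Longrightarrow> sq_integrable (\<lambda>y. f (Complex x y))"
    and line_sq_le_norm: "0 < x \<Longrightarrow> line_sq f x \<le> (h2_norm f)\<^sup>2"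
proof -
  show h: "f holomorphic_on \<complex>\<^sub>+" using f by (simp add: hardy_H2_def)
  then show c: "continuous_on \<complex>\<^sub>+ f" by (rule holomorphic_on_imp_continuous_on)
  have fin: "h2_norm_sq f < \<infinity>" using f by (simp add: hardy_H2_def)
  have le: "(\<integral>\<^sup>+ y. ennreal ((cmod (f (Complex x y)))\<^sup>2) \<partial>lborel) \<le> h2_norm_sq f" if "0 < x" for x
    unfolding h2_norm_sq_def using that by (intro SUP_upper) auto
  show s: "sq_integrable (\<lambda>y. f (Complex x y))" if x: "0 < x" for x
    unfolding sq_integrable_def integrable_iff_bounded
    using measurable_vertical_line[OF c x] order.strict_trans1[OF le[OF x] fin] by simp
  show "line_sq f x \<le> (h2_norm f)\<^sup>2" if x: "0 < x" for x
  proof -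
    have "ennreal (line_sq f x) \<le> h2_norm_sq f"
      unfolding line_sq_def using s[OF x] le[OF x] by (simp add: nn_integral_eq_integral sq_integrable_def)
    then have "ennreal (line_sq f x) \<le> ennreal ((h2_norm f)\<^sup>2)"
      using fin by (simp add: h2_norm_def)
    then show ?thesis by (subst (asm) ennreal_le_iff) auto
  qed
qed

lemma hardy_H2_I:
  assumes "f holomorphic_on \<complex>\<^sub>+" "\<And>x. 0 < x \<Longrightarrow> sq_integrable (\<lambda>y. f (Complex x y))" "\<And>x. 0 < x \<Longrightarrow> line_sq f x \<le> B"
  shows "f \<in> hardy_H2" "(h2_norm f)\<^sup>2 \<le> B"
proof -
  have "h2_norm_sq f \<le> ennreal B"
    unfolding h2_norm_sq_def
  proof (rule SUP_least)
    fix x :: real assume "x \<in> {0<..}"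
    then show "(\<integral>\<^sup>+ y. ennreal ((cmod (f (Complex x y)))\<^sup>2) \<partial>lborel) \<le> ennreal B"
      using assms(2)[of x] assms(3)[of x] by (simp add: nn_integral_eq_integral sq_integrable_def line_sq_def ennreal_leI)
  qed
  moreover have "0 \<le> line_sq f 1" unfolding line_sq_def by (intro integral_nonneg_AE) auto
  then have "0 \<le> B" using assms(3)[of 1] by simp
  ultimately show "f \<in> hardy_H2" "(h2_norm f)\<^sup>2 \<le> B"
    using assms(1) by (auto simp: hardy_H2_def h2_norm_def enn2real_leI intro: le_less_trans)
qed

lemma ex_value_le_1_of_finite_integral:
  fixes g :: "real \<Rightarrow> ennreal"
  assumes "g \<in> borel_measurable lborel" "(\<integral>\<^sup>+ t. g t \<partial>lborel) < \<infinity>"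
  shows "\<exists>t\<ge>N. g t \<le> 1"
proof (rule ccontr)
  assume "\<not> (\<exists>t\<ge>N. g t \<le> 1)"
  then have "(\<integral>\<^sup>+ t. indicator {N..} t \<partial>lborel) \<le> (\<integral>\<^sup>+ t. g t \<partial>lborel)"
    by (intro nn_integral_mono) (auto split: split_indicator intro: less_imp_le)
  moreover have "(\<integral>\<^sup>+ t. indicator {N..} t \<partial>lborel) = (\<infinity>::ennreal)"
  proof -
    have "of_nat k \<le> emeasure lborel {N..}" for k
    proof -
      have "of_nat k = emeasure lborel {N..N + real k}" by (simp add: ennreal_of_nat_eq_real_of_nat)
      also have "\<dots> \<le> emeasure lborel {N..}" by (intro emeasure_mono) auto
      finally show ?thesis .
    qed
    then have "emeasure lborel {N..} = \<infinity>"
      by (metis ennreal_Ex_less_of_nat infinity_ennreal_def leD top.not_eq_extremum)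
    then show ?thesis by simp
  qed
  ultimately show False using assms(2) by simp
qed

lemma integral_Icc_of_nn:
  fixes g :: "real \<Rightarrow> real"
  assumes g: "continuous_on {a..b} g" "\<And>t. 0 \<le> g t" and le: "(\<integral>\<^sup>+ t. indicator {a..b} t * ennreal (g t) \<partial>lborel) \<le> ennreal B" and B: "0 \<le> B"
  shows "integral {a..b} g \<le> B"
proof -
  have i: "set_integrable lborel {a..b} g" using g(1) by (rule borel_integrable_atLeastAtMost')
  have "ennreal (integral {a..b} g) = ennreal (LINT t:{a..b}|lborel. g t)"
    using set_borel_integral_eq_integral(2)[OF i] by simp
  also have "\<dots> = (\<integral>\<^sup>+ t. ennreal (indicator {a..b} t *\<^sub>R g t) \<partial>lborel)"
    using i g(2) unfolding set_lebesgue_integral_def set_integrable_def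
    by (intro nn_integral_eq_integral[symmetric]) auto
  also have "\<dots> = (\<integral>\<^sup>+ t. indicator {a..b} t * ennreal (g t) \<partial>lborel)"
    by (intro nn_integral_cong) (auto split: split_indicator)
  finally have "ennreal (integral {a..b} g) \<le> ennreal B" using le by simp
  then show ?thesis using B by simp
qed

text \<open>By Tonelli's theorem the integral of \<open>|f|^2\<close> over the strip \<open>x \<le> Re z \<le> R\<close> is finite, so its
  horizontal sections cannot all exceed 1 from some height on. This provides horizontal edges on which
  \<open>f\<close> is controlled in mean, in place of a pointwise bound.\<close>
lemma hardy_small_horizontal:
  assumes f: "f \<in> hardy_H2" and x: "0 < x"
  shows "\<exists>T\<ge>N. integral {x..R} (\<lambda>u. (cmod (f (Complex u T)))\<^sup>2) \<le> 1 \<and> integral {x..R} (\<lambda>u. (cmod (f (Complex u (-T))))\<^sup>2) \<le> 1"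
proof -
  define F where "F z = indicator \<complex>\<^sub>+ z *\<^sub>R f z" for z
  have "open \<complex>\<^sub>+" by (rule open_halfspace_Re_gt)
  then have F: "F \<in> borel_measurable borel"
    unfolding F_def using hardy_continuous[OF f] by (intro borel_measurable_continuous_on_indicator) auto
  have Cm: "(\<lambda>p. Complex (fst p) (snd p)) \<in> borel_measurable (lborel \<Otimes>\<^sub>M lborel)"
    by (simp add: lborel_prod, intro borel_measurable_continuous_onI) (auto simp: Complex_eq intro!: continuous_intros)
  have Cm': "(\<lambda>p. Complex (fst p) (- snd p)) \<in> borel_measurable (lborel \<Otimes>\<^sub>M lborel)"
    by (simp add: lborel_prod, intro borel_measurable_continuous_onI) (auto simp: Complex_eq intro!: continuous_intros)
  note [measurable] = measurable_compose[OF Cm F] measurable_compose[OF Cm' F]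
  let ?h = "\<lambda>u t. indicator {x..R} u * (ennreal ((cmod (F (Complex u t)))\<^sup>2) + ennreal ((cmod (F (Complex u (-t))))\<^sup>2))"
  have hm: "(\<lambda>p. ?h (fst p) (snd p)) \<in> borel_measurable (lborel \<Otimes>\<^sub>M lborel)" by measurable
  have fin: "h2_norm_sq f < \<infinity>" using f by (simp add: hardy_H2_def)
  have "(\<integral>\<^sup>+ t. (\<integral>\<^sup>+ u. ?h u t \<partial>lborel) \<partial>lborel) = (\<integral>\<^sup>+ u. (\<integral>\<^sup>+ t. ?h u t \<partial>lborel) \<partial>lborel)"
    using lborel_pair.Fubini'[of "\<lambda>u t. ?h u t"] hm by (simp add: case_prod_beta')
  also have "\<dots> \<le> (\<integral>\<^sup>+ u. indicator {x..R} u * (2 * h2_norm_sq f) \<partial>lborel)"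
  proof (intro nn_integral_mono)
    fix u
    show "(\<integral>\<^sup>+ t. ?h u t \<partial>lborel) \<le> indicator {x..R} u * (2 * h2_norm_sq f)"
    proof (cases "u \<in> {x..R}")
      case True
      then have u: "0 < u" using x by simp
      note [measurable] = measurable_vertical_line[OF hardy_continuous[OF f] u]
      have Fu: "F (Complex u t) = f (Complex u t)" for t using u by (simp add: F_def)
      have "(\<integral>\<^sup>+ t. ennreal ((cmod (f (Complex u (-t))))\<^sup>2) \<partial>lborel) = (\<integral>\<^sup>+ t. ennreal ((cmod (f (Complex u t)))\<^sup>2) \<partial>lborel)"
        using nn_integral_real_affine[of "\<lambda>t. ennreal ((cmod (f (Complex u t)))\<^sup>2)" "-1" 0] by simp
      moreover have "(\<integral>\<^sup>+ t. ennreal ((cmod (f (Complex u t)))\<^sup>2) \<partial>lborel) \<le> h2_norm_sq f"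
        unfolding h2_norm_sq_def using u by (intro SUP_upper) auto
      moreover have "(\<lambda>t. f (Complex u (-t))) \<in> borel_measurable lborel"
        by (rule measurable_compose[of "\<lambda>t. -t" _ borel]) auto
      ultimately show ?thesis using True
        by (simp add: Fu nn_integral_add mult_2 add_mono)
    qed simp
  qed
  also have "\<dots> = emeasure lborel {x..R} * (2 * h2_norm_sq f)" by (simp add: nn_integral_multc)
  also have "\<dots> < \<infinity>" using fin by (simp add: ennreal_mult_less_top emeasure_lborel_Icc_eq)
  finally have "(\<integral>\<^sup>+ t. (\<integral>\<^sup>+ u. ?h u t \<partial>lborel) \<partial>lborel) < \<infinity>" .
  moreover have "(\<lambda>t. \<integral>\<^sup>+ u. ?h u t \<partial>lborel) \<in> borel_measurable lborel"
    using measurable_compose[OF measurable_pair_swap' hm]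
    by (intro lborel.borel_measurable_nn_integral) (simp add: case_prod_beta')
  ultimately obtain T where T: "N \<le> T" "(\<integral>\<^sup>+ u. ?h u T \<partial>lborel) \<le> 1"
    using ex_value_le_1_of_finite_integral[of "\<lambda>t. \<integral>\<^sup>+ u. ?h u t \<partial>lborel" N] by auto
  have bound: "integral {x..R} (\<lambda>u. (cmod (f (Complex u s)))\<^sup>2) \<le> 1" if "s = T \<or> s = -T" for s
  proof (rule integral_Icc_of_nn)
    show "continuous_on {x..R} (\<lambda>u. (cmod (f (Complex u s)))\<^sup>2)"
      using x by (intro continuous_intros continuous_on_compose2[OF hardy_continuous[OF f]]) (auto simp: Complex_eq intro!: continuous_intros)
    have "(\<integral>\<^sup>+ t. indicator {x..R} t * ennreal ((cmod (f (Complex t s)))\<^sup>2) \<partial>lborel) \<le> (\<integral>\<^sup>+ u. ?h u T \<partial>lborel)"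
      using that x by (intro nn_integral_mono) (auto split: split_indicator simp: F_def)
    then show "(\<integral>\<^sup>+ t. indicator {x..R} t * ennreal ((cmod (f (Complex t s)))\<^sup>2) \<partial>lborel) \<le> ennreal 1"
      using T(2) by simp
  qed auto
  show ?thesis using T(1) bound by blast
qed

section \<open>Cauchy's and Poisson's formulas in the Hardy space\<close>

lemma kernel_denominator:
  assumes "Re w \<noteq> x"
  shows "cmod (w - Complex x y) = sqrt ((Re w - x)\<^sup>2 + (y - Im w)\<^sup>2)"
    and "Complex x y \<noteq> w"
    and "(cmod (1 / (w - Complex x y)))\<^sup>2 = 1 / ((Re w - x)\<^sup>2 + (y - Im w)\<^sup>2)"
proof -
  show 1: "cmod (w - Complex x y) = sqrt ((Re w - x)\<^sup>2 + (y - Im w)\<^sup>2)"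
    by (simp add: cmod_def power2_commute[of y])
  show "Complex x y \<noteq> w" using assms by (auto simp: complex_eq_iff)
  show "(cmod (1 / (w - Complex x y)))\<^sup>2 = 1 / ((Re w - x)\<^sup>2 + (y - Im w)\<^sup>2)"
    unfolding norm_divide power_divide 1 by simp
qed

lemma sq_integrable_kernel:
  assumes "Re w \<noteq> x"
  shows "sq_integrable (\<lambda>y. 1 / (w - Complex x y))"
    and "(\<integral>y. (cmod (1 / (w - Complex x y)))\<^sup>2 \<partial>lborel) = pi / \<bar>Re w - x\<bar>"
proof -
  have *: "has_bochner_integral lborel (\<lambda>y. (cmod (1 / (w - Complex x y)))\<^sup>2) (pi / \<bar>Re w - x\<bar>)"
    unfolding kernel_denominator(3)[OF assms] using poisson_mass[of "\<bar>Re w - x\<bar>" "Im w"] assms by simp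
  have "continuous_on UNIV (\<lambda>y. 1 / (w - Complex x y))"
    using kernel_denominator(2)[OF assms] unfolding Complex_eq by (intro continuous_intros) (auto simp: complex_eq_iff)
  then show "sq_integrable (\<lambda>y. 1 / (w - Complex x y))"
    using * by (auto simp: sq_integrable_def has_bochner_integral_iff intro: borel_measurable_continuous_onI)
  show "(\<integral>y. (cmod (1 / (w - Complex x y)))\<^sup>2 \<partial>lborel) = pi / \<bar>Re w - x\<bar>"
    using * by (simp add: has_bochner_integral_iff)
qed

lemma continuous_on_Complex: "continuous_on A (\<lambda>y. Complex x y)" "continuous_on A (\<lambda>u. Complex u x)"
  by (auto simp: Complex_eq intro!: continuous_intros)

text \<open>Take rectangles with vertical edges on \<open>Re z = x\<close> and \<open>Re z = R\<close> whose horizontal edges lie at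
  heights \<open>T n\<close> and \<open>- T n\<close> where \<open>f\<close> is small in mean. The horizontal edges disappear as the heights
  grow, since the Cauchy kernel decays; the edge on \<open>Re z = R\<close> is bounded by Cauchy-Schwarz, and the
  bound tends to 0 as \<open>R\<close> grows.\<close>
lemma hardy_cauchy_approx:
  fixes f :: "complex \<Rightarrow> complex"
  assumes f: "f \<in> hardy_H2" and x: "0 < x" and w: "Re w \<noteq> x" and R: "x < R" "Re w < R"
  shows "cmod ((\<integral>y. f (Complex x y) / (w - Complex x y) \<partial>lborel) - (if x < Re w then 2 * pi * f w else 0))
    \<le> sqrt ((h2_norm f)\<^sup>2 * (pi / (R - Re w)))" (is "cmod (?I - ?c) \<le> ?V")
proof -
  define g where "g u y = f (Complex u y) / (Complex u y - w)" for u y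
  have swap: "w - Complex u y = - (Complex u y - w)" for u y by simp
  have "\<exists>T\<ge>real n + \<bar>Im w\<bar> + 1. integral {x..R} (\<lambda>u. (cmod (f (Complex u T)))\<^sup>2) \<le> 1 \<and> integral {x..R} (\<lambda>u. (cmod (f (Complex u (-T))))\<^sup>2) \<le> 1" for n
    by (rule hardy_small_horizontal[OF f x])
  then obtain T where T: "\<And>n. real n + \<bar>Im w\<bar> + 1 \<le> T n"
    and T1: "\<And>n. integral {x..R} (\<lambda>u. (cmod (f (Complex u (T n))))\<^sup>2) \<le> 1"
    and T2: "\<And>n. integral {x..R} (\<lambda>u. (cmod (f (Complex u (- T n))))\<^sup>2) \<le> 1"
    by metis
  have T0: "0 < T n" "\<bar>Im w\<bar> < T n" for n using T[of n] by linarith+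
  have fc: "continuous_on A (\<lambda>y. f (Complex u y))" if "0 < u" for u A
  proof -
    have "Complex u ` A \<subseteq> \<complex>\<^sub>+" using that by auto
    with hardy_continuous[OF f] continuous_on_Complex(1)[of A u]
    show ?thesis by (rule continuous_on_compose2[of "\<complex>\<^sub>+" f A "Complex u"])
  qed
  have fc': "continuous_on {x..R} (\<lambda>u. f (Complex u t))" for t
    by (rule continuous_on_compose2[OF hardy_continuous[OF f] continuous_on_Complex(2)]) (use x in auto)
  have horiz: "cmod (integral {x..R} (\<lambda>u. g u t)) \<le> (R - x + 1) / (real n + 1)"
    if t: "t = T n \<or> t = - T n" for n t
  proof -
    have d: "real n + 1 \<le> cmod (Complex u t - w)" for u
      using abs_Im_le_cmod[of "Complex u t - w"] t T[of n] by auto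
    have ne: "Complex u t \<noteq> w" for u using d[of u] by auto
    have "cmod (integral {x..R} (\<lambda>u. g u t)) \<le> integral {x..R} (\<lambda>u. (1 + (cmod (f (Complex u t)))\<^sup>2) / (real n + 1))"
    proof (rule integral_norm_bound_integral)
      show "(\<lambda>u. g u t) integrable_on {x..R}" unfolding g_def
        using ne fc' continuous_on_Complex by (intro integrable_continuous_real continuous_intros) auto
      show "(\<lambda>u. (1 + (cmod (f (Complex u t)))\<^sup>2) / (real n + 1)) integrable_on {x..R}"
        using fc' by (intro integrable_continuous_real continuous_intros) auto
      fix u
      have "cmod (f (Complex u t)) \<le> 1 + (cmod (f (Complex u t)))\<^sup>2"
      proof -
        have "0 \<le> (cmod (f (Complex u t)) - 1)\<^sup>2" "0 \<le> cmod (f (Complex u t))" by auto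
        then show ?thesis unfolding power2_diff power_one mult_1_right by linarith
      qed
      then show "cmod (g u t) \<le> (1 + (cmod (f (Complex u t)))\<^sup>2) / (real n + 1)"
        unfolding g_def norm_divide using d[of u] by (intro frac_le) auto
    qed
    also have "\<dots> = ((R - x) + integral {x..R} (\<lambda>u. (cmod (f (Complex u t)))\<^sup>2)) / (real n + 1)"
    proof -
      have i: "(\<lambda>u. (cmod (f (Complex u t)))\<^sup>2) integrable_on {x..R}"
        using fc' by (intro integrable_continuous_real continuous_intros) auto
      then have "integral {x..R} (\<lambda>u. 1 + (cmod (f (Complex u t)))\<^sup>2) = (R - x) + integral {x..R} (\<lambda>u. (cmod (f (Complex u t)))\<^sup>2)"
        using R by (subst Henstock_Kurzweil_Integration.integral_add) auto
      then show ?thesis by simp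
    qed
    also have "\<dots> \<le> (R - x + 1) / (real n + 1)"
      using t T1[of n] T2[of n] by (intro divide_right_mono) auto
    finally show ?thesis .
  qed
  have vert: "integral {- T n..T n} (\<lambda>y. g u y) = (\<integral>y. indicator {- T n..T n} y *\<^sub>R g u y \<partial>lborel)"
    and vint: "integrable lborel (\<lambda>y. g u y)" if u: "0 < u" "Re w \<noteq> u" for u n
  proof -
    have "integrable lborel (\<lambda>y. f (Complex u y) * (1 / (w - Complex u y)))"
      using u by (intro sq_integrable_mult hardy_sq_integrable[OF f] sq_integrable_kernel)
    moreover have "g u y = - (f (Complex u y) * (1 / (w - Complex u y)))" for y
      unfolding g_def swap by (simp only: divide_minus_right mult_minus_right minus_minus times_divide_eq_right mult_1_right)
    ultimately show vi: "integrable lborel (\<lambda>y. g u y)" by simp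
    then have "set_integrable lborel {- T n..T n} (\<lambda>y. g u y)"
      unfolding set_integrable_def by (intro integrable_mult_indicator) auto
    from set_borel_integral_eq_integral(2)[OF this]
    show "integral {- T n..T n} (\<lambda>y. g u y) = (\<integral>y. indicator {- T n..T n} y *\<^sub>R g u y \<partial>lborel)"
      unfolding set_lebesgue_integral_def by simp
  qed
  have right: "cmod (integral {- T n..T n} (\<lambda>y. g R y)) \<le> ?V" for n
  proof -
    have R0: "0 < R" "Re w \<noteq> R" using R x by auto
    let ?\<phi> = "\<lambda>y. f (Complex R y)" and ?\<psi> = "\<lambda>y. 1 / (w - Complex R y)"
    note sq = hardy_sq_integrable[OF f R0(1)] sq_integrable_kernel(1)[OF R0(2)]
    have "cmod (integral {- T n..T n} (\<lambda>y. g R y)) \<le> (\<integral>y. cmod (indicator {- T n..T n} y *\<^sub>R g R y) \<partial>lborel)"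
      unfolding vert[OF R0] by (rule integral_norm_bound)
    also have "\<dots> \<le> (\<integral>y. cmod (?\<phi> y * ?\<psi> y) \<partial>lborel)"
    proof (rule integral_mono')
      show "integrable lborel (\<lambda>y. cmod (?\<phi> y * ?\<psi> y))" using sq_integrable_mult[OF sq] by (rule integrable_norm)
      show "cmod (indicator {- T n..T n} y *\<^sub>R g R y) \<le> cmod (?\<phi> y * ?\<psi> y)" for y
        unfolding g_def by (auto split: split_indicator simp: norm_divide norm_mult norm_minus_commute)
    qed auto
    also have "\<dots> \<le> ?V"
    proof (rule real_le_rsqrt)
      have "(\<integral>y. cmod (?\<phi> y * ?\<psi> y) \<partial>lborel)\<^sup>2 \<le> line_sq f R * (pi / \<bar>Re w - R\<bar>)"
        using Cauchy_Schwarz_line[OF sq] unfolding sq_integrable_kernel(2)[OF R0(2)] line_sq_def .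
      also have "\<dots> \<le> (h2_norm f)\<^sup>2 * (pi / (R - Re w))"
        using R line_sq_le_norm[OF f R0(1)] by (intro mult_mono) auto
      finally show "(\<integral>y. cmod (?\<phi> y * ?\<psi> y) \<partial>lborel)\<^sup>2 \<le> (h2_norm f)\<^sup>2 * (pi / (R - Re w))" .
    qed
    finally show ?thesis .
  qed
  have est: "cmod (- integral {- T n..T n} (\<lambda>y. g x y) - ?c) \<le> (R - x + 1) / (real n + 1) + (R - x + 1) / (real n + 1) + ?V" for n
  proof -
    have "(if w \<in> box (Complex x (- T n)) (Complex R (T n)) then 2 * pi * \<i> * f w else 0)
      = integral {x..R} (\<lambda>u. g u (- T n)) - integral {x..R} (\<lambda>u. g u (T n))
        + \<i> * (integral {- T n..T n} (\<lambda>y. g R y) - integral {- T n..T n} (\<lambda>y. g x y))"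
      unfolding g_def
    proof (rule Cauchy_rectangle[where S="\<complex>\<^sub>+"])
      show "convex \<complex>\<^sub>+" by (rule convex_halfspace_Re_gt)
      show "w \<notin> path_image (rectpath (Complex x (- T n)) (Complex R (T n)))"
        using R T0[of n] w by (subst path_image_rectpath) auto
      show "cbox (Complex x (- T n)) (Complex R (T n)) \<subseteq> \<complex>\<^sub>+" using x by (auto simp: in_cbox_complex_iff)
    qed (use R T0[of n] hardy_holomorphic[OF f] in auto)
    moreover have "(if w \<in> box (Complex x (- T n)) (Complex R (T n)) then 2 * pi * \<i> * f w else 0) = \<i> * ?c"
      using R T0[of n] w by (auto simp: in_box_complex_iff)
    ultimately have "\<i> * ?c = integral {x..R} (\<lambda>u. g u (- T n)) - integral {x..R} (\<lambda>u. g u (T n))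
        + \<i> * (integral {- T n..T n} (\<lambda>y. g R y) - integral {- T n..T n} (\<lambda>y. g x y))" by simp
    then have E: "\<i> * (- integral {- T n..T n} (\<lambda>y. g x y) - ?c) = integral {x..R} (\<lambda>u. g u (T n)) - integral {x..R} (\<lambda>u. g u (- T n))
        - \<i> * integral {- T n..T n} (\<lambda>y. g R y)"
      by (simp add: algebra_simps)
    have "cmod (\<i> * (- integral {- T n..T n} (\<lambda>y. g x y) - ?c)) \<le> cmod (integral {x..R} (\<lambda>u. g u (T n)))
        + cmod (integral {x..R} (\<lambda>u. g u (- T n))) + cmod (\<i> * integral {- T n..T n} (\<lambda>y. g R y))"
      unfolding E using norm_triangle_ineq4[of "integral {x..R} (\<lambda>u. g u (T n)) - integral {x..R} (\<lambda>u. g u (- T n))" "\<i> * integral {- T n..T n} (\<lambda>y. g R y)"]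
        norm_triangle_ineq4[of "integral {x..R} (\<lambda>u. g u (T n))" "integral {x..R} (\<lambda>u. g u (- T n))"]
      by linarith
    then have "cmod (- integral {- T n..T n} (\<lambda>y. g x y) - ?c) \<le> cmod (integral {x..R} (\<lambda>u. g u (T n)))
        + cmod (integral {x..R} (\<lambda>u. g u (- T n))) + cmod (integral {- T n..T n} (\<lambda>y. g R y))"
      by (simp only: norm_mult norm_ii mult_1_left)
    then show ?thesis using horiz[of "T n" n] horiz[of "- T n" n] right[of n] by linarith
  qed
  have "(\<lambda>n. - integral {- T n..T n} (\<lambda>y. g x y)) \<longlonglongrightarrow> - (\<integral>y. g x y \<partial>lborel)"
  proof (rule tendsto_minus)
    have "(\<lambda>n. (\<integral>y. indicator {- T n..T n} y *\<^sub>R g x y \<partial>lborel)) \<longlonglongrightarrow> (\<integral>y. g x y \<partial>lborel)"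
    proof (rule integral_dominated_convergence[where w="\<lambda>y. cmod (g x y)"])
      show "integrable lborel (\<lambda>y. cmod (g x y))" using vint[OF x w] by (rule integrable_norm)
      show "(\<lambda>y. g x y) \<in> borel_measurable lborel" using vint[OF x w] by auto
      then show "(\<lambda>y. indicator {- T n..T n} y *\<^sub>R g x y) \<in> borel_measurable lborel" for n by measurable
      show "AE y in lborel. (\<lambda>n. indicator {- T n..T n} y *\<^sub>R g x y) \<longlonglongrightarrow> g x y"
      proof (rule AE_I2)
        fix y :: real
        have "\<forall>\<^sub>F n in sequentially. indicator {- T n..T n} y *\<^sub>R g x y = g x y"
        proof (rule eventually_sequentiallyI[of "nat \<lceil>\<bar>y\<bar>\<rceil>"])
          fix n assume "nat \<lceil>\<bar>y\<bar>\<rceil> \<le> n"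
          then have "\<bar>y\<bar> \<le> real n" by linarith
          then have "y \<in> {- T n..T n}" using T[of n] by auto
          then show "indicator {- T n..T n} y *\<^sub>R g x y = g x y" by simp
        qed
        then show "(\<lambda>n. indicator {- T n..T n} y *\<^sub>R g x y) \<longlonglongrightarrow> g x y"
          by (rule tendsto_eventually)
      qed
      show "AE y in lborel. norm (indicator {- T n..T n} y *\<^sub>R g x y) \<le> cmod (g x y)" for n
        by (auto split: split_indicator)
    qed
    then show "(\<lambda>n. integral {- T n..T n} (\<lambda>y. g x y)) \<longlonglongrightarrow> (\<integral>y. g x y \<partial>lborel)"
      unfolding vert[OF x w] .
  qed
  then have l1: "(\<lambda>n. cmod (- integral {- T n..T n} (\<lambda>y. g x y) - ?c)) \<longlonglongrightarrow> cmod (- (\<integral>y. g x y \<partial>lborel) - ?c)"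
    by (intro tendsto_norm tendsto_diff tendsto_const)
  have "(\<lambda>n. (R - x + 1) / (real n + 1) + (R - x + 1) / (real n + 1) + ?V) \<longlonglongrightarrow> 0 + 0 + ?V"
    by (intro tendsto_add tendsto_const) real_asymp+
  then have "cmod (- (\<integral>y. g x y \<partial>lborel) - ?c) \<le> 0 + 0 + ?V"
    using est by (intro LIMSEQ_le[OF l1]) auto
  moreover have "- (\<integral>y. g x y \<partial>lborel) = ?I"
    unfolding g_def integral_minus[symmetric]
    by (intro Bochner_Integration.integral_cong refl) (simp only: swap divide_minus_right)
  ultimately show ?thesis by simp
qed

lemma hardy_cauchy_formula:
  fixes f :: "complex \<Rightarrow> complex"
  assumes f: "f \<in> hardy_H2" and x: "0 < x" and w: "Re w \<noteq> x"
  shows "(\<integral>y. f (Complex x y) / (w - Complex x y) \<partial>lborel) = (if x < Re w then 2 * pi * f w else 0)"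
    (is "?I = ?c")
proof -
  have "((\<lambda>R. sqrt ((h2_norm f)\<^sup>2 * (pi / (R - Re w)))) \<longlongrightarrow> sqrt ((h2_norm f)\<^sup>2 * 0)) at_top"
    by (intro tendsto_intros) real_asymp
  moreover have "\<forall>\<^sub>F R in at_top. cmod (?I - ?c) \<le> sqrt ((h2_norm f)\<^sup>2 * (pi / (R - Re w)))"
    using eventually_gt_at_top[of x] eventually_gt_at_top[of "Re w"]
    by eventually_elim (rule hardy_cauchy_approx[OF f x w])
  ultimately have "cmod (?I - ?c) \<le> sqrt ((h2_norm f)\<^sup>2 * 0)"
    by (intro tendsto_lowerbound) auto
  then show ?thesis by simp
qed

text \<open>Subtract from Cauchy's formula at \<open>w = x + a + iq\<close> the one at the mirror image of \<open>w\<close> in the line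
  \<open>Re z = x\<close>, where the integral vanishes.\<close>
lemma hardy_poisson_formula:
  fixes f :: "complex \<Rightarrow> complex"
  assumes f: "f \<in> hardy_H2" and x: "0 < x" and a: "0 < a"
  shows "f (Complex (x + a) q) = (\<integral>y. f (Complex x y) * of_real (a / (pi * (a\<^sup>2 + (y - q)\<^sup>2))) \<partial>lborel)"
proof -
  define w w' where "w = Complex (x + a) q" and "w' = Complex (x - a) q"
  have w: "Re w \<noteq> x" "Re w' \<noteq> x" using a by (auto simp: w_def w'_def)
  have i: "integrable lborel (\<lambda>y. f (Complex x y) * (1 / (v - Complex x y)))" if "Re v \<noteq> x" for v
    using that by (intro sq_integrable_mult hardy_sq_integrable[OF f x] sq_integrable_kernel)
  have "2 * pi * f w = (\<integral>y. f (Complex x y) / (w - Complex x y) \<partial>lborel) - (\<integral>y. f (Complex x y) / (w' - Complex x y) \<partial>lborel)"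
    using hardy_cauchy_formula[OF f x w(1)] hardy_cauchy_formula[OF f x w(2)] a by (simp add: w_def w'_def)
  also have "\<dots> = (\<integral>y. f (Complex x y) / (w - Complex x y) - f (Complex x y) / (w' - Complex x y) \<partial>lborel)"
    using i[OF w(1)] i[OF w(2)] by (subst Bochner_Integration.integral_diff) auto
  also have "\<dots> = (\<integral>y. 2 * pi * (f (Complex x y) * of_real (a / (pi * (a\<^sup>2 + (y - q)\<^sup>2)))) \<partial>lborel)"
  proof (intro Bochner_Integration.integral_cong refl)
    fix y
    have e: "w - Complex x y = Complex a (q - y)" "w' - Complex x y = Complex (- a) (q - y)"
      by (auto simp: w_def w'_def complex_eq_iff)
    have ne: "Complex a (q - y) \<noteq> 0" "Complex (- a) (q - y) \<noteq> 0" using a by (auto simp: complex_eq_iff)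
    have p: "0 < a\<^sup>2 + (y - q)\<^sup>2" using a by (simp add: add_pos_nonneg)
    have "1 / Complex a (q - y) - 1 / Complex (- a) (q - y) = (Complex (- a) (q - y) - Complex a (q - y)) / (Complex a (q - y) * Complex (- a) (q - y))"
      using ne by (simp add: field_simps)
    also have "Complex a (q - y) * Complex (- a) (q - y) = - of_real (a\<^sup>2 + (y - q)\<^sup>2)"
      by (simp add: complex_eq_iff power2_eq_square algebra_simps)
    also have "Complex (- a) (q - y) - Complex a (q - y) = - of_real (2 * a)" by (simp add: complex_eq_iff)
    finally have k: "1 / Complex a (q - y) - 1 / Complex (- a) (q - y) = of_real (2 * a / (a\<^sup>2 + (y - q)\<^sup>2))" by (simp only: divide_minus_left divide_minus_right minus_minus of_real_divide)
    have "f (Complex x y) / (w - Complex x y) - f (Complex x y) / (w' - Complex x y)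
      = f (Complex x y) * (1 / Complex a (q - y) - 1 / Complex (- a) (q - y))"
      unfolding e by (simp add: right_diff_distrib)
    also have "\<dots> = 2 * pi * (f (Complex x y) * of_real (a / (pi * (a\<^sup>2 + (y - q)\<^sup>2))))"
      unfolding k using p by simp
    finally show "f (Complex x y) / (w - Complex x y) - f (Complex x y) / (w' - Complex x y)
      = 2 * pi * (f (Complex x y) * of_real (a / (pi * (a\<^sup>2 + (y - q)\<^sup>2))))" .
  qed
  also have "\<dots> = 2 * pi * (\<integral>y. f (Complex x y) * of_real (a / (pi * (a\<^sup>2 + (y - q)\<^sup>2))) \<partial>lborel)"
    by (rule integral_mult_right_zero)
  finally have E: "2 * pi * f w = 2 * pi * (\<integral>y. f (Complex x y) * of_real (a / (pi * (a\<^sup>2 + (y - q)\<^sup>2))) \<partial>lborel)" .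
  have "complex_of_real (2 * pi) \<noteq> 0" by simp
  from mult_left_cancel[THEN iffD1, OF this E] show ?thesis unfolding w_def .
qed

text \<open>Poisson's formula writes \<open>f\<close> on the line \<open>Re z = x + a\<close> as an average of its values on the line
  \<open>Re z = x\<close>. Cauchy-Schwarz with respect to the Poisson kernel bounds the square of the average by
  the average of the squares, and integration over the line preserves the total mass.\<close>
lemma line_sq_antimono:
  fixes f :: "complex \<Rightarrow> complex"
  assumes f: "f \<in> hardy_H2" and x: "0 < x" and a: "0 < a"
  shows "line_sq f (x + a) \<le> line_sq f x"
proof -
  define P where "P y q = a / (pi * (a\<^sup>2 + (y - q)\<^sup>2))" for y q
  have pos: "0 < a\<^sup>2 + t\<^sup>2" for t using a by (simp add: add_pos_nonneg)
  have P0: "0 \<le> P y q" for y q unfolding P_def using a by simp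
  have Pm: "(\<integral>\<^sup>+ y. ennreal (P y q) \<partial>lborel) = 1" for q
  proof -
    have "has_bochner_integral lborel (\<lambda>y. a / pi * (1 / (a\<^sup>2 + (y - q)\<^sup>2))) (a / pi * (pi / a))"
      by (intro has_bochner_integral_mult_right poisson_mass a)
    then have "has_bochner_integral lborel (\<lambda>y. P y q) 1" using a by (simp add: P_def)
    then show ?thesis using P0 by (subst nn_integral_eq_integral) (auto simp: has_bochner_integral_iff)
  qed
  have Psym: "P y q = P q y" for y q by (simp add: P_def power2_commute)
  note fm [measurable] = hardy_sq_integrable[OF f x, unfolded sq_integrable_def, THEN conjunct1, simplified]
  have [measurable]: "(\<lambda>p. P (fst p) (snd p)) \<in> borel_measurable (borel \<Otimes>\<^sub>M borel)"
    unfolding P_def by measurable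
  have point: "ennreal ((cmod (f (Complex (x + a) q)))\<^sup>2) \<le> (\<integral>\<^sup>+ y. ennreal ((cmod (f (Complex x y)))\<^sup>2) * ennreal (P y q) \<partial>lborel)" for q
  proof -
    have "ennreal (cmod (f (Complex (x + a) q))) \<le> (\<integral>\<^sup>+ y. ennreal (cmod (f (Complex x y) * of_real (P y q))) \<partial>lborel)"
    proof (cases "integrable lborel (\<lambda>y. f (Complex x y) * of_real (P y q))")
      case True
      then show ?thesis unfolding hardy_poisson_formula[OF f x a] P_def[symmetric] by (rule integral_norm_bound_ennreal)
    next
      case False
      then show ?thesis unfolding hardy_poisson_formula[OF f x a] P_def[symmetric] by (simp add: not_integrable_integral_eq)
    qed
    also have "\<dots> = (\<integral>\<^sup>+ y. ennreal (cmod (f (Complex x y)) * sqrt (P y q)) * ennreal (sqrt (P y q)) \<partial>lborel)"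
      using P0 by (intro nn_integral_cong) (simp add: norm_mult mult.assoc flip: ennreal_mult)
    finally have "(ennreal (cmod (f (Complex (x + a) q))))\<^sup>2 \<le> (\<integral>\<^sup>+ y. ennreal (cmod (f (Complex x y)) * sqrt (P y q)) * ennreal (sqrt (P y q)) \<partial>lborel)\<^sup>2"
      by (rule power_mono) simp
    also have "\<dots> \<le> (\<integral>\<^sup>+ y. (ennreal (cmod (f (Complex x y)) * sqrt (P y q)))\<^sup>2 \<partial>lborel) * (\<integral>\<^sup>+ y. (ennreal (sqrt (P y q)))\<^sup>2 \<partial>lborel)"
      by (rule Cauchy_Schwarz_nn_integral) (unfold P_def, measurable)
    also have "(\<integral>\<^sup>+ y. (ennreal (sqrt (P y q)))\<^sup>2 \<partial>lborel) = 1"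
      using P0 Pm by (simp add: ennreal_power)
    also have "(\<integral>\<^sup>+ y. (ennreal (cmod (f (Complex x y)) * sqrt (P y q)))\<^sup>2 \<partial>lborel) = (\<integral>\<^sup>+ y. ennreal ((cmod (f (Complex x y)))\<^sup>2) * ennreal (P y q) \<partial>lborel)"
      using P0 by (intro nn_integral_cong) (simp add: ennreal_power power_mult_distrib ennreal_mult)
    finally show ?thesis by (simp add: ennreal_power)
  qed
  have "(\<integral>\<^sup>+ q. ennreal ((cmod (f (Complex (x + a) q)))\<^sup>2) \<partial>lborel)
     \<le> (\<integral>\<^sup>+ q. (\<integral>\<^sup>+ y. ennreal ((cmod (f (Complex x y)))\<^sup>2) * ennreal (P y q) \<partial>lborel) \<partial>lborel)"
    by (intro nn_integral_mono point)
  also have "\<dots> = (\<integral>\<^sup>+ y. (\<integral>\<^sup>+ q. ennreal ((cmod (f (Complex x y)))\<^sup>2) * ennreal (P y q) \<partial>lborel) \<partial>lborel)"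
    by (rule lborel_pair.Fubini') (simp add: case_prod_beta' P_def, measurable)
  also have "\<dots> = (\<integral>\<^sup>+ y. ennreal ((cmod (f (Complex x y)))\<^sup>2) \<partial>lborel)"
  proof (intro nn_integral_cong)
    fix y
    have "(\<integral>\<^sup>+ q. ennreal ((cmod (f (Complex x y)))\<^sup>2) * ennreal (P y q) \<partial>lborel)
      = ennreal ((cmod (f (Complex x y)))\<^sup>2) * (\<integral>\<^sup>+ q. ennreal (P q y) \<partial>lborel)"
      unfolding Psym[of y] by (rule nn_integral_cmult) (unfold P_def, measurable)
    then show "(\<integral>\<^sup>+ q. ennreal ((cmod (f (Complex x y)))\<^sup>2) * ennreal (P y q) \<partial>lborel) = ennreal ((cmod (f (Complex x y)))\<^sup>2)"
      by (simp add: Pm)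
  qed
  finally have "ennreal (line_sq f (x + a)) \<le> ennreal (line_sq f x)"
    using hardy_sq_integrable[OF f x] hardy_sq_integrable[OF f, of "x + a"] x a
    by (simp add: nn_integral_eq_integral sq_integrable_def line_sq_def)
  then show ?thesis by (subst (asm) ennreal_le_iff) (auto simp: line_sq_def intro: integral_nonneg_AE)
qed

lemma line_sq_nonneg: "0 \<le> line_sq f x"
  unfolding line_sq_def by (intro integral_nonneg_AE) auto

lemma line_sq_tendsto:
  fixes f :: "complex \<Rightarrow> complex"
  assumes f: "f \<in> hardy_H2"
  shows "\<exists>L. (line_sq f \<longlongrightarrow> L) (at_right 0) \<and> (\<forall>x>0. line_sq f x \<le> L)"
proof -
  define L where "L = (SUP x\<in>{0<..}. line_sq f x)"
  have bdd: "bdd_above (line_sq f ` {0<..})"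
    using line_sq_le_norm[OF f] by (intro bdd_aboveI[of _ "(h2_norm f)\<^sup>2"]) auto
  have le: "line_sq f x \<le> L" if "0 < x" for x
    unfolding L_def using that bdd by (intro cSUP_upper) auto
  have "(line_sq f \<longlongrightarrow> L) (at_right 0)"
  proof (rule order_tendstoI)
    fix b assume "b < L"
    then obtain x0 where x0: "0 < x0" "b < line_sq f x0"
      unfolding L_def using less_cSUP_iff[of "{0<..}" "line_sq f" b] bdd by auto
    have "b < line_sq f x" if "0 < x" "x < x0" for x
      using line_sq_antimono[OF f that(1), of "x0 - x"] that x0 by simp
    then show "\<forall>\<^sub>F x in at_right 0. b < line_sq f x"
      using x0(1) by (auto simp: eventually_at_right_field intro!: exI[of _ x0])
  next
    fix b assume "L < b"
    then show "\<forall>\<^sub>F x in at_right 0. line_sq f x < b"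
      using le by (auto simp: eventually_at_right_field intro!: exI[of _ 1] intro: le_less_trans)
  qed
  then show ?thesis using le by blast
qed

section \<open>Inner products as limits along vertical lines\<close>

lemma hardy_add:
  fixes f g :: "complex \<Rightarrow> complex"
  assumes f: "f \<in> hardy_H2" and g: "g \<in> hardy_H2"
  shows "(\<lambda>z. f z + g z) \<in> hardy_H2"
proof (rule hardy_H2_I)
  show "(\<lambda>z. f z + g z) holomorphic_on \<complex>\<^sub>+" by (intro holomorphic_intros hardy_holomorphic f g)
  fix x :: real assume x: "0 < x"
  note sf = hardy_sq_integrable[OF f x] and sg = hardy_sq_integrable[OF g x]
  show s: "sq_integrable (\<lambda>y. f (Complex x y) + g (Complex x y))" by (rule sq_integrable_add[OF sf sg])
  have "line_sq (\<lambda>z. f z + g z) x \<le> (\<integral>y. 2 * (cmod (f (Complex x y)))\<^sup>2 + 2 * (cmod (g (Complex x y)))\<^sup>2 \<partial>lborel)"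
    unfolding line_sq_def
  proof (rule integral_mono)
    show "integrable lborel (\<lambda>y. (cmod (f (Complex x y) + g (Complex x y)))\<^sup>2)" using s by (simp add: sq_integrable_def)
    show "integrable lborel (\<lambda>y. 2 * (cmod (f (Complex x y)))\<^sup>2 + 2 * (cmod (g (Complex x y)))\<^sup>2)"
      using sf sg by (simp add: sq_integrable_def)
  qed (rule cmod_add_power2_le)
  also have "\<dots> = 2 * line_sq f x + 2 * line_sq g x"
    unfolding line_sq_def using sf sg by (simp add: sq_integrable_def)
  also have "\<dots> \<le> 2 * (h2_norm f)\<^sup>2 + 2 * (h2_norm g)\<^sup>2"
    using line_sq_le_norm[OF f x] line_sq_le_norm[OF g x] by simp
  finally show "line_sq (\<lambda>z. f z + g z) x \<le> 2 * (h2_norm f)\<^sup>2 + 2 * (h2_norm g)\<^sup>2" .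
qed

lemma hardy_bounded_mult:
  fixes f \<psi> :: "complex \<Rightarrow> complex"
  assumes f: "f \<in> hardy_H2" and \<psi>: "\<psi> holomorphic_on \<complex>\<^sub>+" "\<And>z. 0 < Re z \<Longrightarrow> cmod (\<psi> z) \<le> B"
  shows "(\<lambda>z. \<psi> z * f z) \<in> hardy_H2"
proof (rule hardy_H2_I)
  show "(\<lambda>z. \<psi> z * f z) holomorphic_on \<complex>\<^sub>+" by (intro holomorphic_intros hardy_holomorphic f \<psi>)
  fix x :: real assume x: "0 < x"
  note sf = hardy_sq_integrable[OF f x]
  have \<psi>x: "cmod (\<psi> (Complex x y)) \<le> B" for y using x by (intro \<psi>(2)) auto
  show s: "sq_integrable (\<lambda>y. \<psi> (Complex x y) * f (Complex x y))"
    using measurable_vertical_line[OF holomorphic_on_imp_continuous_on[OF \<psi>(1)] x] \<psi>x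
    by (intro sq_integrable_bounded_mult[OF sf]) auto
  have "line_sq (\<lambda>z. \<psi> z * f z) x \<le> (\<integral>y. B\<^sup>2 * (cmod (f (Complex x y)))\<^sup>2 \<partial>lborel)"
    unfolding line_sq_def
  proof (rule integral_mono)
    show "integrable lborel (\<lambda>y. (cmod (\<psi> (Complex x y) * f (Complex x y)))\<^sup>2)" using s by (simp add: sq_integrable_def)
    show "integrable lborel (\<lambda>y. B\<^sup>2 * (cmod (f (Complex x y)))\<^sup>2)"
      using sf by (simp add: sq_integrable_def)
    show "(cmod (\<psi> (Complex x y) * f (Complex x y)))\<^sup>2 \<le> B\<^sup>2 * (cmod (f (Complex x y)))\<^sup>2" for y
      unfolding norm_mult power_mult_distrib by (intro mult_right_mono power_mono \<psi>x) auto
  qed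
  also have "\<dots> = B\<^sup>2 * line_sq f x" unfolding line_sq_def by simp
  also have "\<dots> \<le> B\<^sup>2 * (h2_norm f)\<^sup>2" by (intro mult_left_mono line_sq_le_norm[OF f x]) simp
  finally show "line_sq (\<lambda>z. \<psi> z * f z) x \<le> B\<^sup>2 * (h2_norm f)\<^sup>2" .
qed

lemma hardy_cmult: "f \<in> hardy_H2 \<Longrightarrow> (\<lambda>z. c * f z) \<in> hardy_H2"
  by (rule hardy_bounded_mult[where B="cmod c"]) auto

lemma hardy_zero: "(\<lambda>z. 0) \<in> hardy_H2"
  by (rule hardy_H2_I(1)[where B=0]) (auto simp: sq_integrable_def line_sq_def)

lemma hardy_sum:
  "finite I \<Longrightarrow> (\<And>i. i \<in> I \<Longrightarrow> F i \<in> hardy_H2) \<Longrightarrow> (\<lambda>z. \<Sum>i\<in>I. F i z) \<in> hardy_H2"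
  by (induction I rule: finite_induct) (auto intro: hardy_add hardy_zero)

definition line_inner :: "(complex \<Rightarrow> complex) \<Rightarrow> (complex \<Rightarrow> complex) \<Rightarrow> real \<Rightarrow> complex"
  where "line_inner f g x = (\<integral>y. f (Complex x y) * cnj (g (Complex x y)) \<partial>lborel)"

lemma line_inner_integrable:
  assumes "f \<in> hardy_H2" "g \<in> hardy_H2" "0 < x"
  shows "integrable lborel (\<lambda>y. f (Complex x y) * cnj (g (Complex x y)))"
  by (intro sq_integrable_mult sq_integrable_cnj hardy_sq_integrable assms)

lemma line_inner_self: "line_inner f f x = of_real (line_sq f x)"
  unfolding line_inner_def line_sq_def by (simp add: complex_norm_square[symmetric] flip: of_real_power)

lemma line_inner_cnj: "line_inner g f x = cnj (line_inner f g x)"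
  unfolding line_inner_def by (subst Bochner_Integration.integral_cnj[symmetric]) (simp add: mult.commute)

lemma line_inner_Cauchy_Schwarz:
  assumes "f \<in> hardy_H2" "g \<in> hardy_H2" "0 < x"
  shows "(cmod (line_inner f g x))\<^sup>2 \<le> line_sq f x * line_sq g x"
  using Cauchy_Schwarz_line_integral[OF hardy_sq_integrable[OF assms(1,3)] sq_integrable_cnj[OF hardy_sq_integrable[OF assms(2,3)]]]
  by (simp add: line_inner_def line_sq_def)

lemma line_inner_polarization:
  assumes f: "f \<in> hardy_H2" and g: "g \<in> hardy_H2" and x: "0 < x"
  shows "line_inner f g x = (of_real (line_sq (\<lambda>z. f z + g z) x) - of_real (line_sq (\<lambda>z. f z + (-1) * g z) x)
     + \<i> * of_real (line_sq (\<lambda>z. f z + \<i> * g z) x) - \<i> * of_real (line_sq (\<lambda>z. f z + (- \<i>) * g z) x)) / 4"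
proof -
  have h: "(\<lambda>z. f z + c * g z) \<in> hardy_H2" for c by (intro hardy_add hardy_cmult f g)
  have sq: "line_sq (\<lambda>z. f z + c * g z) x = line_sq f x + (cmod c)\<^sup>2 * line_sq g x + 2 * Re (cnj c * line_inner f g x)" for c
  proof -
    have e: "(cmod (a + c * b))\<^sup>2 = (cmod a)\<^sup>2 + (cmod c)\<^sup>2 * (cmod b)\<^sup>2 + 2 * Re (cnj c * (a * cnj b))" for a b
      unfolding cmod_power2 by (simp add: algebra_simps power2_eq_square)
    define r where "r y = Re (cnj c * (f (Complex x y) * cnj (g (Complex x y))))" for y
    have ic: "integrable lborel (\<lambda>y. cnj c * (f (Complex x y) * cnj (g (Complex x y))))"
      by (intro integrable_mult_right line_inner_integrable[OF f g x])
    then have ir: "integrable lborel r" unfolding r_def by (rule integrable_Re)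
    have "line_sq (\<lambda>z. f z + c * g z) x = line_sq f x + (cmod c)\<^sup>2 * line_sq g x + 2 * (\<integral>y. r y \<partial>lborel)"
      unfolding line_sq_def e r_def[symmetric]
      using hardy_sq_integrable[OF f x] hardy_sq_integrable[OF g x] ir
      by (simp add: sq_integrable_def)
    also have "(\<integral>y. r y \<partial>lborel) = Re (cnj c * line_inner f g x)"
      unfolding r_def line_inner_def integral_Re[OF ic] by (subst integral_mult_right_zero) (rule refl)
    finally show ?thesis .
  qed
  have 1: "line_sq (\<lambda>z. f z + g z) x = line_sq f x + line_sq g x + 2 * Re (line_inner f g x)"
    using sq[of 1] by simp
  have 2: "line_sq (\<lambda>z. f z + (-1) * g z) x = line_sq f x + line_sq g x - 2 * Re (line_inner f g x)"
    using sq[of "-1"] by simp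
  have 3: "line_sq (\<lambda>z. f z + \<i> * g z) x = line_sq f x + line_sq g x + 2 * Im (line_inner f g x)"
    using sq[of "\<i>"] by simp
  have 4: "line_sq (\<lambda>z. f z + (- \<i>) * g z) x = line_sq f x + line_sq g x - 2 * Im (line_inner f g x)"
    using sq[of "- \<i>"] by simp
  show ?thesis unfolding 1 2 3 4 by (simp add: complex_eq_iff)
qed

text \<open>The squared norms along vertical lines are monotone and bounded, hence convergent; by polarization so
  are the inner products. Thus orthogonality in the Hardy space is a statement about limits of
  integrals over lines inside the half-plane, and boundary functions are not needed.\<close>
lemma line_inner_convergent:
  assumes f: "f \<in> hardy_H2" and g: "g \<in> hardy_H2"
  shows "(line_inner f g \<longlongrightarrow> h2_inner f g) (at_right 0)"
proof -
  have "\<exists>L. (line_sq (\<lambda>z. f z + c * g z) \<longlongrightarrow> L) (at_right 0)" for c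
    using line_sq_tendsto[OF hardy_add[OF f hardy_cmult[OF g]]] by blast
  then obtain L where L: "\<And>c. (line_sq (\<lambda>z. f z + c * g z) \<longlongrightarrow> L c) (at_right 0)" by metis
  have "(line_inner f g \<longlongrightarrow> (of_real (L 1) - of_real (L (-1)) + \<i> * of_real (L \<i>) - \<i> * of_real (L (- \<i>))) / 4) (at_right 0)"
  proof (rule tendsto_at_right_0_cong[OF line_inner_polarization[OF f g]])
    show "((\<lambda>x. (of_real (line_sq (\<lambda>z. f z + g z) x) - of_real (line_sq (\<lambda>z. f z + (-1) * g z) x)
       + \<i> * of_real (line_sq (\<lambda>z. f z + \<i> * g z) x) - \<i> * of_real (line_sq (\<lambda>z. f z + (- \<i>) * g z) x)) / 4)
       \<longlongrightarrow> (of_real (L 1) - of_real (L (-1)) + \<i> * of_real (L \<i>) - \<i> * of_real (L (- \<i>))) / 4) (at_right 0)"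
      using L[of 1] by (intro tendsto_intros L) auto
  qed
  moreover from this have "h2_inner f g = (of_real (L 1) - of_real (L (-1)) + \<i> * of_real (L \<i>) - \<i> * of_real (L (- \<i>))) / 4"
    unfolding h2_inner_def line_inner_def[symmetric] by (intro tendsto_Lim) auto
  ultimately show ?thesis by (simp only:)
qed

lemma line_inner_add:
  assumes "f \<in> hardy_H2" "g \<in> hardy_H2" "h \<in> hardy_H2" "0 < x"
  shows "line_inner (\<lambda>z. f z + g z) h x = line_inner f h x + line_inner g h x"
  unfolding line_inner_def using line_inner_integrable assms by (simp add: distrib_right)

lemma line_inner_cmult: "line_inner (\<lambda>z. c * f z) h x = c * line_inner f h x"
  unfolding line_inner_def by (simp add: mult.assoc)

lemma line_inner_sum:
  assumes "finite I" "\<And>i. i \<in> I \<Longrightarrow> F i \<in> hardy_H2" "h \<in> hardy_H2" "0 < x"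
  shows "line_inner (\<lambda>z. \<Sum>i\<in>I. c i * F i z) h x = (\<Sum>i\<in>I. c i * line_inner (F i) h x)"
  using assms
proof (induction I rule: finite_induct)
  case empty
  then show ?case by (simp add: line_inner_def)
next
  case (insert i I)
  have "line_inner (\<lambda>z. c i * F i z + (\<Sum>i\<in>I. c i * F i z)) h x
      = line_inner (\<lambda>z. c i * F i z) h x + line_inner (\<lambda>z. \<Sum>i\<in>I. c i * F i z) h x"
    using insert by (intro line_inner_add hardy_cmult hardy_sum) auto
  then show ?case using insert by (simp add: line_inner_cmult)
qed

section \<open>Reproducing kernels of the model space\<close>

definition szego :: "complex \<Rightarrow> complex \<Rightarrow> complex"
  where "szego w z = 1 / (2 * pi * (z + cnj w))"

lemma szego_line: "cnj (szego w (Complex x y)) = of_real (1 / (2 * pi)) * (1 / (w + 2 * of_real x - Complex x y))"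
proof -
  have "cnj (Complex x y + cnj w) = w + 2 * of_real x - Complex x y" by (simp add: complex_eq_iff)
  then show ?thesis by (simp add: szego_def)
qed

lemma szego_cmod: "(cmod (szego w (Complex x y)))\<^sup>2 = 1 / (4 * pi\<^sup>2) * (1 / ((Re w + x)\<^sup>2 + (y - Im w)\<^sup>2))"
  unfolding szego_def norm_divide norm_mult power_divide power_mult_distrib
  by (simp add: cmod_power2 add.commute)

lemma szego_hardy:
  assumes w: "0 < Re w"
  shows "szego w \<in> hardy_H2"
proof (rule hardy_H2_I)
  have "z + cnj w \<noteq> 0" if "0 < Re z" for z using w that by (auto simp: complex_eq_iff)
  then show "szego w holomorphic_on \<complex>\<^sub>+" unfolding szego_def by (intro holomorphic_intros) auto
  fix x :: real assume x: "0 < x"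
  have ne: "Re (w + 2 * of_real x) \<noteq> x" using w x by simp
  have "sq_integrable (\<lambda>y. cnj (of_real (1 / (2 * pi)) * (1 / (w + 2 * of_real x - Complex x y))))"
    by (intro sq_integrable_cnj sq_integrable_cmult sq_integrable_kernel ne)
  then show "sq_integrable (\<lambda>y. szego w (Complex x y))"
    by (simp only: szego_line[symmetric] complex_cnj_cnj)
  have "has_bochner_integral lborel (\<lambda>y. (cmod (szego w (Complex x y)))\<^sup>2) (1 / (4 * pi\<^sup>2) * (pi / (Re w + x)))"
    unfolding szego_cmod using w x by (intro has_bochner_integral_mult_right poisson_mass) auto
  then have "line_sq (szego w) x = 1 / (4 * pi * (Re w + x))"
    by (simp add: line_sq_def has_bochner_integral_iff power2_eq_square)
  also have "\<dots> \<le> 1 / (4 * pi * Re w)" using w x by (intro divide_left_mono) auto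
  finally show "line_sq (szego w) x \<le> 1 / (4 * pi * Re w)" .
qed

text \<open>On the line \<open>Re z = x\<close> the conjugate of \<open>szego w\<close> is a Cauchy kernel. Its pole is \<open>w + 2x\<close>, the mirror
  image in this line of the pole \<open>- cnj w\<close> of \<open>szego w\<close>.\<close>
lemma line_inner_szego:
  assumes f: "f \<in> hardy_H2" and x: "0 < x" and w: "0 < Re w"
  shows "line_inner f (szego w) x = f (w + 2 * of_real x)"
proof -
  have "line_inner f (szego w) x = (\<integral>y. of_real (1 / (2 * pi)) * (f (Complex x y) / (w + 2 * of_real x - Complex x y)) \<partial>lborel)"
    unfolding line_inner_def szego_line by (intro Bochner_Integration.integral_cong) (auto simp: field_simps)
  also have "\<dots> = of_real (1 / (2 * pi)) * (\<integral>y. f (Complex x y) / (w + 2 * of_real x - Complex x y) \<partial>lborel)"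
    by (rule integral_mult_right_zero)
  also have "(\<integral>y. f (Complex x y) / (w + 2 * of_real x - Complex x y) \<partial>lborel) = 2 * pi * f (w + 2 * of_real x)"
    using hardy_cauchy_formula[OF f x, of "w + 2 * of_real x"] x w by simp
  finally show ?thesis by simp
qed

lemma hardy_tendsto:
  assumes "f holomorphic_on \<complex>\<^sub>+" "0 < Re w"
  shows "((\<lambda>x::real. f (w + 2 * of_real x)) \<longlongrightarrow> f w) (at_right 0)"
proof -
  have "isCont f w"
    using assms holomorphic_on_imp_continuous_on[OF assms(1)] open_halfspace_Re_gt[of 0]
    by (simp add: continuous_on_eq_continuous_at)
  moreover have "((\<lambda>x::real. w + 2 * of_real x) \<longlongrightarrow> w + 2 * of_real 0) (at_right 0)"
    by (intro tendsto_intros)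
  ultimately show ?thesis by (intro isCont_tendsto_compose[of w f]) auto
qed

definition model_kernel :: "(complex \<Rightarrow> complex) \<Rightarrow> complex \<Rightarrow> complex \<Rightarrow> complex"
  where "model_kernel \<theta> w z = szego w z + (- cnj (\<theta> w)) * (\<theta> z * szego w z)"

lemma model_kernel_eq: "model_kernel \<theta> w z = (1 - cnj (\<theta> w) * \<theta> z) / (2 * pi * (z + cnj w))"
  unfolding model_kernel_def szego_def by (simp add: diff_divide_distrib)

locale inner_fun =
  fixes \<theta> :: "complex \<Rightarrow> complex"
  assumes inner: "inner_function \<theta>"
begin

lemma hol: "\<theta> holomorphic_on \<complex>\<^sub>+"
  using inner by (simp add: inner_function_def)

lemma bounded: "\<exists>B\<ge>0. \<forall>z. 0 < Re z \<longrightarrow> cmod (\<theta> z) \<le> B"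
proof -
  obtain B where "\<forall>z\<in>\<theta> ` \<complex>\<^sub>+. cmod z \<le> B" using inner by (auto simp: inner_function_def bounded_iff)
  then have "0 \<le> max B 0" "\<And>z. 0 < Re z \<Longrightarrow> cmod (\<theta> z) \<le> max B 0" by (auto simp: le_max_iff_disj)
  then show ?thesis by blast
qed

lemma mult_hardy: "f \<in> hardy_H2 \<Longrightarrow> (\<lambda>z. \<theta> z * f z) \<in> hardy_H2"
  using bounded hardy_bounded_mult[OF _ hol] by metis

lemma model_kernel_hardy: "0 < Re w \<Longrightarrow> model_kernel \<theta> w \<in> hardy_H2"
  unfolding model_kernel_def by (intro hardy_add hardy_cmult mult_hardy szego_hardy)

lemma defect_measurable:
  assumes "0 < x"
  shows "(\<lambda>y. complex_of_real (1 - (cmod (\<theta> (Complex x y)))\<^sup>2)) \<in> borel_measurable borel"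
proof -
  note [measurable] = measurable_vertical_line[OF holomorphic_on_imp_continuous_on[OF hol] assms]
  show ?thesis by measurable
qed

lemma sq_integrable_defect:
  assumes "0 < x" "sq_integrable \<phi>"
  shows "sq_integrable (\<lambda>y. of_real (1 - (cmod (\<theta> (Complex x y)))\<^sup>2) * \<phi> y)"
proof -
  obtain B where B: "0 \<le> B" "\<And>z. 0 < Re z \<Longrightarrow> cmod (\<theta> z) \<le> B" using bounded by blast
  have "cmod (of_real (1 - (cmod (\<theta> (Complex x y)))\<^sup>2)) \<le> 1 + B\<^sup>2" for y
  proof -
    have "(cmod (\<theta> (Complex x y)))\<^sup>2 \<le> B\<^sup>2" using assms B by (intro power_mono) auto
    then show ?thesis unfolding norm_of_real by (simp add: abs_le_iff)
  qed
  then show ?thesis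
    using defect_measurable[OF assms(1)] by (intro sq_integrable_bounded_mult[OF assms(2)]) auto
qed

text \<open>The unimodular boundary values of \<open>\<theta>\<close> enter the theory of the model space only here, through
  dominated convergence.\<close>
lemma defect_szego_tendsto:
  assumes w: "0 < Re w"
  shows "((\<lambda>x. \<integral>y. (cmod (of_real (1 - (cmod (\<theta> (Complex x y)))\<^sup>2) * szego w (Complex x y)))\<^sup>2 \<partial>lborel) \<longlongrightarrow> 0) (at_right 0)"
proof -
  obtain B where B: "0 \<le> B" "\<And>z. 0 < Re z \<Longrightarrow> cmod (\<theta> z) \<le> B" using bounded by blast
  define h where "h x y = (cmod (of_real (1 - (cmod (\<theta> (Complex x y)))\<^sup>2) * szego w (Complex x y)))\<^sup>2" for x y
  define H where "H y = (1 + B\<^sup>2)\<^sup>2 * (1 / (4 * pi\<^sup>2) * (1 / ((Re w)\<^sup>2 + (y - Im w)\<^sup>2)))" for y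
  have Hi: "integrable lborel H"
    unfolding H_def using poisson_mass[OF w, of "Im w"]
    by (intro integrable_mult_right) (simp add: has_bochner_integral_iff)
  have hm: "h x \<in> borel_measurable lborel" if "0 < x" for x
    using sq_integrable_defect[OF that hardy_sq_integrable[OF szego_hardy[OF w] that]]
    unfolding h_def sq_integrable_def by auto
  have hH: "h x y \<le> H y" if x: "0 < x" for x y
  proof -
    have "(cmod (\<theta> (Complex x y)))\<^sup>2 \<le> B\<^sup>2" using x B by (intro power_mono) auto
    then have "\<bar>1 - (cmod (\<theta> (Complex x y)))\<^sup>2\<bar> \<le> 1 + B\<^sup>2"
      using zero_le_power2[of "cmod (\<theta> (Complex x y))"] by linarith
    then have 1: "(cmod (of_real (1 - (cmod (\<theta> (Complex x y)))\<^sup>2)))\<^sup>2 \<le> (1 + B\<^sup>2)\<^sup>2"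
      unfolding norm_of_real by (intro power_mono) auto
    have p: "0 < (Re w)\<^sup>2 + (y - Im w)\<^sup>2" using w by (simp add: add_pos_nonneg)
    have "(Re w)\<^sup>2 \<le> (Re w + x)\<^sup>2" using w x by (intro power_mono) auto
    then have "1 / ((Re w + x)\<^sup>2 + (y - Im w)\<^sup>2) \<le> 1 / ((Re w)\<^sup>2 + (y - Im w)\<^sup>2)"
      using p by (intro divide_left_mono mult_pos_pos) auto
    then have 2: "(cmod (szego w (Complex x y)))\<^sup>2 \<le> 1 / (4 * pi\<^sup>2) * (1 / ((Re w)\<^sup>2 + (y - Im w)\<^sup>2))"
      unfolding szego_cmod by (intro mult_left_mono) auto
    show ?thesis unfolding h_def H_def norm_mult power_mult_distrib
      by (rule mult_mono[OF 1 2]) auto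
  qed
  have lim: "AE y in lborel. ((\<lambda>x. h x y) \<longlongrightarrow> 0) (at_right 0)"
  proof -
    have "AE y in lborel. \<exists>l. ((\<lambda>x. \<theta> (Complex x y)) \<longlongrightarrow> l) (at_right 0) \<and> cmod l = 1"
      using inner by (simp add: inner_function_def)
    then show ?thesis
    proof eventually_elim
      case (elim y)
      then obtain l where l: "((\<lambda>x. \<theta> (Complex x y)) \<longlongrightarrow> l) (at_right 0)" "cmod l = 1" by auto
      have ne: "Complex 0 y + cnj w \<noteq> 0" using w by (auto simp: complex_eq_iff)
      have "((\<lambda>x. Complex x y) \<longlongrightarrow> Complex 0 y) (at_right 0)"
        unfolding Complex_eq by (intro tendsto_intros)
      then have "((\<lambda>x. h x y) \<longlongrightarrow> (cmod (of_real (1 - (cmod l)\<^sup>2) * szego w (Complex 0 y)))\<^sup>2) (at_right 0)"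
        unfolding h_def szego_def using l ne by (intro tendsto_intros) auto
      then show ?case using l by simp
    qed
  qed
  have "((\<lambda>x. \<integral>y. h x y \<partial>lborel) \<longlongrightarrow> 0) (at_right 0)"
  proof (rule tendsto_at_right_sequentially[of 0 1])
    fix X :: "nat \<Rightarrow> real" assume X: "\<And>n. 0 < X n" "X \<longlonglongrightarrow> 0"
    then have fl: "filterlim X (at_right 0) sequentially"
      by (auto simp: filterlim_at less_imp_neq[OF X(1), symmetric] intro!: always_eventually)
    have "(\<lambda>n. \<integral>y. h (X n) y \<partial>lborel) \<longlonglongrightarrow> (\<integral>y. 0 \<partial>(lborel :: real measure))"
    proof (rule integral_dominated_convergence[where w=H and s="\<lambda>n. h (X n)" and f="\<lambda>_. 0"])
      show "AE y in lborel. (\<lambda>n. h (X n) y) \<longlonglongrightarrow> 0"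
        using lim by eventually_elim (rule filterlim_compose[OF _ fl])
      show "AE y in lborel. norm (h (X n) y) \<le> H y" for n
        using hH[OF X(1)[of n]] by (auto simp: h_def)
    qed (use hm X Hi in auto)
    then show "(\<lambda>n. \<integral>y. h (X n) y \<partial>lborel) \<longlonglongrightarrow> 0" by simp
  qed simp
  then show ?thesis unfolding h_def .
qed

text \<open>The inner product of \<open>\<theta> * szego w\<close> with \<open>\<theta> * g\<close> carries the factor \<open>|\<theta>|^2\<close>. Replacing it by 1
  produces an error that vanishes in the limit; the remaining terms evaluate \<open>g\<close> and \<open>\<theta> * g\<close> at
  \<open>w + 2x\<close> and cancel as \<open>x\<close> tends to 0.\<close>
lemma model_kernel_orthogonal:
  assumes w: "0 < Re w" and g: "g \<in> hardy_H2"
  shows "(line_inner (model_kernel \<theta> w) (\<lambda>s. \<theta> s * g s) \<longlongrightarrow> 0) (at_right 0)"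
proof -
  define E where "E x = (\<integral>y. (of_real (1 - (cmod (\<theta> (Complex x y)))\<^sup>2) * szego w (Complex x y)) * cnj (g (Complex x y)) \<partial>lborel)" for x
  define d where "d x = (\<integral>y. (cmod (of_real (1 - (cmod (\<theta> (Complex x y)))\<^sup>2) * szego w (Complex x y)))\<^sup>2 \<partial>lborel)" for x
  note S = szego_hardy[OF w]
  have eq: "line_inner (model_kernel \<theta> w) (\<lambda>s. \<theta> s * g s) x
      = cnj (\<theta> (w + 2 * of_real x) * g (w + 2 * of_real x)) - cnj (\<theta> w) * cnj (g (w + 2 * of_real x)) + cnj (\<theta> w) * E x" if x: "0 < x" for x
  proof -
    have "line_inner (model_kernel \<theta> w) (\<lambda>s. \<theta> s * g s) x
      = line_inner (szego w) (\<lambda>s. \<theta> s * g s) x + (- cnj (\<theta> w)) * line_inner (\<lambda>z. \<theta> z * szego w z) (\<lambda>s. \<theta> s * g s) x"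
      unfolding model_kernel_def line_inner_cmult[symmetric]
      by (intro line_inner_add hardy_cmult mult_hardy S g x)
    also have "line_inner (szego w) (\<lambda>s. \<theta> s * g s) x = cnj (\<theta> (w + 2 * of_real x) * g (w + 2 * of_real x))"
      by (subst line_inner_cnj) (simp only: line_inner_szego[OF mult_hardy[OF g] x w])
    also have "line_inner (\<lambda>z. \<theta> z * szego w z) (\<lambda>s. \<theta> s * g s) x = line_inner (szego w) g x - E x"
    proof -
      have "\<theta> z * szego w z * cnj (\<theta> z * g z) = szego w z * cnj (g z) - (of_real (1 - (cmod (\<theta> z))\<^sup>2) * szego w z) * cnj (g z)" for z
        using complex_norm_square[of "\<theta> z"] by (simp add: algebra_simps)
      then show ?thesis unfolding line_inner_def E_def
        using line_inner_integrable[OF S g x]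
          sq_integrable_mult[OF sq_integrable_defect[OF x hardy_sq_integrable[OF S x]] sq_integrable_cnj[OF hardy_sq_integrable[OF g x]]]
        by (simp only: Bochner_Integration.integral_diff)
    qed
    also have "line_inner (szego w) g x = cnj (g (w + 2 * of_real x))"
      by (subst line_inner_cnj) (simp only: line_inner_szego[OF g x w])
    finally show ?thesis by (simp add: algebra_simps)
  qed
  have E0: "(E \<longlongrightarrow> 0) (at_right 0)"
  proof (rule Lim_null_comparison)
    have "cmod (E x) \<le> sqrt (d x * (h2_norm g)\<^sup>2)" if x: "0 < x" for x
    proof (rule real_le_rsqrt)
      have "(cmod (E x))\<^sup>2 \<le> d x * line_sq g x"
        using Cauchy_Schwarz_line_integral[OF sq_integrable_defect[OF x hardy_sq_integrable[OF S x]] sq_integrable_cnj[OF hardy_sq_integrable[OF g x]]]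
        by (simp add: E_def d_def line_sq_def)
      also have "\<dots> \<le> d x * (h2_norm g)\<^sup>2"
        by (intro mult_left_mono line_sq_le_norm[OF g x]) (simp add: d_def)
      finally show "(cmod (E x))\<^sup>2 \<le> d x * (h2_norm g)\<^sup>2" .
    qed
    then show "\<forall>\<^sub>F x in at_right 0. cmod (E x) \<le> sqrt (d x * (h2_norm g)\<^sup>2)" by (rule eventually_at_right_0)
    have "((\<lambda>x. sqrt (d x * (h2_norm g)\<^sup>2)) \<longlongrightarrow> sqrt (0 * (h2_norm g)\<^sup>2)) (at_right 0)"
      using defect_szego_tendsto[OF w] unfolding d_def[symmetric] by (intro tendsto_intros)
    then show "((\<lambda>x. sqrt (d x * (h2_norm g)\<^sup>2)) \<longlongrightarrow> 0) (at_right 0)" by simp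
  qed
  have "((\<lambda>x. cnj (\<theta> (w + 2 * of_real x) * g (w + 2 * of_real x)) - cnj (\<theta> w) * cnj (g (w + 2 * of_real x)) + cnj (\<theta> w) * E x)
     \<longlongrightarrow> cnj (\<theta> w * g w) - cnj (\<theta> w) * cnj (g w) + cnj (\<theta> w) * 0) (at_right 0)"
    by (intro tendsto_intros E0 hardy_tendsto hol hardy_holomorphic g w)
  then have "((\<lambda>x. cnj (\<theta> (w + 2 * of_real x) * g (w + 2 * of_real x)) - cnj (\<theta> w) * cnj (g (w + 2 * of_real x)) + cnj (\<theta> w) * E x) \<longlongrightarrow> 0) (at_right 0)"
    by simp
  with eq show ?thesis by (rule tendsto_at_right_0_cong)
qed

lemma model_space_iff:
  "f \<in> model_space \<theta> \<longleftrightarrow> f \<in> hardy_H2 \<and> (\<forall>g\<in>hardy_H2. (line_inner f (\<lambda>s. \<theta> s * g s) \<longlongrightarrow> 0) (at_right 0))"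
proof -
  have "h2_inner f (\<lambda>s. \<theta> s * g s) = 0 \<longleftrightarrow> (line_inner f (\<lambda>s. \<theta> s * g s) \<longlongrightarrow> 0) (at_right 0)"
    if "f \<in> hardy_H2" "g \<in> hardy_H2" for g
    using line_inner_convergent[OF that(1) mult_hardy[OF that(2)]] tendsto_unique[of "at_right (0::real)"] by auto
  then show ?thesis by (auto simp: model_space_def)
qed

lemma model_kernel_in_model_space: "0 < Re w \<Longrightarrow> model_kernel \<theta> w \<in> model_space \<theta>"
  using model_space_iff model_kernel_hardy model_kernel_orthogonal by blast

lemma model_space_hardy: "f \<in> model_space \<theta> \<Longrightarrow> f \<in> hardy_H2"
  by (simp add: model_space_def)

lemma model_space_sum:
  assumes "finite I" "\<And>i. i \<in> I \<Longrightarrow> F i \<in> model_space \<theta>"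
  shows "(\<lambda>z. \<Sum>i\<in>I. c i * F i z) \<in> model_space \<theta>"
  unfolding model_space_iff
proof (intro conjI ballI)
  have F: "F i \<in> hardy_H2" if "i \<in> I" for i using assms(2) that by (simp add: model_space_hardy)
  show "(\<lambda>z. \<Sum>i\<in>I. c i * F i z) \<in> hardy_H2" by (intro hardy_sum hardy_cmult F assms)
  fix g assume g: "g \<in> hardy_H2"
  have "((\<lambda>x. \<Sum>i\<in>I. c i * line_inner (F i) (\<lambda>s. \<theta> s * g s) x) \<longlongrightarrow> (\<Sum>i\<in>I. c i * 0)) (at_right 0)"
    using assms(2) g by (intro tendsto_intros) (auto simp: model_space_iff)
  then show "(line_inner (\<lambda>z. \<Sum>i\<in>I. c i * F i z) (\<lambda>s. \<theta> s * g s) \<longlongrightarrow> 0) (at_right 0)"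
    using tendsto_at_right_0_cong[OF line_inner_sum[OF assms(1) F mult_hardy[OF g]]] by simp
qed

text \<open>The Szego part of the kernel evaluates \<open>f\<close>; the other part pairs \<open>f\<close> with an element of \<open>\<theta> H2\<close>.\<close>
lemma reproducing:
  assumes f: "f \<in> model_space \<theta>" and w: "0 < Re w"
  shows "(line_inner f (model_kernel \<theta> w) \<longlongrightarrow> f w) (at_right 0)"
proof -
  have fH: "f \<in> hardy_H2" using f by (rule model_space_hardy)
  note S = szego_hardy[OF w]
  have eq: "line_inner f (model_kernel \<theta> w) x = f (w + 2 * of_real x) - \<theta> w * line_inner f (\<lambda>z. \<theta> z * szego w z) x" if x: "0 < x" for x
  proof -
    have "line_inner (model_kernel \<theta> w) f x = line_inner (szego w) f x + (- cnj (\<theta> w)) * line_inner (\<lambda>z. \<theta> z * szego w z) f x"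
      unfolding model_kernel_def line_inner_cmult[symmetric]
      by (intro line_inner_add hardy_cmult mult_hardy S fH x)
    then have "cnj (line_inner f (model_kernel \<theta> w) x) = cnj (line_inner f (szego w) x + (- \<theta> w) * line_inner f (\<lambda>z. \<theta> z * szego w z) x)"
      by (simp add: line_inner_cnj[of _ f])
    then have "line_inner f (model_kernel \<theta> w) x = line_inner f (szego w) x + (- \<theta> w) * line_inner f (\<lambda>z. \<theta> z * szego w z) x"
      by (simp only: complex_cnj_cancel_iff)
    then show ?thesis by (simp add: line_inner_szego[OF fH x w])
  qed
  have "((\<lambda>x. f (w + 2 * of_real x) - \<theta> w * line_inner f (\<lambda>z. \<theta> z * szego w z) x) \<longlongrightarrow> f w - \<theta> w * 0) (at_right 0)"
    using f S by (intro tendsto_intros hardy_tendsto hardy_holomorphic fH w) (auto simp: model_space_iff)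
  then have "((\<lambda>x. f (w + 2 * of_real x) - \<theta> w * line_inner f (\<lambda>z. \<theta> z * szego w z) x) \<longlongrightarrow> f w) (at_right 0)" by simp
  with eq show ?thesis by (rule tendsto_at_right_0_cong)
qed

end

section \<open>A bilinear inequality for slowly varying sequences\<close>

definition pair_sum :: "'i set \<Rightarrow> ('i \<Rightarrow> real) \<Rightarrow> ('i \<Rightarrow> real) \<Rightarrow> ('i \<Rightarrow> 'i \<Rightarrow> real) \<Rightarrow> real"
  where "pair_sum I m a k = (\<Sum>i\<in>I. \<Sum>j\<in>I. m i * a i * (m j * a j) * k i j)"

lemma pair_sum_mono:
  assumes "\<And>i. 0 \<le> m i" "\<And>i. 0 \<le> a i" "\<And>i j. i \<in> I \<Longrightarrow> j \<in> I \<Longrightarrow> k i j \<le> k' i j"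
  shows "pair_sum I m a k \<le> pair_sum I m a k'"
  unfolding pair_sum_def using assms by (intro sum_mono mult_left_mono mult_nonneg_nonneg) auto

lemma pair_sum_cmult: "pair_sum I m a (\<lambda>i j. c * k i j) = c * pair_sum I m a k"
  unfolding pair_sum_def sum_distrib_left by (intro sum.cong refl) simp

lemma pair_sum_add: "pair_sum I m a (\<lambda>i j. k i j + k' i j) = pair_sum I m a k + pair_sum I m a k'"
  unfolding pair_sum_def by (simp only: distrib_left sum.distrib)

text \<open>A discrete form of Hardy's inequality: the hypothesis says that the points with \<open>p \<ge> t\<close> have mass at
  most \<open>C / t\<close>, for every value \<open>t\<close> of \<open>p\<close>. The points are added in the order of decreasing \<open>p\<close>, so that a new point meets every
  earlier one with the weight \<open>p x\<close>. The cross terms are absorbed by carrying along the term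
  \<open>C * B^2 / M\<close>, where \<open>B\<close> and \<open>M\<close> are the sums of \<open>m * a\<close> and of \<open>m\<close> over the earlier points.\<close>
lemma hardy_min_kernel:
  fixes p m a :: "'i \<Rightarrow> real"
  assumes "finite I"
    and m: "\<And>i. i \<in> I \<Longrightarrow> 0 \<le> m i" and p: "\<And>i. i \<in> I \<Longrightarrow> 0 \<le> p i" and a: "\<And>i. i \<in> I \<Longrightarrow> 0 \<le> a i"
    and C: "\<And>i. i \<in> I \<Longrightarrow> p i * (\<Sum>j\<in>{j\<in>I. p i \<le> p j}. m j) \<le> C"
    and C0: "0 \<le> C"
  shows "pair_sum I m a (\<lambda>i j. min (p i) (p j)) \<le> 4 * C * (\<Sum>i\<in>I. m i * (a i)\<^sup>2)"
proof -
  have "(\<Sum>i\<in>I. \<Sum>j\<in>I. m i * a i * (m j * a j) * min (p i) (p j))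
      + C * ((\<Sum>i\<in>I. m i * a i)\<^sup>2 / (\<Sum>i\<in>I. m i)) \<le> 4 * C * (\<Sum>i\<in>I. m i * (a i)\<^sup>2)"
    using assms(1) m p a C
  proof (induction rule: finite_ranking_induct[where f="\<lambda>i. - p i"])
    case empty
    then show ?case by simp
  next
    case (insert x S)
    show ?case
    proof (cases "x \<in> S")
      case True
      then show ?thesis using insert by (simp add: insert_absorb)
    next
      case xS: False
      define Q where "Q = (\<Sum>i\<in>S. \<Sum>j\<in>S. m i * a i * (m j * a j) * min (p i) (p j))"
      define B where "B = (\<Sum>i\<in>S. m i * a i)"
      define M where "M = (\<Sum>i\<in>S. m i)"
      define b where "b = m x * a x"
      have C': "p i * (\<Sum>j\<in>{j\<in>S. p i \<le> p j}. m j) \<le> C" if "i \<in> S" for i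
      proof -
        have "(\<Sum>j\<in>{j\<in>S. p i \<le> p j}. m j) \<le> (\<Sum>j\<in>{j\<in>insert x S. p i \<le> p j}. m j)"
          using insert.prems(1) insert.hyps(1) by (intro sum_mono2) auto
        then have "p i * (\<Sum>j\<in>{j\<in>S. p i \<le> p j}. m j) \<le> p i * (\<Sum>j\<in>{j\<in>insert x S. p i \<le> p j}. m j)"
          using insert.prems(2)[of i] that by (intro mult_left_mono) auto
        also have "\<dots> \<le> C" using insert.prems(4)[of i] that by auto
        finally show ?thesis .
      qed
      have IH: "Q + C * (B\<^sup>2 / M) \<le> 4 * C * (\<Sum>i\<in>S. m i * (a i)\<^sup>2)"
        unfolding Q_def B_def M_def
        using insert.IH insert.prems(1,2,3) C' by simp
      have px: "p x \<le> p y" if "y \<in> S" for y using insert.hyps(2)[OF that] by simp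
      have M0: "0 \<le> M" unfolding M_def using insert.prems(1) by (intro sum_nonneg) auto
      have B0: "0 \<le> B" unfolding B_def using insert.prems(1,3) by (intro sum_nonneg) auto
      have m0: "0 \<le> m x" "0 \<le> a x" "0 \<le> p x" using insert.prems by auto
      have "{j \<in> insert x S. p x \<le> p j} = insert x S" using px by auto
      then have pM: "p x * (m x + M) \<le> C"
        using insert.prems(4)[of x] xS insert.hyps(1) by (simp add: M_def)
      have s1: "(\<Sum>j\<in>S. m x * a x * (m j * a j) * min (p x) (p j)) = p x * b * B"
        unfolding B_def b_def sum_distrib_left using px by (intro sum.cong) (auto simp: min_def)
      have s2: "(\<Sum>i\<in>S. m i * a i * (m x * a x) * min (p i) (p x)) = p x * b * B"
        unfolding B_def b_def sum_distrib_left using px by (intro sum.cong) (auto simp: min_def antisym)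
      have Q': "(\<Sum>i\<in>insert x S. \<Sum>j\<in>insert x S. m i * a i * (m j * a j) * min (p i) (p j))
        = Q + p x * (2 * b * B + b\<^sup>2)"
      proof -
        have "(\<Sum>i\<in>insert x S. \<Sum>j\<in>insert x S. m i * a i * (m j * a j) * min (p i) (p j))
          = (b * b * p x + (\<Sum>j\<in>S. m x * a x * (m j * a j) * min (p x) (p j)))
            + ((\<Sum>i\<in>S. m i * a i * (m x * a x) * min (p i) (p x)) + Q)"
          using xS insert.hyps(1) by (simp add: sum.distrib Q_def b_def)
        then show ?thesis unfolding s1 s2 by (simp add: power2_eq_square algebra_simps)
      qed
      have step: "p x * (2 * b * B + b\<^sup>2) + C * ((b + B)\<^sup>2 / (m x + M)) \<le> C * (B\<^sup>2 / M) + 4 * C * (m x * (a x)\<^sup>2)"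
      proof (cases "m x = 0")
        case True
        then show ?thesis by (simp add: b_def)
      next
        case False
        then have mx: "0 < m x" using m0 by simp
        have pC: "p x \<le> C / (m x + M)" using pM mx M0 by (simp add: field_simps)
        have e: "m x * (a x)\<^sup>2 = b\<^sup>2 / m x" using mx by (simp add: b_def power2_eq_square)
        have b0: "0 \<le> b" using m0 by (simp add: b_def)
        have "p x * (2 * b * B + b\<^sup>2) \<le> C / (m x + M) * (2 * b * B + b\<^sup>2)"
          using b0 B0 by (intro mult_right_mono[OF pC]) auto
        moreover have "(2 * b * B + b\<^sup>2) / (m x + M) + (b + B)\<^sup>2 / (m x + M) \<le> B\<^sup>2 / M + 4 * (b\<^sup>2 / m x)"
        proof (cases "M = 0")
          case True
          then have "\<forall>i\<in>S. m i = 0" unfolding M_def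
            using insert.prems(1) insert.hyps(1) by (subst (asm) sum_nonneg_eq_0_iff) auto
          then have "B = 0" by (simp add: B_def)
          then show ?thesis using True mx by (simp add: field_simps)
        next
          case False
          then have M: "0 < M" using M0 by simp
          \<comment> \<open>Completing the square shows that the new point costs at most four times its own term.\<close>
          have "B\<^sup>2 / M + 4 * (b\<^sup>2 / m x) - ((2 * b * B + b\<^sup>2) / (m x + M) + (b + B)\<^sup>2 / (m x + M))
             = ((2 * b * M - B * m x)\<^sup>2 + 2 * b\<^sup>2 * M * m x) / (M * m x * (m x + M))"
            using M mx by (simp add: divide_simps add_pos_pos less_imp_neq[symmetric])
              (simp add: algebra_simps power2_eq_square)
          also have "\<dots> \<ge> 0" using M mx by (intro divide_nonneg_nonneg add_nonneg_nonneg mult_nonneg_nonneg) auto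
          finally show ?thesis by simp
        qed
        then have "C * ((2 * b * B + b\<^sup>2) / (m x + M) + (b + B)\<^sup>2 / (m x + M)) \<le> C * (B\<^sup>2 / M + 4 * (b\<^sup>2 / m x))"
          by (intro mult_left_mono C0)
        moreover have "C / (m x + M) * (2 * b * B + b\<^sup>2) = C * ((2 * b * B + b\<^sup>2) / (m x + M))"
          "C * (B\<^sup>2 / M + 4 * (b\<^sup>2 / m x)) = C * (B\<^sup>2 / M) + 4 * C * (b\<^sup>2 / m x)"
          "C * ((2 * b * B + b\<^sup>2) / (m x + M) + (b + B)\<^sup>2 / (m x + M))
            = C * ((2 * b * B + b\<^sup>2) / (m x + M)) + C * ((b + B)\<^sup>2 / (m x + M))"
          by (simp_all only: distrib_left[of C] times_divide_eq_left times_divide_eq_right mult_ac)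
        ultimately show ?thesis unfolding e by linarith
      qed
      show ?thesis
      proof -
        have "(\<Sum>i\<in>insert x S. m i * a i) = b + B" "(\<Sum>i\<in>insert x S. m i) = m x + M"
          "4 * C * (\<Sum>i\<in>insert x S. m i * (a i)\<^sup>2) = 4 * C * (m x * (a x)\<^sup>2) + 4 * C * (\<Sum>i\<in>S. m i * (a i)\<^sup>2)"
          using xS insert.hyps(1) by (simp_all add: B_def M_def b_def distrib_left)
        then show ?thesis using step IH unfolding Q' by (simp only:)
      qed
    qed
  qed
  moreover have "0 \<le> C * ((\<Sum>i\<in>I. m i * a i)\<^sup>2 / (\<Sum>i\<in>I. m i))"
    using C0 m by (intro mult_nonneg_nonneg divide_nonneg_nonneg sum_nonneg) auto
  ultimately show ?thesis unfolding pair_sum_def by linarith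
qed

lemma sum_rotate:
  "(\<Sum>i\<in>I. \<Sum>j\<in>J. \<Sum>k\<in>K. f i j k) = (\<Sum>k\<in>K. \<Sum>i\<in>I. \<Sum>j\<in>J. f i j k)"
  by (subst (2) sum.swap, subst sum.swap) (rule refl)

lemma powi2_simps:
  "(2::real) powi (k + 1) = 2 * 2 powi k" "(2::real) powi (k - 1) = 2 powi k / 2"
  by (simp_all add: power_int_add power_int_diff)

text \<open>For \<open>w = 2^r\<close> and \<open>s\<close> in the dyadic block from \<open>2^n\<close> to \<open>2^(n+1)\<close>, this is a lower bound for the
  integrand \<open>w / |w + s|^2\<close> of the kernel condition.\<close>
definition dyadic_weight :: "int \<Rightarrow> int \<Rightarrow> real"
  where "dyadic_weight r n = 2 powi r / (2 powi r + 2 powi (n + 1))\<^sup>2"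

lemma dyadic_weight_pos: "0 < dyadic_weight r n"
  unfolding dyadic_weight_def by (intro divide_pos_pos zero_less_power add_pos_pos) auto

lemma powi2_cancel: "2 powi (- r) * (2 powi r :: real) = 1"
  by (simp add: power_int_minus)

lemma dyadic_weight_ge: "2 powi r * (2 powi (- max r n))\<^sup>2 \<le> 9 * dyadic_weight r n"
proof -
  let ?M = "(2::real) powi (max r n)"
  have "(2::real) powi r \<le> ?M" "(2::real) powi n \<le> ?M" by (auto intro: power_int_increasing)
  then have "(2 powi r + 2 powi (n + 1))\<^sup>2 \<le> (3 * ?M)\<^sup>2"
    by (intro power_mono) (auto simp: powi2_simps add_nonneg_nonneg)
  then have "2 powi r * (2 powi (- max r n))\<^sup>2 * (2 powi r + 2 powi (n + 1))\<^sup>2 \<le> 2 powi r * (2 powi (- max r n))\<^sup>2 * (3 * ?M)\<^sup>2"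
    by (intro mult_left_mono) auto
  also have "\<dots> = 9 * 2 powi r * (2 powi (- max r n) * ?M)\<^sup>2"
    by (simp only: power_mult_distrib) (simp add: mult_ac)
  also have "\<dots> = 9 * 2 powi r" by (simp only: powi2_cancel) simp
  finally show ?thesis unfolding dyadic_weight_def
    by (subst times_divide_eq_right, subst pos_le_divide_eq) (intro zero_less_power add_pos_pos, simp_all)
qed

text \<open>The sequences \<open>2^j\<close> and \<open>2^-j\<close> both satisfy \<open>x (j+1) + x (j-1) = 5/2 * x j\<close>, so the last assumption is
  concavity relative to these two sequences. The second difference \<open>D\<close> below measures how far \<open>v\<close> is
  from being a combination of them.\<close>
locale hyperbolic_concave =
  fixes v :: "int \<Rightarrow> real"
  assumes nonneg: "0 \<le> v j"
    and up: "v (j + 1) \<le> 2 * v j"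
    and down: "v (j - 1) \<le> 2 * v j"
    and conc: "v (j + 1) + v (j - 1) \<le> 5 / 2 * v j"
begin

definition D :: "int \<Rightarrow> real" where "D j = v j - 2 / 5 * (v (j + 1) + v (j - 1))"

lemma D_nonneg: "0 \<le> D j"
  using conc[of j] by (simp add: D_def)

text \<open>The sum telescopes. For \<open>v\<close> in place of \<open>D\<close> such a bound fails: if \<open>v j = 2^j\<close>, all terms are equal to 1.
  The gain is what makes \<open>D\<close> useful.\<close>
lemma sum_D_upper: 
  assumes "r \<le> R" shows "(\<Sum>k\<in>{r..R}. 2 powi (-k) * D k) \<le> 4 / 5 * (2 powi (-r) * v r)"
proof -
  define g where "g j = (2::real) powi (-j) * (2 * v j - v (j - 1))" for j
  have Dg: "2 powi (-k) * D k = 2 / 5 * (g k - g (k + 1))" for k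
  proof -
    have "(2::real) powi (-(k + 1)) = 2 powi (-k) / 2" using powi2_simps(2)[of "-k"] by simp
    then show ?thesis unfolding g_def D_def by (simp add: field_simps)
  qed
  have "(\<Sum>k\<in>{r..R}. 2 powi (-k) * D k) = 2 / 5 * (g r - g (R + 1))"
    using assms
  proof (induction R rule: int_ge_induct)
    case base
    then show ?case using Dg by simp
  next
    case (step i)
    have "{r..i + 1} = insert (i + 1) {r..i}" using step.hyps by auto
    then show ?case using step Dg[of "i + 1"] by (simp add: algebra_simps)
  qed
  moreover have "0 \<le> g (R + 1)" unfolding g_def using down[of "R + 1"] by simp
  moreover have "g r \<le> 2 * (2 powi (-r) * v r)" unfolding g_def using nonneg[of "r - 1"]
    by (simp add: algebra_simps)
  ultimately show ?thesis by simp
qed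

lemma sum_D_lower:
  assumes "L \<le> r" shows "(\<Sum>k\<in>{L..r}. 2 powi k * D k) \<le> 4 / 5 * (2 powi r * v r)"
proof -
  define g where "g j = (2::real) powi j * (2 * v j - v (j + 1))" for j
  have Dg: "2 powi k * D k = 2 / 5 * (g k - g (k - 1))" for k
    unfolding g_def D_def by (simp add: powi2_simps field_simps)
  have "(\<Sum>k\<in>{L..r}. 2 powi k * D k) = 2 / 5 * (g r - g (L - 1))"
    using assms
  proof (induction r rule: int_ge_induct)
    case base
    then show ?case using Dg by simp
  next
    case (step i)
    have "{L..i + 1} = insert (i + 1) {L..i}" using step.hyps by auto
    then show ?case using step Dg[of "i + 1"] by (simp add: algebra_simps)
  qed
  moreover have "0 \<le> g (L - 1)" unfolding g_def using up[of "L - 1"] by simp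
  moreover have "g r \<le> 2 * (2 powi r * v r)" unfolding g_def using nonneg[of "r + 1"]
    by (simp add: algebra_simps)
  ultimately show ?thesis by simp
qed

text \<open>Up to its two end values, the sum of \<open>v\<close> over an interval is recovered from \<open>D\<close>.\<close>
lemma sum_le_sum_D:
  assumes "i \<le> j" shows "(\<Sum>k\<in>{i..j}. v k) \<le> 5 * (\<Sum>k\<in>{i..j}. D k) + 4 * (v i + v j)"
proof -
  have s1: "(\<Sum>k\<in>{i..j}. v (k + 1)) = (\<Sum>k\<in>{i..j}. v k) - v i + v (j + 1)"
    using assms
  proof (induction j rule: int_ge_induct)
    case (step j)
    have "{i..j + 1} = insert (j + 1) {i..j}" using step.hyps by auto
    then show ?case using step by simp
  qed simp
  have s2: "(\<Sum>k\<in>{i..j}. v (k - 1)) = (\<Sum>k\<in>{i..j}. v k) - v j + v (i - 1)"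
    using assms
  proof (induction j rule: int_ge_induct)
    case (step j)
    have "{i..j + 1} = insert (j + 1) {i..j}" using step.hyps by auto
    then show ?case using step by simp
  qed simp
  have "(\<Sum>k\<in>{i..j}. D k) = (\<Sum>k\<in>{i..j}. v k) - 2 / 5 * ((\<Sum>k\<in>{i..j}. v (k + 1)) + (\<Sum>k\<in>{i..j}. v (k - 1)))"
    by (simp only: D_def sum_subtractf sum_distrib_left[symmetric] sum.distrib)
  then have "5 * (\<Sum>k\<in>{i..j}. D k) = 5 * (\<Sum>k\<in>{i..j}. v k) - 2 * ((\<Sum>k\<in>{i..j}. v (k + 1)) + (\<Sum>k\<in>{i..j}. v (k - 1)))"
    by (simp add: field_simps)
  then show ?thesis unfolding s1 s2 using up[of j] down[of i] nonneg[of i] nonneg[of j] by simp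
qed

lemma antimono_down: "i \<le> j \<Longrightarrow> 2 powi (-j) * v j \<le> 2 powi (-i) * v i"
proof (induction j rule: int_ge_induct)
  case (step j)
  have "(2::real) powi (-(j + 1)) * v (j + 1) \<le> 2 powi (-(j + 1)) * (2 * v j)"
    by (intro mult_left_mono up) simp
  also have "\<dots> = 2 powi (-j) * v j" using powi2_simps(2)[of "-j"] by simp
  finally show ?case using step by simp
qed simp

lemma mono_up: "i \<le> j \<Longrightarrow> 2 powi i * v i \<le> 2 powi j * v j"
proof (induction j rule: int_ge_induct)
  case (step j)
  have "v j \<le> 2 * v (j + 1)" using down[of "j + 1"] by simp
  then have "2 powi j * v j \<le> 2 powi j * (2 * v (j + 1))"
    by (intro mult_left_mono) auto
  also have "\<dots> = 2 powi (j + 1) * v (j + 1)" by (simp add: powi2_simps)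
  finally show ?case using step by simp
qed simp

text \<open>By \<open>sum_le_sum_D\<close> the kernel splits into a part with the sum of \<open>D\<close> and two parts with the values
  of \<open>v\<close> at the end points. The end-point parts are Hardy kernels \<open>min (p i) (p j)\<close>: with
  \<open>p i = 2^-i * v i\<close> in the first case, and with \<open>p i = 2^i * v i\<close> after rescaling the masses in the
  second. The part with \<open>D\<close> is a sum over \<open>k\<close> of \<open>D k\<close> times a product of two sums, over the points to
  the left and to the right of \<open>k\<close>; by Cauchy-Schwarz and the bounds for the tails of \<open>D\<close> it is controlled by
  the two Hardy kernels.\<close>
lemma carleson_kernel_sum:
  fixes I :: "int set" and m a :: "int \<Rightarrow> real"
  assumes fin: "finite I" and m: "\<And>i. 0 \<le> m i" and a: "\<And>i. 0 \<le> a i"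
    and c: "\<And>r. v r * (\<Sum>n\<in>I. m n * dyadic_weight r n) \<le> c"
    and c0: "0 \<le> c"
  shows "pair_sum I m a (\<lambda>i j. 2 powi (- max i j) * (\<Sum>k\<in>{min i j..max i j}. v k))
      \<le> 576 * c * (\<Sum>i\<in>I. m i * (a i)\<^sup>2)"
proof -
  define X where "X = (\<Sum>i\<in>I. m i * (a i)\<^sup>2)"
  have both: "v r * (\<Sum>n\<in>A. m n * (2 powi r * (2 powi (- max r n))\<^sup>2)) \<le> 9 * c" if A: "A \<subseteq> I" for A r
  proof -
    have "(\<Sum>n\<in>A. m n * (2 powi r * (2 powi (- max r n))\<^sup>2)) \<le> (\<Sum>n\<in>A. m n * (9 * dyadic_weight r n))"
      by (intro sum_mono mult_left_mono dyadic_weight_ge m)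
    also have "\<dots> \<le> (\<Sum>n\<in>I. m n * (9 * dyadic_weight r n))"
      using fin A m less_imp_le[OF dyadic_weight_pos] by (intro sum_mono2) auto
    also have "\<dots> = 9 * (\<Sum>n\<in>I. m n * dyadic_weight r n)"
      unfolding sum_distrib_left by (simp only: mult_ac)
    finally have "v r * (\<Sum>n\<in>A. m n * (2 powi r * (2 powi (- max r n))\<^sup>2)) \<le> v r * (9 * (\<Sum>n\<in>I. m n * dyadic_weight r n))"
      by (intro mult_left_mono nonneg)
    also have "\<dots> \<le> 9 * c" using c[of r] by linarith
    finally show ?thesis .
  qed
  have low: "2 powi (-r) * v r * (\<Sum>n\<in>{n\<in>I. n \<le> r}. m n) \<le> 9 * c" for r
  proof -
    have "2 powi r * (2 powi (- r))\<^sup>2 = 2 powi (- r) * (2 powi (- r) * (2 powi r :: real))"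
      by (simp only: power2_eq_square mult_ac)
    then have "(2::real) powi r * (2 powi (- r))\<^sup>2 = 2 powi (- r)" by (simp only: powi2_cancel mult_1_right)
    then have "(\<Sum>n\<in>{n\<in>I. n \<le> r}. m n * (2 powi r * (2 powi (- max r n))\<^sup>2)) = (\<Sum>n\<in>{n\<in>I. n \<le> r}. m n * 2 powi (- r))"
      by (intro sum.cong refl) (simp add: max_absorb1)
    with both[of "{n\<in>I. n \<le> r}" r] show ?thesis unfolding sum_distrib_right[symmetric] by (simp add: mult_ac)
  qed
  have high: "2 powi r * v r * (\<Sum>n\<in>{n\<in>I. r \<le> n}. m n * (2 powi (-n))\<^sup>2) \<le> 9 * c" for r
  proof -
    have "(\<Sum>n\<in>{n\<in>I. r \<le> n}. m n * (2 powi r * (2 powi (- max r n))\<^sup>2)) = 2 powi r * (\<Sum>n\<in>{n\<in>I. r \<le> n}. m n * (2 powi (-n))\<^sup>2)"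
      unfolding sum_distrib_left by (intro sum.cong refl) (simp add: max_absorb2)
    with both[of "{n\<in>I. r \<le> n}" r] show ?thesis by (simp add: mult_ac)
  qed
  have K1: "pair_sum I m a (\<lambda>i j. 2 powi (- max i j) * v (max i j)) \<le> 36 * c * X"
  proof -
    let ?p = "\<lambda>i. 2 powi (-i) * v i"
    have "pair_sum I m a (\<lambda>i j. min (?p i) (?p j)) \<le> 4 * (9 * c) * (\<Sum>i\<in>I. m i * (a i)\<^sup>2)"
    proof (rule hardy_min_kernel[OF fin])
      fix i assume i: "i \<in> I"
      define S where "S = {j\<in>I. ?p i \<le> ?p j}"
      have S: "finite S" "i \<in> S" using fin i by (auto simp: S_def)
      define s where "s = Max S"
      have s: "s \<in> S" unfolding s_def using S by (intro Max_in) auto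
      have "?p i * sum m S \<le> ?p s * (\<Sum>n\<in>{n\<in>I. n \<le> s}. m n)"
      proof (rule mult_mono)
        show "?p i \<le> ?p s" using s by (simp add: S_def)
        show "sum m S \<le> (\<Sum>n\<in>{n\<in>I. n \<le> s}. m n)"
          using fin m S by (intro sum_mono2) (auto simp: s_def S_def)
      qed (use nonneg m in \<open>auto intro!: sum_nonneg\<close>)
      also have "\<dots> \<le> 9 * c" by (rule low)
      finally show "?p i * (\<Sum>j\<in>{j\<in>I. ?p i \<le> ?p j}. m j) \<le> 9 * c" unfolding S_def .
    qed (use nonneg m a c0 in auto)
    moreover have "min (?p i) (?p j) = 2 powi (- max i j) * v (max i j)" for i j
      using antimono_down[of i j] antimono_down[of j i] by (cases "i \<le> j") (auto simp: max_def min_def)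
    ultimately show ?thesis by (simp add: X_def)
  qed
  have K2: "pair_sum I m a (\<lambda>i j. 2 powi (- max i j) * v (min i j)) \<le> 36 * c * X"
  proof -
    let ?p = "\<lambda>i. 2 powi i * v i" and ?m = "\<lambda>i. m i * (2 powi (-i))\<^sup>2" and ?a = "\<lambda>i. 2 powi i * a i"
    have "pair_sum I ?m ?a (\<lambda>i j. min (?p i) (?p j)) \<le> 4 * (9 * c) * (\<Sum>i\<in>I. ?m i * (?a i)\<^sup>2)"
    proof (rule hardy_min_kernel[OF fin])
      fix i assume i: "i \<in> I"
      define S where "S = {j\<in>I. ?p i \<le> ?p j}"
      have S: "finite S" "i \<in> S" using fin i by (auto simp: S_def)
      define s where "s = Min S"
      have s: "s \<in> S" unfolding s_def using S by (intro Min_in) auto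
      have "?p i * sum ?m S \<le> ?p s * (\<Sum>n\<in>{n\<in>I. s \<le> n}. ?m n)"
      proof (rule mult_mono)
        show "?p i \<le> ?p s" using s by (simp add: S_def)
        show "sum ?m S \<le> (\<Sum>n\<in>{n\<in>I. s \<le> n}. ?m n)"
          using fin m S by (intro sum_mono2) (auto simp: s_def S_def)
      qed (use nonneg m in \<open>auto intro!: sum_nonneg\<close>)
      also have "\<dots> \<le> 9 * c" by (rule high)
      finally show "?p i * (\<Sum>j\<in>{j\<in>I. ?p i \<le> ?p j}. ?m j) \<le> 9 * c" unfolding S_def .
    qed (use nonneg m a c0 in auto)
    moreover have "?m i * ?a i * (?m j * ?a j) * min (?p i) (?p j) = m i * a i * (m j * a j) * (2 powi (- max i j) * v (min i j))" for i j
    proof -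
      have 1: "min (?p i) (?p j) = 2 powi (min i j) * v (min i j)"
        using mono_up[of i j] mono_up[of j i] by (cases "i \<le> j") (auto simp: max_def min_def)
      have "?m i * ?a i * (?m j * ?a j) = m i * a i * (m j * a j) * (2 powi (-i) * 2 powi (-j)) * (2 powi (-i) * 2 powi i) * (2 powi (-j) * 2 powi j)"
        by (simp only: power2_eq_square mult_ac)
      also have "\<dots> = m i * a i * (m j * a j) * (2 powi (-i) * 2 powi (-j))" by (simp only: powi2_cancel mult_1_right)
      also have "2 powi (-i) * 2 powi (-j) = (2::real) powi (- max i j) * 2 powi (- min i j)"
        by (simp add: max_def min_def)
      finally have 2: "?m i * ?a i * (?m j * ?a j) = m i * a i * (m j * a j) * (2 powi (- max i j) * 2 powi (- min i j))" .
      have "?m i * ?a i * (?m j * ?a j) * min (?p i) (?p j)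
        = m i * a i * (m j * a j) * (2 powi (- max i j) * v (min i j)) * (2 powi (- min i j) * 2 powi (min i j))"
        unfolding 1 2 by (simp only: mult_ac)
      then show ?thesis by (simp only: powi2_cancel mult_1_right)
    qed
    moreover have "?m i * (?a i)\<^sup>2 = m i * (a i)\<^sup>2" for i
    proof -
      have "?m i * (?a i)\<^sup>2 = m i * (a i)\<^sup>2 * (2 powi (-i) * 2 powi i)\<^sup>2" by (simp only: power_mult_distrib mult_ac)
      then show ?thesis by (simp only: powi2_cancel) simp
    qed
    ultimately show ?thesis by (simp add: X_def pair_sum_def)
  qed
  have K3: "pair_sum I m a (\<lambda>i j. 2 powi (- max i j) * (\<Sum>k\<in>{min i j..max i j}. D k)) \<le> 288 / 5 * c * X"
  proof (cases "I = {}")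
    case True then show ?thesis by (simp add: X_def pair_sum_def)
  next
    case False
    define l h where "l = Min I" and "h = Max I"
    have lh: "l \<le> i" "i \<le> h" if "i \<in> I" for i using that fin by (auto simp: l_def h_def)
    define b where "b i = m i * a i" for i
    have b0: "0 \<le> b i" for i using m a by (simp add: b_def)
    define A where "A k i = of_bool (i \<le> k) * b i" for k i
    define B where "B k j = of_bool (k \<le> j) * (2 powi (-j) * b j)" for k j
    have A0: "0 \<le> A k i" "0 \<le> B k i" for k i using b0 by (auto simp: A_def B_def)
    let ?A = "\<lambda>k. \<Sum>i\<in>I. A k i" and ?B = "\<lambda>k. \<Sum>j\<in>I. B k j"
    have "pair_sum I m a (\<lambda>i j. 2 powi (- max i j) * (\<Sum>k\<in>{min i j..max i j}. D k))
      \<le> (\<Sum>i\<in>I. \<Sum>j\<in>I. \<Sum>k\<in>{l..h}. D k * (A k i * B k j + A k j * B k i))"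
      unfolding pair_sum_def b_def[symmetric]
    proof (intro sum_mono)
      fix i j assume ij: "i \<in> I" "j \<in> I"
      have "b i * b j * (2 powi (- max i j) * (\<Sum>k\<in>{min i j..max i j}. D k))
         = (\<Sum>k\<in>{l..h}. if k \<in> {min i j..max i j} then b i * b j * (2 powi (- max i j) * D k) else 0)"
        unfolding sum_distrib_left using lh[OF ij(1)] lh[OF ij(2)]
        by (intro sum.mono_neutral_cong_left) auto
      also have "\<dots> \<le> (\<Sum>k\<in>{l..h}. D k * (A k i * B k j + A k j * B k i))"
      proof (intro sum_mono)
        fix k
        show "(if k \<in> {min i j..max i j} then b i * b j * (2 powi (- max i j) * D k) else 0) \<le> D k * (A k i * B k j + A k j * B k i)"
        proof (cases "k \<in> {min i j..max i j}")
          case False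
          then show ?thesis by (simp only: if_False) (intro mult_nonneg_nonneg add_nonneg_nonneg D_nonneg A0)
        next
          case k: True
          show ?thesis
            using k D_nonneg[of k] b0
            by (cases "i \<le> j") (simp_all add: max_def min_def A_def B_def algebra_simps)
        qed
      qed
      finally show "b i * b j * (2 powi (- max i j) * (\<Sum>k\<in>{min i j..max i j}. D k)) \<le> \<dots>" .
    qed
    also have "\<dots> = (\<Sum>k\<in>{l..h}. \<Sum>i\<in>I. \<Sum>j\<in>I. D k * (A k i * B k j + A k j * B k i))"
      by (rule sum_rotate)
    also have "\<dots> = (\<Sum>k\<in>{l..h}. D k * (?A k * ?B k + ?B k * ?A k))"
      unfolding sum_product unfolding sum.distrib[symmetric] unfolding sum_distrib_left
      by (intro sum.cong refl) (simp add: algebra_simps)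
    also have "\<dots> \<le> (\<Sum>k\<in>{l..h}. 2 powi (-k) * D k * (?A k)\<^sup>2 + 2 powi k * D k * (?B k)\<^sup>2)"
    proof (intro sum_mono)
      fix k
      have pk: "(2::real) powi (-k) > 0" by simp
      have pk': "(2::real) powi k = 1 / 2 powi (-k)" by (simp add: power_int_minus field_simps)
      have "0 \<le> (2 powi (-k) * ?A k - ?B k)\<^sup>2 / 2 powi (-k)" by simp
      also have "\<dots> = 2 powi (-k) * (?A k)\<^sup>2 + 2 powi k * (?B k)\<^sup>2 - (?A k * ?B k + ?B k * ?A k)"
        unfolding pk' using pk by (simp add: power2_eq_square field_simps)
      finally have "?A k * ?B k + ?B k * ?A k \<le> 2 powi (-k) * (?A k)\<^sup>2 + 2 powi k * (?B k)\<^sup>2" by simp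
      from mult_left_mono[OF this D_nonneg[of k]]
      show "D k * (?A k * ?B k + ?B k * ?A k) \<le> 2 powi (-k) * D k * (?A k)\<^sup>2 + 2 powi k * D k * (?B k)\<^sup>2"
        by (simp add: algebra_simps)
    qed
    also have "\<dots> = (\<Sum>k\<in>{l..h}. 2 powi (-k) * D k * (?A k)\<^sup>2) + (\<Sum>k\<in>{l..h}. 2 powi k * D k * (?B k)\<^sup>2)"
      by (rule sum.distrib)
    also have "\<dots> \<le> 4 / 5 * (36 * c * X) + 4 / 5 * (36 * c * X)"
    proof (rule add_mono)
      have "(\<Sum>k\<in>{l..h}. 2 powi (-k) * D k * (?A k)\<^sup>2)
        = (\<Sum>k\<in>{l..h}. \<Sum>i\<in>I. \<Sum>j\<in>I. b i * b j * (of_bool (max i j \<le> k) * (2 powi (-k) * D k)))"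
        unfolding A_def power2_eq_square sum_product unfolding sum_distrib_left
        by (intro sum.cong refl) (auto simp: of_bool_def)
      also have "\<dots> = (\<Sum>i\<in>I. \<Sum>j\<in>I. \<Sum>k\<in>{l..h}. b i * b j * (of_bool (max i j \<le> k) * (2 powi (-k) * D k)))"
        by (rule sum_rotate[symmetric])
      also have "\<dots> \<le> pair_sum I m a (\<lambda>i j. 4 / 5 * (2 powi (- max i j) * v (max i j)))"
        unfolding pair_sum_def b_def[symmetric]
      proof (intro sum_mono)
        fix i j assume ij: "i \<in> I" "j \<in> I"
        have "(\<Sum>k\<in>{l..h}. of_bool (max i j \<le> k) * (2 powi (-k) * D k)) = (\<Sum>k\<in>{max i j..h}. 2 powi (-k) * D k)"
          using lh[OF ij(1)] lh[OF ij(2)] by (intro sum.mono_neutral_cong_right) auto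
        also have "\<dots> \<le> 4 / 5 * (2 powi (- max i j) * v (max i j))"
          using lh[OF ij(1)] lh[OF ij(2)] by (intro sum_D_upper) auto
        finally show "(\<Sum>k\<in>{l..h}. b i * b j * (of_bool (max i j \<le> k) * (2 powi (-k) * D k)))
            \<le> b i * b j * (4 / 5 * (2 powi (- max i j) * v (max i j)))"
          unfolding sum_distrib_left[symmetric] by (intro mult_left_mono) (auto intro!: mult_nonneg_nonneg b0)
      qed
      also have "\<dots> \<le> 4 / 5 * (36 * c * X)" unfolding pair_sum_cmult by (intro mult_left_mono K1) simp
      finally show "(\<Sum>k\<in>{l..h}. 2 powi (-k) * D k * (?A k)\<^sup>2) \<le> 4 / 5 * (36 * c * X)" .
    next
      have "(\<Sum>k\<in>{l..h}. 2 powi k * D k * (?B k)\<^sup>2)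
        = (\<Sum>k\<in>{l..h}. \<Sum>i\<in>I. \<Sum>j\<in>I. b i * b j * (2 powi (-i) * 2 powi (-j)) * (of_bool (k \<le> min i j) * (2 powi k * D k)))"
        unfolding B_def power2_eq_square sum_product unfolding sum_distrib_left
        by (intro sum.cong refl) (auto simp: of_bool_def)
      also have "\<dots> = (\<Sum>i\<in>I. \<Sum>j\<in>I. \<Sum>k\<in>{l..h}. b i * b j * (2 powi (-i) * 2 powi (-j)) * (of_bool (k \<le> min i j) * (2 powi k * D k)))"
        by (rule sum_rotate[symmetric])
      also have "\<dots> \<le> pair_sum I m a (\<lambda>i j. 4 / 5 * (2 powi (- max i j) * v (min i j)))"
        unfolding pair_sum_def b_def[symmetric]
      proof (intro sum_mono)
        fix i j assume ij: "i \<in> I" "j \<in> I"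
        have pm: "2 powi (-i) * 2 powi (-j) = (2::real) powi (- max i j) * 2 powi (- min i j)"
          by (simp add: max_def min_def)
        have "(\<Sum>k\<in>{l..h}. of_bool (k \<le> min i j) * (2 powi k * D k)) = (\<Sum>k\<in>{l..min i j}. 2 powi k * D k)"
          using lh[OF ij(1)] lh[OF ij(2)] by (intro sum.mono_neutral_cong_right) auto
        also have "\<dots> \<le> 4 / 5 * (2 powi (min i j) * v (min i j))"
          using lh[OF ij(1)] lh[OF ij(2)] by (intro sum_D_lower) auto
        finally have "(\<Sum>k\<in>{l..h}. b i * b j * (2 powi (-i) * 2 powi (-j)) * (of_bool (k \<le> min i j) * (2 powi k * D k)))
            \<le> b i * b j * (2 powi (-i) * 2 powi (-j)) * (4 / 5 * (2 powi (min i j) * v (min i j)))"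
          unfolding sum_distrib_left[symmetric] by (intro mult_left_mono) (auto intro!: mult_nonneg_nonneg b0)
        also have "\<dots> = b i * b j * (4 / 5 * (2 powi (- max i j) * v (min i j))) * (2 powi (- min i j) * 2 powi (min i j))"
          unfolding pm by (simp only: mult_ac)
        finally show "(\<Sum>k\<in>{l..h}. b i * b j * (2 powi (-i) * 2 powi (-j)) * (of_bool (k \<le> min i j) * (2 powi k * D k)))
            \<le> b i * b j * (4 / 5 * (2 powi (- max i j) * v (min i j)))"
          by (simp only: powi2_cancel mult_1_right)
      qed
      also have "\<dots> \<le> 4 / 5 * (36 * c * X)" unfolding pair_sum_cmult by (intro mult_left_mono K2) simp
      finally show "(\<Sum>k\<in>{l..h}. 2 powi k * D k * (?B k)\<^sup>2) \<le> 4 / 5 * (36 * c * X)" .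
    qed
    finally show ?thesis by (simp add: mult_ac)
  qed
  let ?w = "\<lambda>i j. (2::real) powi (- max i j)"
  have "pair_sum I m a (\<lambda>i j. ?w i j * (\<Sum>k\<in>{min i j..max i j}. v k))
    \<le> pair_sum I m a (\<lambda>i j. 5 * (?w i j * (\<Sum>k\<in>{min i j..max i j}. D k)) + 4 * (?w i j * v (max i j) + ?w i j * v (min i j)))"
  proof (rule pair_sum_mono[OF m a])
    fix i j
    have "(\<Sum>k\<in>{min i j..max i j}. v k) \<le> 5 * (\<Sum>k\<in>{min i j..max i j}. D k) + 4 * (v (max i j) + v (min i j))"
      using sum_le_sum_D[of "min i j" "max i j"] by (simp add: add.commute)
    then have "?w i j * (\<Sum>k\<in>{min i j..max i j}. v k) \<le> ?w i j * (5 * (\<Sum>k\<in>{min i j..max i j}. D k) + 4 * (v (max i j) + v (min i j)))"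
      by (intro mult_left_mono) auto
    then show "?w i j * (\<Sum>k\<in>{min i j..max i j}. v k) \<le> 5 * (?w i j * (\<Sum>k\<in>{min i j..max i j}. D k)) + 4 * (?w i j * v (max i j) + ?w i j * v (min i j))"
      by (simp only: distrib_left mult_ac)
  qed
  \<comment> \<open>The constant is \<open>5 * 288/5 + 4 * (36 + 36)\<close>.\<close>
  also have "\<dots> \<le> 576 * c * X"
    unfolding pair_sum_add pair_sum_cmult using K1 K2 K3 by simp
  finally show ?thesis by (simp add: X_def)
qed

end

text \<open>If \<open>e\<close> varies slowly, the combination with index \<open>k\<close> of \<open>2^j\<close> and \<open>2^-j\<close> dominates \<open>e / 4\<close> everywhere and
  has the value \<open>2 * e k\<close> at \<open>k\<close>. The infimum of these combinations is therefore comparable to \<open>e\<close>, and it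
  is concave relative to \<open>2^j\<close> and \<open>2^-j\<close>.\<close>
definition envelope :: "(int \<Rightarrow> real) \<Rightarrow> int \<Rightarrow> real"
  where "envelope e j = (INF k. e k * (2 powi (j - k) + 2 powi (k - j)))"

context
  fixes e :: "int \<Rightarrow> real"
  assumes e0: "0 \<le> e k"
    and e_le: "e j \<le> 4 * (e k * (2 powi (j - k) + 2 powi (k - j)))"
begin

lemma envelope_lower: "envelope e j \<le> e k * (2 powi (j - k) + 2 powi (k - j))"
  unfolding envelope_def using e0
  by (intro cINF_lower bdd_belowI[of _ 0]) (auto intro!: mult_nonneg_nonneg add_nonneg_nonneg)

lemma envelope_greatest: "(\<And>k. x \<le> e k * (2 powi (j - k) + 2 powi (k - j))) \<Longrightarrow> x \<le> envelope e j"
  unfolding envelope_def by (intro cINF_greatest) auto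

lemma envelope_le: "envelope e j \<le> 2 * e j"
  using envelope_lower[of j j] by simp

lemma envelope_ge: "e j / 4 \<le> envelope e j"
  by (rule envelope_greatest) (use e_le[of j] in \<open>simp add: field_simps\<close>)

lemma hyperbolic_concave_envelope: "hyperbolic_concave (envelope e)"
proof
  fix j
  show "0 \<le> envelope e j" using e0 by (intro envelope_greatest mult_nonneg_nonneg add_nonneg_nonneg) auto
  have eq: "(2::real) powi (j + 1 - k) = 2 * 2 powi (j - k)" "(2::real) powi (k - (j + 1)) = 2 powi (k - j) / 2"
    "(2::real) powi (j - 1 - k) = 2 powi (j - k) / 2" "(2::real) powi (k - (j - 1)) = 2 * 2 powi (k - j)" for k
    by (simp_all add: power_int_add power_int_diff)
  have "envelope e (j + 1) / 2 \<le> envelope e j"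
  proof (rule envelope_greatest)
    fix k
    have "envelope e (j + 1) \<le> e k * (2 * 2 powi (j - k) + 2 powi (k - j) / 2)" using envelope_lower[of "j + 1" k] unfolding eq .
    also have "\<dots> \<le> e k * (2 * (2 powi (j - k) + 2 powi (k - j)))" by (intro mult_left_mono e0) simp
    finally show "envelope e (j + 1) / 2 \<le> e k * (2 powi (j - k) + 2 powi (k - j))" by (simp add: algebra_simps)
  qed
  then show "envelope e (j + 1) \<le> 2 * envelope e j" by simp
  have "envelope e (j - 1) / 2 \<le> envelope e j"
  proof (rule envelope_greatest)
    fix k
    have "envelope e (j - 1) \<le> e k * (2 powi (j - k) / 2 + 2 * 2 powi (k - j))" using envelope_lower[of "j - 1" k] unfolding eq .
    also have "\<dots> \<le> e k * (2 * (2 powi (j - k) + 2 powi (k - j)))" by (intro mult_left_mono e0) simp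
    finally show "envelope e (j - 1) / 2 \<le> e k * (2 powi (j - k) + 2 powi (k - j))" by (simp add: algebra_simps)
  qed
  then show "envelope e (j - 1) \<le> 2 * envelope e j" by simp
  have "(envelope e (j + 1) + envelope e (j - 1)) * (2 / 5) \<le> envelope e j"
  proof (rule envelope_greatest)
    fix k
    show "(envelope e (j + 1) + envelope e (j - 1)) * (2 / 5) \<le> e k * (2 powi (j - k) + 2 powi (k - j))"
      using envelope_lower[of "j + 1" k] envelope_lower[of "j - 1" k] unfolding eq
      by (simp add: algebra_simps)
  qed
  then show "envelope e (j + 1) + envelope e (j - 1) \<le> 5 / 2 * envelope e j" by simp
qed

lemma carleson_kernel_sum_of_slowly_varying:
  fixes I :: "int set" and m a :: "int \<Rightarrow> real"
  assumes "finite I" and m: "\<And>i. 0 \<le> m i" and a: "\<And>i. 0 \<le> a i"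
    and c: "\<And>r. e r * (\<Sum>n\<in>I. m n * dyadic_weight r n) \<le> c"
    and c0: "0 \<le> c"
  shows "pair_sum I m a (\<lambda>i j. 2 powi (- max i j) * (\<Sum>k\<in>{min i j..max i j}. e k))
      \<le> 4608 * c * (\<Sum>i\<in>I. m i * (a i)\<^sup>2)"
proof -
  interpret hyperbolic_concave "envelope e" by (rule hyperbolic_concave_envelope)
  have "envelope e r * (\<Sum>n\<in>I. m n * dyadic_weight r n) \<le> 2 * c" for r
  proof -
    have "envelope e r * (\<Sum>n\<in>I. m n * dyadic_weight r n) \<le> 2 * e r * (\<Sum>n\<in>I. m n * dyadic_weight r n)"
      using m less_imp_le[OF dyadic_weight_pos] by (intro mult_right_mono envelope_le sum_nonneg mult_nonneg_nonneg) auto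
    then show ?thesis using c[of r] by simp
  qed
  \<comment> \<open>Passing between \<open>e\<close> and its envelope costs a factor 2 in the hypothesis and 4 in the conclusion.\<close>
  from carleson_kernel_sum[OF assms(1) m a this] c0
  have "pair_sum I m a (\<lambda>i j. 2 powi (- max i j) * (\<Sum>k\<in>{min i j..max i j}. envelope e k))
      \<le> 576 * (2 * c) * (\<Sum>i\<in>I. m i * (a i)\<^sup>2)" by simp
  moreover have "pair_sum I m a (\<lambda>i j. 2 powi (- max i j) * (\<Sum>k\<in>{min i j..max i j}. e k))
     \<le> pair_sum I m a (\<lambda>i j. 4 * (2 powi (- max i j) * (\<Sum>k\<in>{min i j..max i j}. envelope e k)))"
  proof (rule pair_sum_mono[OF m a])
    fix i j
    have "(\<Sum>k\<in>{min i j..max i j}. e k) \<le> 4 * (\<Sum>k\<in>{min i j..max i j}. envelope e k)"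
      unfolding sum_distrib_left using envelope_ge by (intro sum_mono) (simp add: field_simps)
    then show "2 powi (- max i j) * (\<Sum>k\<in>{min i j..max i j}. e k) \<le> 4 * (2 powi (- max i j) * (\<Sum>k\<in>{min i j..max i j}. envelope e k))"
      by simp
  qed
  ultimately show ?thesis by (simp add: pair_sum_cmult)
qed

end

section \<open>Schwarz-Pick estimates for an inner function\<close>

context inner_fun
begin

definition defect :: "complex \<Rightarrow> real"
  where "defect s = 1 - (cmod (\<theta> s))\<^sup>2"

lemma model_kernel_diagonal:
  "0 < Re w \<Longrightarrow> model_kernel \<theta> w w = of_real (defect w / (4 * pi * Re w))"
proof -
  have "w + cnj w = of_real (2 * Re w)" by (simp add: complex_eq_iff)
  moreover have "1 - cnj (\<theta> w) * \<theta> w = of_real (defect w)"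
    unfolding defect_def using complex_norm_square[of "\<theta> w"] by (simp add: mult.commute)
  ultimately show ?thesis unfolding model_kernel_eq by simp
qed

lemma line_sq_model_kernel:
  assumes w: "0 < Re w"
  shows "(line_sq (model_kernel \<theta> w) \<longlongrightarrow> defect w / (4 * pi * Re w)) (at_right 0)"
  using tendsto_Re[OF reproducing[OF model_kernel_in_model_space[OF w] w]]
  unfolding line_inner_self model_kernel_diagonal[OF w] by simp

lemma h2_norm_model_kernel:
  assumes w: "0 < Re w"
  shows "(h2_norm (model_kernel \<theta> w))\<^sup>2 \<le> defect w / (4 * pi * Re w)"
proof -
  note k = model_kernel_hardy[OF w]
  obtain L where L: "(line_sq (model_kernel \<theta> w) \<longlongrightarrow> L) (at_right 0)" "\<And>x. 0 < x \<Longrightarrow> line_sq (model_kernel \<theta> w) x \<le> L"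
    using line_sq_tendsto[OF k] by blast
  have "L = defect w / (4 * pi * Re w)"
    using tendsto_unique[OF _ L(1) line_sq_model_kernel[OF w]] by simp
  then show ?thesis using L(2) by (intro hardy_H2_I(2) hardy_holomorphic hardy_sq_integrable k) auto
qed

lemma defect_nonneg:
  assumes w: "0 < Re w"
  shows "0 \<le> defect w"
proof -
  have "0 \<le> defect w / (4 * pi * Re w)"
    using zero_le_power2 h2_norm_model_kernel[OF w] by (rule order_trans)
  moreover have "0 < 4 * pi * Re w" using w by simp
  ultimately show ?thesis using pos_le_divide_eq[of "4 * pi * Re w" 0 "defect w"] by simp
qed

lemma cmod_le_1: "0 < Re w \<Longrightarrow> cmod (\<theta> w) \<le> 1"
  using defect_nonneg[of w] by (simp add: defect_def power_le_one_iff abs_square_le_1)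

text \<open>The sum on the left is the inner product of \<open>f\<close> with the combination of kernels \<open>F = \<Sum> c i * k (s i)\<close>,
  and the squared norm of \<open>F\<close> is the Gram sum of the kernels.\<close>
lemma model_space_gram_bound:
  assumes fin: "finite I" and f: "f \<in> model_space \<theta>" and s: "\<And>i. i \<in> I \<Longrightarrow> 0 < Re (s i)"
  shows "(cmod (\<Sum>i\<in>I. cnj (c i) * f (s i)))\<^sup>2
     \<le> (h2_norm f)\<^sup>2 * (\<Sum>i\<in>I. \<Sum>j\<in>I. cmod (c i) * cmod (c j) * cmod (model_kernel \<theta> (s i) (s j)))"
proof -
  define F where "F z = (\<Sum>i\<in>I. c i * model_kernel \<theta> (s i) z)" for z
  have F: "F \<in> model_space \<theta>" unfolding F_def using s by (intro model_space_sum fin model_kernel_in_model_space)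
  have FH: "F \<in> hardy_H2" and fH: "f \<in> hardy_H2" using F f by (auto intro: model_space_hardy)
  have lim: "(line_inner g F \<longlongrightarrow> (\<Sum>i\<in>I. cnj (c i) * g (s i))) (at_right 0)" if g: "g \<in> model_space \<theta>" for g
  proof -
    have "line_inner g F x = (\<Sum>i\<in>I. cnj (c i) * line_inner g (model_kernel \<theta> (s i)) x)" if x: "0 < x" for x
    proof -
      have "line_inner F g x = (\<Sum>i\<in>I. c i * line_inner (model_kernel \<theta> (s i)) g x)"
        unfolding F_def using s by (intro line_inner_sum fin model_kernel_hardy model_space_hardy g x)
      then have "cnj (line_inner F g x) = (\<Sum>i\<in>I. cnj (c i) * cnj (line_inner (model_kernel \<theta> (s i)) g x))"
        by simp
      then show ?thesis by (simp only: line_inner_cnj[symmetric])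
    qed
    moreover have "((\<lambda>x. \<Sum>i\<in>I. cnj (c i) * line_inner g (model_kernel \<theta> (s i)) x) \<longlongrightarrow> (\<Sum>i\<in>I. cnj (c i) * g (s i))) (at_right 0)"
      using g s by (intro tendsto_intros reproducing)
    ultimately show ?thesis by (rule tendsto_at_right_0_cong)
  qed
  have "(cmod (\<Sum>i\<in>I. cnj (c i) * f (s i)))\<^sup>2 \<le> (h2_norm f)\<^sup>2 * cmod (\<Sum>i\<in>I. cnj (c i) * F (s i))"
  proof (rule tendsto_le)
    show "((\<lambda>x. (cmod (line_inner f F x))\<^sup>2) \<longlongrightarrow> (cmod (\<Sum>i\<in>I. cnj (c i) * f (s i)))\<^sup>2) (at_right 0)"
      by (intro tendsto_intros lim f)
    show "((\<lambda>x. (h2_norm f)\<^sup>2 * cmod (line_inner F F x)) \<longlongrightarrow> (h2_norm f)\<^sup>2 * cmod (\<Sum>i\<in>I. cnj (c i) * F (s i))) (at_right 0)"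
      by (intro tendsto_intros lim F)
    show "\<forall>\<^sub>F x in at_right 0. (cmod (line_inner f F x))\<^sup>2 \<le> (h2_norm f)\<^sup>2 * cmod (line_inner F F x)"
    proof (rule eventually_at_right_0)
      fix x :: real assume x: "0 < x"
      have "(cmod (line_inner f F x))\<^sup>2 \<le> line_sq f x * line_sq F x" by (rule line_inner_Cauchy_Schwarz[OF fH FH x])
      also have "\<dots> \<le> (h2_norm f)\<^sup>2 * line_sq F x"
        by (intro mult_right_mono line_sq_le_norm[OF fH x] line_sq_nonneg)
      finally show "(cmod (line_inner f F x))\<^sup>2 \<le> (h2_norm f)\<^sup>2 * cmod (line_inner F F x)"
        by (simp add: line_inner_self line_sq_nonneg)
    qed
  qed simp
  also have "cmod (\<Sum>i\<in>I. cnj (c i) * F (s i)) \<le> (\<Sum>j\<in>I. \<Sum>i\<in>I. cmod (c i) * cmod (c j) * cmod (model_kernel \<theta> (s i) (s j)))"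
    unfolding F_def sum_distrib_left
    by (intro order_trans[OF norm_sum] sum_mono order_trans[OF norm_sum]) (simp add: norm_mult mult_ac)
  also have "\<dots> = (\<Sum>i\<in>I. \<Sum>j\<in>I. cmod (c i) * cmod (c j) * cmod (model_kernel \<theta> (s i) (s j)))"
    by (rule sum.swap)
  finally show ?thesis by (simp add: mult_left_mono)
qed

lemma model_space_point_bound:
  assumes f: "f \<in> model_space \<theta>" and w: "0 < Re w"
  shows "(cmod (f w))\<^sup>2 \<le> (h2_norm f)\<^sup>2 * (defect w / (4 * pi * Re w))"
  using model_space_gram_bound[of "{w}" f "\<lambda>w. w" "\<lambda>_. 1"] f w defect_nonneg[OF w]
  by (simp add: model_kernel_diagonal norm_divide norm_mult)

text \<open>This is the Cauchy-Schwarz inequality for the kernels at \<open>s\<close> and \<open>t\<close>. The Schwarz-Pick inequality and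
  Harnack's inequality for the defect follow from it by algebra.\<close>
lemma kernel_Cauchy_Schwarz:
  assumes s: "0 < Re s" and t: "0 < Re t"
  shows "(cmod (1 - cnj (\<theta> s) * \<theta> t))\<^sup>2 \<le> defect s * defect t * ((cmod (t + cnj s))\<^sup>2 / (4 * Re s * Re t))"
proof -
  have ne: "t + cnj s \<noteq> 0" using s t by (auto simp: complex_eq_iff)
  then have p: "0 < (cmod (t + cnj s))\<^sup>2" by simp
  have "(cmod (model_kernel \<theta> s t))\<^sup>2 \<le> (h2_norm (model_kernel \<theta> s))\<^sup>2 * (defect t / (4 * pi * Re t))"
    by (rule model_space_point_bound[OF model_kernel_in_model_space[OF s] t])
  also have "\<dots> \<le> defect s / (4 * pi * Re s) * (defect t / (4 * pi * Re t))"
    using s t defect_nonneg[OF t] by (intro mult_right_mono h2_norm_model_kernel divide_nonneg_nonneg) auto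
  finally have "(cmod (1 - cnj (\<theta> s) * \<theta> t))\<^sup>2 / (4 * pi\<^sup>2 * (cmod (t + cnj s))\<^sup>2) \<le> defect s / (4 * pi * Re s) * (defect t / (4 * pi * Re t))"
    by (simp add: model_kernel_eq norm_divide norm_mult power_divide power_mult_distrib)
  then have "(cmod (1 - cnj (\<theta> s) * \<theta> t))\<^sup>2 \<le> defect s / (4 * pi * Re s) * (defect t / (4 * pi * Re t)) * (4 * pi\<^sup>2 * (cmod (t + cnj s))\<^sup>2)"
    using p by (subst (asm) pos_divide_le_eq) auto
  also have "\<dots> = defect s * defect t * ((cmod (t + cnj s))\<^sup>2 / (4 * Re s * Re t))"
    using s t by (simp add: field_simps power2_eq_square)
  finally show ?thesis .
qed

lemma Schwarz_Pick:
  assumes s: "0 < Re s" and t: "0 < Re t"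
  shows "(cmod (\<theta> s - \<theta> t))\<^sup>2 \<le> defect s * defect t * ((cmod (s - t))\<^sup>2 / (4 * Re s * Re t))"
proof -
  have 1: "(cmod (1 - cnj (\<theta> s) * \<theta> t))\<^sup>2 = defect s * defect t + (cmod (\<theta> s - \<theta> t))\<^sup>2"
    unfolding defect_def cmod_power2 by (simp add: algebra_simps power2_eq_square)
  have 2: "(cmod (t + cnj s))\<^sup>2 = (cmod (s - t))\<^sup>2 + 4 * Re s * Re t"
    unfolding cmod_power2 by (simp add: algebra_simps power2_eq_square)
  have "(cmod (t + cnj s))\<^sup>2 / (4 * Re s * Re t) = (cmod (s - t))\<^sup>2 / (4 * Re s * Re t) + 1"
    unfolding 2 using s t by (simp add: field_simps)
  then show ?thesis using kernel_Cauchy_Schwarz[OF s t] unfolding 1 by (simp add: algebra_simps)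
qed

lemma defect_Harnack:
  assumes s: "0 < Re s" and t: "0 < Re t"
  shows "defect t \<le> defect s * ((cmod (t + cnj s))\<^sup>2 / (Re s * Re t))"
proof (cases "defect t = 0")
  case True
  then show ?thesis using s t defect_nonneg[OF s] by simp
next
  case False
  then have dt: "0 < defect t" using defect_nonneg[OF t] by simp
  have ct: "0 \<le> cmod (\<theta> t)" "cmod (\<theta> t) \<le> 1" using cmod_le_1[OF t] by auto
  have "defect t = (1 - cmod (\<theta> t)) * (1 + cmod (\<theta> t))"
    by (simp add: defect_def power2_eq_square algebra_simps)
  also have "\<dots> \<le> (1 - cmod (\<theta> t)) * 2" using ct by (intro mult_left_mono) auto
  finally have "defect t / 2 \<le> 1 - cmod (\<theta> t)" by simp
  also have "cmod (cnj (\<theta> s) * \<theta> t) \<le> 1 * cmod (\<theta> t)"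
    unfolding norm_mult using cmod_le_1[OF s] by (intro mult_right_mono) auto
  then have "1 - cmod (\<theta> t) \<le> cmod (1 - cnj (\<theta> s) * \<theta> t)"
    using norm_triangle_ineq2[of 1 "cnj (\<theta> s) * \<theta> t"] by simp
  finally have "(defect t / 2)\<^sup>2 \<le> (cmod (1 - cnj (\<theta> s) * \<theta> t))\<^sup>2"
    using dt by (intro power_mono) auto
  also have "\<dots> \<le> defect s * defect t * ((cmod (t + cnj s))\<^sup>2 / (4 * Re s * Re t))"
    by (rule kernel_Cauchy_Schwarz[OF s t])
  finally have "defect t * (defect t / 4) \<le> defect t * (defect s * ((cmod (t + cnj s))\<^sup>2 / (4 * Re s * Re t)))"
    by (simp add: power2_eq_square mult_ac)
  then have "defect t / 4 \<le> defect s * ((cmod (t + cnj s))\<^sup>2 / (4 * Re s * Re t))"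
    using dt by (simp only: mult_le_cancel_left_pos)
  then show ?thesis by simp
qed

lemma defect_real_Harnack:
  assumes "0 < s" "0 < t"
  shows "defect (of_real t) \<le> defect (of_real s) * ((s + t)\<^sup>2 / (s * t))"
  using defect_Harnack[of "of_real s" "of_real t"] assms
  by (simp add: add.commute flip: of_real_add) 

lemma defect_close_points:
  assumes s: "0 < s" and t: "0 < t" and st: "t \<le> 2 * s" "s \<le> 2 * t"
  shows "defect (of_real t) \<le> 5 * defect (of_real s)"
    and "cmod (\<theta> (of_real s) - \<theta> (of_real t)) \<le> defect (of_real s)"
proof -
  have d0: "0 \<le> defect (of_real s)" "0 \<le> defect (of_real t)" using defect_nonneg s t by auto
  have "0 \<le> (2 * s - t) * (2 * t - s)" using st by (intro mult_nonneg_nonneg) auto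
  then have q: "s * s + t * t \<le> 5 / 2 * (s * t)" by (simp add: algebra_simps)
  have "(s + t)\<^sup>2 \<le> 5 * (s * t)"
    unfolding power2_sum unfolding power2_eq_square using q mult_pos_pos[OF s t] by linarith
  then have "(s + t)\<^sup>2 / (s * t) \<le> 5" using s t by (subst pos_divide_le_eq) auto
  then have "defect (of_real s) * ((s + t)\<^sup>2 / (s * t)) \<le> defect (of_real s) * 5"
    by (intro mult_left_mono d0)
  then show 1: "defect (of_real t) \<le> 5 * defect (of_real s)"
    using defect_real_Harnack[OF s t] by simp
  have q2: "(s - t)\<^sup>2 / (4 * s * t) \<le> 1 / 8"
  proof -
    have "(s - t)\<^sup>2 \<le> 1 / 8 * (4 * s * t)"
      unfolding power2_diff unfolding power2_eq_square using q by linarith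
    then show ?thesis using s t by (subst pos_divide_le_eq) auto
  qed
  have "(cmod (\<theta> (of_real s) - \<theta> (of_real t)))\<^sup>2 \<le> defect (of_real s) * defect (of_real t) * ((s - t)\<^sup>2 / (4 * s * t))"
    using Schwarz_Pick[of "of_real s" "of_real t"] s t by (simp flip: of_real_diff)
  also have "\<dots> \<le> defect (of_real s) * (5 * defect (of_real s)) * (1 / 8)"
    using d0 s t by (intro mult_mono 1 q2) auto
  also have "\<dots> \<le> (defect (of_real s))\<^sup>2" by (simp add: power2_eq_square)
  finally show "cmod (\<theta> (of_real s) - \<theta> (of_real t)) \<le> defect (of_real s)"
    by (rule power2_le_imp_le[OF _ d0(1)])
qed

section \<open>The Gram matrix of kernels at dyadic points\<close>

definition dyadic_defect :: "int \<Rightarrow> real" where "dyadic_defect k = defect (of_real (2 powi k))"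

lemma dyadic_defect_nonneg: "0 \<le> dyadic_defect k"
  unfolding dyadic_defect_def by (intro defect_nonneg, subst Re_complex_of_real, simp)

lemma dyadic_defect_slow: "dyadic_defect j \<le> 4 * (dyadic_defect k * (2 powi (j - k) + 2 powi (k - j)))"
proof -
  let ?s = "(2::real) powi k" and ?t = "(2::real) powi j"
  have p: "0 < ?s" "0 < ?t" by auto
  have "(?s + ?t)\<^sup>2 / (?s * ?t) \<le> 2 * (?t / ?s + ?s / ?t)"
  proof -
    have "0 \<le> (?s - ?t)\<^sup>2 / (?s * ?t)" using p by (intro divide_nonneg_nonneg) auto
    also have "\<dots> = 2 * (?t / ?s + ?s / ?t) - (?s + ?t)\<^sup>2 / (?s * ?t)"
      using p by (simp add: field_simps power2_eq_square)
    finally show ?thesis by simp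
  qed
  also have "\<dots> = 2 * (2 powi (j - k) + 2 powi (k - j))" by (simp add: power_int_diff)
  also have "\<dots> \<le> 4 * (2 powi (j - k) + 2 powi (k - j))" by simp
  finally have "dyadic_defect k * ((?s + ?t)\<^sup>2 / (?s * ?t)) \<le> dyadic_defect k * (4 * (2 powi (j - k) + 2 powi (k - j)))"
    by (intro mult_left_mono dyadic_defect_nonneg)
  also have "\<dots> = 4 * (dyadic_defect k * (2 powi (j - k) + 2 powi (k - j)))" by (simp only: mult_ac)
  finally show ?thesis using defect_real_Harnack[OF p] unfolding dyadic_defect_def[symmetric] by (rule order_trans[rotated])
qed

lemma dyadic_chain: "i \<le> j \<Longrightarrow> cmod (\<theta> (of_real (2 powi i)) - \<theta> (of_real (2 powi j))) \<le> (\<Sum>k\<in>{i..j}. dyadic_defect k)"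
proof (induction j rule: int_ge_induct)
  case base
  then show ?case by (simp add: dyadic_defect_nonneg)
next
  case (step j)
  have "cmod (\<theta> (of_real (2 powi (j + 1))) - \<theta> (of_real (2 powi j))) \<le> dyadic_defect (j + 1)"
    unfolding dyadic_defect_def by (intro defect_close_points) (auto simp: powi2_simps)
  moreover have "cmod (\<theta> (of_real (2 powi i)) - \<theta> (of_real (2 powi (j + 1))))
     \<le> cmod (\<theta> (of_real (2 powi i)) - \<theta> (of_real (2 powi j))) + cmod (\<theta> (of_real (2 powi (j + 1))) - \<theta> (of_real (2 powi j)))"
    using norm_triangle_ineq4[of "\<theta> (of_real (2 powi i)) - \<theta> (of_real (2 powi j))" "\<theta> (of_real (2 powi (j + 1))) - \<theta> (of_real (2 powi j))"]
    by (simp del: of_real_power_int)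
  moreover have "{i..j + 1} = insert (j + 1) {i..j}" using step.hyps by auto
  ultimately show ?case using step.IH by simp
qed

text \<open>The numerator is the defect at \<open>s\<close> up to a multiple of \<open>\<theta> s - \<theta> t\<close>, and the variation of \<open>\<theta>\<close> from \<open>s\<close>
  to \<open>t\<close> is bounded by the sum of the defects at the dyadic points in between, by Schwarz-Pick.\<close>
lemma kernel_numerator_bound:
  assumes ij: "i \<le> j" and s: "2 powi i \<le> s" "s \<le> 2 powi (i + 1)" and t: "2 powi j \<le> t" "t \<le> 2 powi (j + 1)"
  shows "cmod (1 - cnj (\<theta> (of_real s)) * \<theta> (of_real t)) \<le> 8 * (\<Sum>k\<in>{i..j}. dyadic_defect k)"
proof -
  let ?S = "\<Sum>k\<in>{i..j}. dyadic_defect k"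
  have pos: "(0::real) < 2 powi i" "(0::real) < 2 powi j" by auto
  have s0: "0 < s" "s \<le> 2 * 2 powi i" and t0: "0 < t" "t \<le> 2 * 2 powi j"
    using less_le_trans[OF pos(1) s(1)] less_le_trans[OF pos(2) t(1)] s t by (auto simp: powi2_simps)
  have ei: "dyadic_defect i \<le> ?S" and ej: "dyadic_defect j \<le> ?S"
    using ij by (auto intro!: member_le_sum dyadic_defect_nonneg)
  have a: "cmod (\<theta> (of_real (2 powi i)) - \<theta> (of_real s)) \<le> dyadic_defect i"
    unfolding dyadic_defect_def using s s0 by (intro defect_close_points) auto
  have b: "cmod (\<theta> (of_real (2 powi j)) - \<theta> (of_real t)) \<le> dyadic_defect j"
    unfolding dyadic_defect_def using t t0 by (intro defect_close_points) auto
  have d: "defect (of_real s) \<le> 5 * dyadic_defect i"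
    unfolding dyadic_defect_def using s s0 by (intro defect_close_points) auto
  have st: "cmod (\<theta> (of_real s) - \<theta> (of_real t)) \<le> 3 * ?S"
  proof -
    have "\<theta> (of_real s) - \<theta> (of_real t) = (\<theta> (of_real (2 powi i)) - \<theta> (of_real (2 powi j)))
      - (\<theta> (of_real (2 powi i)) - \<theta> (of_real s)) + (\<theta> (of_real (2 powi j)) - \<theta> (of_real t))" by simp
    then have "cmod (\<theta> (of_real s) - \<theta> (of_real t)) \<le> cmod (\<theta> (of_real (2 powi i)) - \<theta> (of_real (2 powi j)))
      + cmod (\<theta> (of_real (2 powi i)) - \<theta> (of_real s)) + cmod (\<theta> (of_real (2 powi j)) - \<theta> (of_real t))"
      using norm_triangle_ineq norm_triangle_ineq4 by (smt (verit))
    then show ?thesis using dyadic_chain[OF ij] a b ei ej by linarith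
  qed
  have "1 - cnj (\<theta> (of_real s)) * \<theta> (of_real t) = of_real (defect (of_real s)) + cnj (\<theta> (of_real s)) * (\<theta> (of_real s) - \<theta> (of_real t))"
    unfolding defect_def using complex_norm_square[of "\<theta> (of_real s)"] by (simp add: algebra_simps)
  then have "cmod (1 - cnj (\<theta> (of_real s)) * \<theta> (of_real t)) \<le> cmod (of_real (defect (of_real s))) + cmod (cnj (\<theta> (of_real s)) * (\<theta> (of_real s) - \<theta> (of_real t)))"
    by (metis norm_triangle_ineq)
  also have "cmod (of_real (defect (of_real s))) = defect (of_real s)" using defect_nonneg[of "of_real s"] s0 by simp
  also have "cmod (cnj (\<theta> (of_real s)) * (\<theta> (of_real s) - \<theta> (of_real t))) \<le> 1 * (3 * ?S)"
    unfolding norm_mult using s0 cmod_le_1[of "of_real s"] st by (intro mult_mono) auto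
  finally show ?thesis using d ei by linarith
qed

lemma model_kernel_dyadic_bound:
  assumes s: "2 powi i \<le> s" "s \<le> 2 powi (i + 1)" and t: "2 powi j \<le> t" "t \<le> 2 powi (j + 1)"
  shows "cmod (model_kernel \<theta> (of_real s) (of_real t)) \<le> 2 * (2 powi (- max i j) * (\<Sum>k\<in>{min i j..max i j}. dyadic_defect k))"
proof -
  let ?S = "\<Sum>k\<in>{min i j..max i j}. dyadic_defect k"
  have pos: "(0::real) < 2 powi i" "(0::real) < 2 powi j" by auto
  have num: "cmod (1 - cnj (\<theta> (of_real s)) * \<theta> (of_real t)) \<le> 8 * ?S"
  proof (cases "i \<le> j")
    case True
    then show ?thesis using kernel_numerator_bound[OF True s t] by (simp add: max_def min_def)
  next
    case False
    then have ji: "j \<le> i" by simp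
    have "1 - cnj (\<theta> (of_real s)) * \<theta> (of_real t) = cnj (1 - cnj (\<theta> (of_real t)) * \<theta> (of_real s))" by (simp add: mult.commute)
    then have "cmod (1 - cnj (\<theta> (of_real s)) * \<theta> (of_real t)) = cmod (1 - cnj (\<theta> (of_real t)) * \<theta> (of_real s))"
      by (simp only: complex_mod_cnj)
    then show ?thesis using kernel_numerator_bound[OF ji t s] False by (simp add: max_def min_def)
  qed
  have S0: "0 \<le> ?S" by (intro sum_nonneg dyadic_defect_nonneg)
  have st: "2 powi (max i j) \<le> s + t"
    using less_le_trans[OF pos(1) s(1)] less_le_trans[OF pos(2) t(1)] s t unfolding max_def
    by (cases "i \<le> j") auto
  have pos': "(0::real) < 2 powi (max i j)" by simp
  have "cmod (model_kernel \<theta> (of_real s) (of_real t)) = cmod (1 - cnj (\<theta> (of_real s)) * \<theta> (of_real t)) / (2 * pi * (s + t))"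
    using less_le_trans[OF pos' st] by (simp add: model_kernel_eq norm_divide norm_mult add.commute flip: of_real_add)
  also have "\<dots> \<le> 8 * ?S / (4 * 2 powi (max i j))"
    using num S0 st pos' pi_gt3 by (intro frac_le mult_mono) auto
  also have "\<dots> = 2 * (2 powi (- max i j) * ?S)" by (simp add: power_int_minus field_simps)
  finally show ?thesis .
qed

text \<open>Let \<open>X\<close> be the sum on the left. Duality with the coefficients \<open>m n * f (s n)\<close> bounds \<open>X^2\<close> by the squared
  norm of \<open>f\<close> times a pair sum, and the pair sum is at most a constant times \<open>X\<close>.\<close>
lemma discrete_carleson:
  fixes I :: "int set" and m :: "int \<Rightarrow> real" and s :: "int \<Rightarrow> real"
  assumes fin: "finite I" and f: "f \<in> model_space \<theta>"
    and m: "\<And>n. 0 \<le> m n" and s: "\<And>n. 2 powi n \<le> s n" "\<And>n. s n \<le> 2 powi (n + 1)"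
    and c: "\<And>r. dyadic_defect r * (\<Sum>n\<in>I. m n * dyadic_weight r n) \<le> c" and c0: "0 \<le> c"
  shows "(\<Sum>n\<in>I. m n * (cmod (f (of_real (s n))))\<^sup>2) \<le> 9216 * c * (h2_norm f)\<^sup>2"
proof -
  define X where "X = (\<Sum>n\<in>I. m n * (cmod (f (of_real (s n))))\<^sup>2)"
  define a where "a n = cmod (f (of_real (s n)))" for n
  have X0: "0 \<le> X" unfolding X_def using m by (intro sum_nonneg) auto
  have sp: "0 < s n" for n using s(1)[of n] by (rule less_le_trans[rotated]) simp
  have "(\<Sum>i\<in>I. cnj (of_real (m i) * f (of_real (s i))) * f (of_real (s i))) = of_real X"
    unfolding X_def of_real_sum
    by (intro sum.cong refl) (simp add: complex_norm_square mult_ac del: of_real_power)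
  then have "X\<^sup>2 = (cmod (\<Sum>i\<in>I. cnj (of_real (m i) * f (of_real (s i))) * f (of_real (s i))))\<^sup>2"
    using X0 by simp
  also have "\<dots> \<le> (h2_norm f)\<^sup>2 * (\<Sum>i\<in>I. \<Sum>j\<in>I. cmod (of_real (m i) * f (of_real (s i))) * cmod (of_real (m j) * f (of_real (s j)))
      * cmod (model_kernel \<theta> (of_real (s i)) (of_real (s j))))"
    by (rule model_space_gram_bound[OF fin f]) (simp add: sp)
  also have "\<dots> \<le> (h2_norm f)\<^sup>2 * pair_sum I m a (\<lambda>i j. 2 * (2 powi (- max i j) * (\<Sum>k\<in>{min i j..max i j}. dyadic_defect k)))"
    unfolding pair_sum_def using m by (intro mult_left_mono sum_mono mult_mono model_kernel_dyadic_bound s mult_nonneg_nonneg)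
      (auto simp: norm_mult a_def)
  also have "\<dots> \<le> (h2_norm f)\<^sup>2 * (2 * (4608 * c * (\<Sum>i\<in>I. m i * (a i)\<^sup>2)))"
    unfolding pair_sum_cmult
    by (intro mult_left_mono carleson_kernel_sum_of_slowly_varying dyadic_defect_nonneg dyadic_defect_slow fin m c c0)
      (auto simp: a_def)
  also have "\<dots> = 9216 * c * (h2_norm f)\<^sup>2 * X" by (simp add: X_def a_def)
  finally have "X * X \<le> (9216 * c * (h2_norm f)\<^sup>2) * X" by (simp add: power2_eq_square)
  then have "X \<le> 9216 * c * (h2_norm f)\<^sup>2"
    using X0 c0 by (cases "X = 0") (auto simp: mult_le_cancel_right)
  then show ?thesis by (simp add: X_def)
qed

end

section \<open>Carleson measures and the kernel condition\<close>

context inner_fun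
begin

text \<open>Test the embedding on the kernel at \<open>w\<close>: its squared norm is at most \<open>defect w / (4 pi w)\<close>, and
  \<open>defect w \<le> 2 (1 - |\<theta> w|)\<close>, while its numerator has modulus at least \<open>1 - |\<theta> w|\<close> everywhere.\<close>
lemma carleson_imp_kernel_condition:
  assumes sets: "sets \<mu> = sets (restrict_space borel \<complex>\<^sub>+)"
    and carl: "carleson_measure_for (model_space \<theta>) \<mu>"
  shows "kernel_condition \<theta> \<mu> {0<..}"
proof -
  obtain C where C: "\<And>f. f \<in> model_space \<theta> \<Longrightarrow> (\<integral>\<^sup>+ s. ennreal ((cmod (f s))\<^sup>2) \<partial>\<mu>) \<le> ennreal ((C * h2_norm f)\<^sup>2)"
    using carl by (auto simp: carleson_measure_for_def)
  have space: "space \<mu> = \<complex>\<^sub>+" using sets_eq_imp_space_eq[OF sets] by (simp add: space_restrict_space)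
  define c where "c = 2 * pi * C\<^sup>2 + 1"
  have c: "0 < c" unfolding c_def by (intro add_nonneg_pos) auto
  have "(\<integral>\<^sup>+ s. ennreal (w / (cmod (of_real w + s))\<^sup>2) \<partial>\<mu>) \<le> ennreal c / ennreal (1 - cmod (\<theta> (of_real w)))" if w: "0 < w" for w :: real
  proof (cases "cmod (\<theta> (of_real w)) = 1")
    case True
    then show ?thesis using c by (simp add: ennreal_divide_zero)
  next
    case False
    define d where "d = 1 - cmod (\<theta> (of_real w))"
    have d: "0 < d" using False cmod_le_1[of "of_real w"] w by (simp add: d_def)
    have K: "model_kernel \<theta> (of_real w) \<in> model_space \<theta>" using w by (intro model_kernel_in_model_space) simp
    have point: "w / (cmod (of_real w + s))\<^sup>2 \<le> 4 * pi\<^sup>2 * w / d\<^sup>2 * (cmod (model_kernel \<theta> (of_real w) s))\<^sup>2" if s: "s \<in> \<complex>\<^sub>+" for s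
    proof -
      have "cmod (cnj (\<theta> (of_real w)) * \<theta> s) \<le> cmod (\<theta> (of_real w)) * 1"
        unfolding norm_mult using cmod_le_1[of s] s by (intro mult_mono) auto
      then have "d \<le> cmod (1 - cnj (\<theta> (of_real w)) * \<theta> s)"
        using norm_triangle_ineq2[of 1 "cnj (\<theta> (of_real w)) * \<theta> s"] by (simp add: d_def)
      then have "d\<^sup>2 \<le> (cmod (1 - cnj (\<theta> (of_real w)) * \<theta> s))\<^sup>2" using d by (intro power_mono) auto
      then have "w / (cmod (of_real w + s))\<^sup>2 * (d\<^sup>2 / d\<^sup>2) \<le> w / (cmod (of_real w + s))\<^sup>2 * ((cmod (1 - cnj (\<theta> (of_real w)) * \<theta> s))\<^sup>2 / d\<^sup>2)"
        using w by (intro mult_left_mono divide_right_mono) auto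
      also have "\<dots> = 4 * pi\<^sup>2 * w / d\<^sup>2 * (cmod (model_kernel \<theta> (of_real w) s))\<^sup>2"
        by (simp add: model_kernel_eq norm_divide norm_mult power_divide power_mult_distrib add.commute)
      finally show ?thesis using d by simp
    qed
    have fm: "(\<lambda>s. ennreal ((cmod (model_kernel \<theta> (of_real w) s))\<^sup>2)) \<in> borel_measurable \<mu>"
    proof -
      have "model_kernel \<theta> (of_real w) \<in> borel_measurable (restrict_space borel \<complex>\<^sub>+)"
        using hardy_continuous[OF model_space_hardy[OF K]] by (rule borel_measurable_continuous_on_restrict)
      then have [measurable]: "model_kernel \<theta> (of_real w) \<in> borel_measurable \<mu>"
        using measurable_cong_sets[OF sets refl] by blast
      show ?thesis by measurable
    qed
    have "(\<integral>\<^sup>+ s. ennreal (w / (cmod (of_real w + s))\<^sup>2) \<partial>\<mu>)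
       \<le> (\<integral>\<^sup>+ s. ennreal (4 * pi\<^sup>2 * w / d\<^sup>2) * ennreal ((cmod (model_kernel \<theta> (of_real w) s))\<^sup>2) \<partial>\<mu>)"
    proof (rule nn_integral_mono)
      fix s assume "s \<in> space \<mu>"
      then show "ennreal (w / (cmod (of_real w + s))\<^sup>2) \<le> ennreal (4 * pi\<^sup>2 * w / d\<^sup>2) * ennreal ((cmod (model_kernel \<theta> (of_real w) s))\<^sup>2)"
        using point[of s] w by (subst ennreal_mult'[symmetric]) (auto simp: space intro!: ennreal_leI)
    qed
    also have "\<dots> = ennreal (4 * pi\<^sup>2 * w / d\<^sup>2) * (\<integral>\<^sup>+ s. ennreal ((cmod (model_kernel \<theta> (of_real w) s))\<^sup>2) \<partial>\<mu>)"
      by (rule nn_integral_cmult[OF fm])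
    also have "\<dots> \<le> ennreal (4 * pi\<^sup>2 * w / d\<^sup>2) * ennreal ((C * h2_norm (model_kernel \<theta> (of_real w)))\<^sup>2)"
      by (intro mult_left_mono C K) auto
    also have "\<dots> = ennreal (4 * pi\<^sup>2 * w / d\<^sup>2 * (C * h2_norm (model_kernel \<theta> (of_real w)))\<^sup>2)"
      using w by (intro ennreal_mult'[symmetric]) auto
    also have "\<dots> \<le> ennreal (c / d)"
    proof (rule ennreal_leI)
      have "defect (of_real w) = d * (1 + cmod (\<theta> (of_real w)))" by (simp add: defect_def d_def power2_eq_square algebra_simps)
      also have "\<dots> \<le> d * 2" using d by (intro mult_left_mono) (auto simp: d_def)
      finally have dle: "defect (of_real w) \<le> 2 * d" by simp
      have "(h2_norm (model_kernel \<theta> (of_real w)))\<^sup>2 \<le> defect (of_real w) / (4 * pi * w)"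
        using h2_norm_model_kernel[of "of_real w"] w by simp
      also have "\<dots> \<le> 2 * d / (4 * pi * w)" using dle w by (intro divide_right_mono) auto
      finally have "(h2_norm (model_kernel \<theta> (of_real w)))\<^sup>2 \<le> 2 * d / (4 * pi * w)" .
      then have "4 * pi\<^sup>2 * w / d\<^sup>2 * (C\<^sup>2 * (h2_norm (model_kernel \<theta> (of_real w)))\<^sup>2) \<le> 4 * pi\<^sup>2 * w / d\<^sup>2 * (C\<^sup>2 * (2 * d / (4 * pi * w)))"
        using w by (intro mult_left_mono) auto
      also have "\<dots> = 2 * pi * C\<^sup>2 / d" using w d by (simp add: field_simps power2_eq_square)
      also have "\<dots> \<le> c / d" using d by (intro divide_right_mono) (auto simp: c_def)
      finally show "4 * pi\<^sup>2 * w / d\<^sup>2 * (C * h2_norm (model_kernel \<theta> (of_real w)))\<^sup>2 \<le> c / d"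
        by (simp add: power_mult_distrib)
    qed
    also have "\<dots> = ennreal c / ennreal d" using c d by (simp add: divide_ennreal)
    finally show ?thesis by (simp add: d_def)
  qed
  then show ?thesis unfolding kernel_condition_def using c by auto
qed

lemma model_space_zero_of_defect_zero:
  assumes "0 < Re w" "defect w = 0" "f \<in> model_space \<theta>" "0 < Re s"
  shows "f s = 0"
proof -
  have "defect s \<le> 0" using defect_Harnack[OF assms(1,4)] assms(2) by simp
  then have "defect s = 0" using defect_nonneg[OF assms(4)] by simp
  then show ?thesis using model_space_point_bound[OF assms(3,4)] by simp
qed

definition dyadic_block :: "int \<Rightarrow> complex set"
  where "dyadic_block n = {z. Im z = 0 \<and> 2 powi n \<le> Re z \<and> Re z < 2 powi (n + 1)}"

lemma dyadic_block_disjoint: "n \<noteq> k \<Longrightarrow> dyadic_block n \<inter> dyadic_block k = {}"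
proof -
  have "dyadic_block n \<inter> dyadic_block k = {}" if "n < k" for n k
  proof -
    have "(2::real) powi (n + 1) \<le> 2 powi k" using that by (intro power_int_increasing) auto
    then show ?thesis by (auto simp: dyadic_block_def)
  qed
  then show "n \<noteq> k \<Longrightarrow> dyadic_block n \<inter> dyadic_block k = {}" by (metis linorder_neqE Int_commute)
qed

lemma ex_dyadic_block:
  assumes "0 < x" shows "\<exists>n. complex_of_real x \<in> dyadic_block n"
proof -
  define n where "n = \<lfloor>log 2 x\<rfloor>"
  have "(2::real) powi n = 2 powr real_of_int n" "(2::real) powi (n + 1) = 2 powr (real_of_int n + 1)"
    using powr_real_of_int'[of 2 n] powr_real_of_int'[of 2 "n + 1"] by simp_all
  moreover have "2 powr real_of_int n \<le> 2 powr (log 2 x)" "2 powr (log 2 x) < 2 powr (real_of_int n + 1)"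
    unfolding n_def by (auto intro: powr_mono powr_less_mono) 
  moreover have "2 powr (log 2 x) = x" using assms by simp
  ultimately have "(2::real) powi n \<le> x" "x < 2 powi (n + 1)" by simp_all
  then show ?thesis by (auto simp: dyadic_block_def)
qed

lemma dyadic_block_subset: "dyadic_block n \<subseteq> \<complex>\<^sub>+"
  unfolding dyadic_block_def using less_le_trans[of 0 "(2::real) powi n"] by auto

text \<open>On each dyadic block \<open>|f|\<close> is replaced by its maximum, attained at a point \<open>s n\<close>. This turns \<open>\<mu>\<close> into a sum
  of point masses \<open>m n\<close>, one for each block, and the kernel condition at \<open>w = 2^r\<close> is a bound for these
  masses. The estimate for finitely many blocks passes to the limit by monotone convergence.\<close>
lemma kernel_condition_imp_carleson:
  assumes sets: "sets \<mu> = sets (restrict_space borel \<complex>\<^sub>+)"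
    and null: "emeasure \<mu> (\<complex>\<^sub>+ - complex_of_real ` {0..}) = 0"
    and kc: "kernel_condition \<theta> \<mu> {0<..}"
  shows "carleson_measure_for (model_space \<theta>) \<mu>"
proof (cases "\<exists>w. 0 < Re w \<and> defect w = 0")
  \<comment> \<open>Then \<open>\<theta>\<close> is unimodular, the kernel condition is void, and the model space vanishes on the half-plane.\<close>
  case True
  have space: "space \<mu> = \<complex>\<^sub>+" using sets_eq_imp_space_eq[OF sets] by (simp add: space_restrict_space)
  show ?thesis unfolding carleson_measure_for_def
  proof (intro exI ballI)
    fix f assume f: "f \<in> model_space \<theta>"
    have "(\<integral>\<^sup>+ s. ennreal ((cmod (f s))\<^sup>2) \<partial>\<mu>) = (\<integral>\<^sup>+ s. 0 \<partial>\<mu>)"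
      using True model_space_zero_of_defect_zero[OF _ _ f] by (intro nn_integral_cong) (auto simp: space)
    then show "(\<integral>\<^sup>+ s. ennreal ((cmod (f s))\<^sup>2) \<partial>\<mu>) \<le> ennreal ((0 * h2_norm f)\<^sup>2)" by simp
  qed
next
  case False
  have space: "space \<mu> = \<complex>\<^sub>+" using sets_eq_imp_space_eq[OF sets] by (simp add: space_restrict_space)
  obtain c where c0: "0 < c" and c: "\<And>w. 0 < w \<Longrightarrow> (\<integral>\<^sup>+ s. ennreal (w / (cmod (of_real w + s))\<^sup>2) \<partial>\<mu>) \<le> ennreal c / ennreal (1 - cmod (\<theta> (of_real w)))"
    using kc by (auto simp: kernel_condition_def)
  have dpos: "0 < dyadic_defect r" for r
    using False dyadic_defect_nonneg[of r] unfolding dyadic_defect_def by (metis Re_complex_of_real less_eq_real_def zero_less_power_int zero_less_numeral)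
  have meas: "dyadic_block n \<in> sets \<mu>" for n
  proof -
    have "dyadic_block n \<in> sets borel" unfolding dyadic_block_def by measurable
    then show ?thesis unfolding sets using dyadic_block_subset[of n]
      by (subst sets_restrict_space_iff) auto
  qed
  have sum_bound: "(\<Sum>n\<in>I. ennreal (dyadic_weight r n) * emeasure \<mu> (dyadic_block n)) \<le> ennreal (2 * c / dyadic_defect r)" if I: "finite I" for I r
  proof -
    let ?w = "(2::real) powi r"
    have w: "0 < ?w" by simp
    have "(\<Sum>n\<in>I. ennreal (dyadic_weight r n) * emeasure \<mu> (dyadic_block n)) = (\<Sum>n\<in>I. \<integral>\<^sup>+ s. ennreal (dyadic_weight r n) * indicator (dyadic_block n) s \<partial>\<mu>)"
      using meas by (simp add: nn_integral_cmult_indicator)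
    also have "\<dots> = (\<integral>\<^sup>+ s. (\<Sum>n\<in>I. ennreal (dyadic_weight r n) * indicator (dyadic_block n) s) \<partial>\<mu>)"
      using meas by (intro nn_integral_sum[symmetric]) auto
    also have "\<dots> \<le> (\<integral>\<^sup>+ s. ennreal (?w / (cmod (of_real ?w + s))\<^sup>2) \<partial>\<mu>)"
    proof (rule nn_integral_mono)
      fix s
      show "(\<Sum>n\<in>I. ennreal (dyadic_weight r n) * indicator (dyadic_block n) s) \<le> ennreal (?w / (cmod (of_real ?w + s))\<^sup>2)"
      proof (cases "\<exists>n\<in>I. s \<in> dyadic_block n")
        case True
        then obtain n where n: "n \<in> I" "s \<in> dyadic_block n" by blast
        have "(\<Sum>k\<in>I. ennreal (dyadic_weight r k) * indicator (dyadic_block k) s) = (\<Sum>k\<in>I. if k = n then ennreal (dyadic_weight r n) else 0)"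
          using n dyadic_block_disjoint by (intro sum.cong) (auto split: split_indicator)
        also have "\<dots> = ennreal (dyadic_weight r n)" using n I by simp
        also have "\<dots> \<le> ennreal (?w / (cmod (of_real ?w + s))\<^sup>2)"
        proof (rule ennreal_leI)
          have s: "s = of_real (Re s)" "2 powi n \<le> Re s" "Re s < 2 powi (n + 1)" using n by (auto simp: dyadic_block_def complex_eq_iff)
          have s0: "0 < Re s" using dyadic_block_subset n by blast
          have "cmod (of_real ?w + s) = ?w + Re s"
            by (subst s(1), subst of_real_add[symmetric], subst norm_of_real) (use s0 w in simp)
          moreover have "(?w + Re s)\<^sup>2 \<le> (?w + 2 powi (n + 1))\<^sup>2" using s s0 w by (intro power_mono) auto
          moreover have "0 < (?w + Re s)\<^sup>2" by (intro zero_less_power add_pos_pos w s0)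
          moreover have "0 < (?w + 2 powi (n + 1))\<^sup>2" by (intro zero_less_power add_pos_pos w) simp
          ultimately show "dyadic_weight r n \<le> ?w / (cmod (of_real ?w + s))\<^sup>2"
            unfolding dyadic_weight_def by (intro divide_left_mono mult_pos_pos) (auto simp del: of_real_power_int)
        qed
        finally show ?thesis .
      next
        case False
        then have "(\<Sum>n\<in>I. ennreal (dyadic_weight r n) * indicator (dyadic_block n) s) = 0" by (intro sum.neutral) (auto split: split_indicator)
        then show ?thesis by simp
      qed
    qed
    also have "\<dots> \<le> ennreal c / ennreal (1 - cmod (\<theta> (of_real ?w)))" by (rule c[OF w])
    also have "\<dots> \<le> ennreal (2 * c / dyadic_defect r)"
    proof -
      let ?t = "cmod (\<theta> (of_real ?w))"
      have dd: "dyadic_defect r = (1 - ?t) * (1 + ?t)"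
        unfolding dyadic_defect_def defect_def by (simp add: power2_eq_square algebra_simps)
      have t: "?t \<le> 1" by (rule cmod_le_1) (subst Re_complex_of_real, simp)
      have t1: "0 < 1 - ?t" using dpos[of r] dd t by (cases "?t = 1") auto
      have "(1 - ?t) * (1 + ?t) \<le> (1 - ?t) * 2" using t t1 by (intro mult_left_mono) auto
      then have "dyadic_defect r \<le> 2 * (1 - ?t)" using dd by simp
      then have "2 * c / (2 * (1 - ?t)) \<le> 2 * c / dyadic_defect r"
        using c0 dpos[of r] t1 by (intro divide_left_mono mult_pos_pos) auto
      moreover have "ennreal c / ennreal (1 - ?t) = ennreal (c / (1 - ?t))" using c0 t1 by (intro divide_ennreal) auto
      moreover have "2 * c / (2 * (1 - ?t)) = c / (1 - ?t)" by (rule mult_divide_mult_cancel_left) simp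
      ultimately show ?thesis by (simp only: ennreal_leI)
    qed
    finally show ?thesis .
  qed
  have fin: "emeasure \<mu> (dyadic_block n) < \<infinity>" for n
  proof -
    have "ennreal (dyadic_weight n n) * emeasure \<mu> (dyadic_block n) < \<infinity>" using sum_bound[of "{n}" n] by (auto intro: le_less_trans)
    then show ?thesis using dyadic_weight_pos[of n n] by (auto simp: ennreal_mult_less_top)
  qed
  define m where "m n = measure \<mu> (dyadic_block n)" for n
  have em: "emeasure \<mu> (dyadic_block n) = ennreal (m n)" for n
    unfolding m_def using fin[of n] by (intro emeasure_eq_ennreal_measure) auto
  have m0: "0 \<le> m n" for n by (simp add: m_def)
  have mc: "dyadic_defect r * (\<Sum>n\<in>I. m n * dyadic_weight r n) \<le> 2 * c" if I: "finite I" for I r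
  proof -
    have "ennreal (\<Sum>n\<in>I. m n * dyadic_weight r n) = (\<Sum>n\<in>I. ennreal (dyadic_weight r n) * emeasure \<mu> (dyadic_block n))"
      unfolding em using m0 dyadic_weight_pos by (subst sum_ennreal[symmetric]) (auto simp: ennreal_mult[symmetric] less_imp_le mult.commute intro!: sum.cong)
    also have "\<dots> \<le> ennreal (2 * c / dyadic_defect r)" by (rule sum_bound[OF I])
    finally have "(\<Sum>n\<in>I. m n * dyadic_weight r n) \<le> 2 * c / dyadic_defect r"
      using c0 dpos[of r] by (subst (asm) ennreal_le_iff) auto
    then show ?thesis using dpos[of r] by (simp add: pos_le_divide_eq mult.commute)
  qed
  show ?thesis unfolding carleson_measure_for_def
  proof (intro exI ballI)
    fix f assume f: "f \<in> model_space \<theta>"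
    have cont: "continuous_on \<complex>\<^sub>+ f" by (rule hardy_continuous[OF model_space_hardy[OF f]])
    have "f \<in> borel_measurable (restrict_space borel \<complex>\<^sub>+)" by (rule borel_measurable_continuous_on_restrict[OF cont])
    then have fm [measurable]: "f \<in> borel_measurable \<mu>" using measurable_cong_sets[OF sets refl] by blast
    have "\<exists>x. 2 powi n \<le> x \<and> x \<le> 2 powi (n + 1) \<and> (\<forall>y. 2 powi n \<le> y \<and> y \<le> 2 powi (n + 1) \<longrightarrow> cmod (f (of_real y)) \<le> cmod (f (of_real x)))" for n :: int
    proof -
      have p: "(0::real) < 2 powi n" by simp
      have "continuous_on {2 powi n..2 powi (n + 1)} (\<lambda>x::real. cmod (f (of_real x)))"
        by (intro continuous_on_norm continuous_on_compose2[OF cont] continuous_intros) (auto intro: less_le_trans[OF p])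
      moreover have "{2 powi n..2 powi (n + 1)} \<noteq> ({} :: real set)" by (simp add: powi2_simps)
      ultimately show ?thesis
        using continuous_attains_sup[of "{2 powi n..2 powi (n + 1)}" "\<lambda>x::real. cmod (f (of_real x))"] by auto
    qed
    then obtain s where s: "\<And>n. 2 powi n \<le> s n" "\<And>n. s n \<le> 2 powi (n + 1)"
      and smax: "\<And>n y. 2 powi n \<le> y \<Longrightarrow> y \<le> 2 powi (n + 1) \<Longrightarrow> cmod (f (of_real y)) \<le> cmod (f (of_real (s n)))"
      by metis
    define J where "J k = {- int k..int k}" for k :: nat
    define G where "G k z = (\<Sum>n\<in>J k. ennreal ((cmod (f (of_real (s n))))\<^sup>2) * indicator (dyadic_block n) z)" for k z
    have Gm: "G k \<in> borel_measurable \<mu>" for k unfolding G_def using meas by measurable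
    have Gint: "(\<integral>\<^sup>+ z. G k z \<partial>\<mu>) \<le> ennreal (9216 * (2 * c) * (h2_norm f)\<^sup>2)" for k
    proof -
      have "(\<integral>\<^sup>+ z. G k z \<partial>\<mu>) = (\<Sum>n\<in>J k. \<integral>\<^sup>+ z. ennreal ((cmod (f (of_real (s n))))\<^sup>2) * indicator (dyadic_block n) z \<partial>\<mu>)"
        unfolding G_def using meas by (intro nn_integral_sum) auto
      also have "\<dots> = (\<Sum>n\<in>J k. ennreal (m n * (cmod (f (of_real (s n))))\<^sup>2))"
        by (intro sum.cong refl, subst nn_integral_cmult_indicator[OF meas]) (simp add: em m0 ennreal_mult mult.commute)
      also have "\<dots> = ennreal (\<Sum>n\<in>J k. m n * (cmod (f (of_real (s n))))\<^sup>2)"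
        using m0 by (intro sum_ennreal) auto
      also have "\<dots> \<le> ennreal (9216 * (2 * c) * (h2_norm f)\<^sup>2)"
        using c0 by (intro ennreal_leI discrete_carleson f m0 s mc) (auto simp: J_def)
      finally show ?thesis .
    qed
    have "incseq G"
      unfolding G_def by (intro incseq_SucI le_funI sum_mono2) (auto simp: J_def)
    then have SUPint: "(\<integral>\<^sup>+ z. (SUP k. G k z) \<partial>\<mu>) = (SUP k. \<integral>\<^sup>+ z. G k z \<partial>\<mu>)"
      by (intro nn_integral_monotone_convergence_SUP Gm)
    have "(\<integral>\<^sup>+ z. ennreal ((cmod (f z))\<^sup>2) \<partial>\<mu>) \<le> (\<integral>\<^sup>+ z. (SUP k. G k z) \<partial>\<mu>)"
    proof (rule nn_integral_mono_AE)
      have "AE z in \<mu>. z \<notin> \<complex>\<^sub>+ - complex_of_real ` {0..}"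
      proof (rule AE_not_in)
        have axis: "complex_of_real ` {0..} = {z. Im z = 0 \<and> 0 \<le> Re z}"
          by (auto simp: image_iff complex_eq_iff intro!: bexI[of _ "Re z" for z])
        have "\<complex>\<^sub>+ - complex_of_real ` {0..} \<in> sets borel" unfolding axis by measurable
        then have "\<complex>\<^sub>+ - complex_of_real ` {0..} \<in> sets \<mu>"
          unfolding sets by (subst sets_restrict_space_iff) auto
        then show "\<complex>\<^sub>+ - complex_of_real ` {0..} \<in> null_sets \<mu>" using null by auto
      qed
      moreover have "AE z in \<mu>. z \<in> \<complex>\<^sub>+" using space by (intro AE_I2) simp
      ultimately show "AE z in \<mu>. ennreal ((cmod (f z))\<^sup>2) \<le> (SUP k. G k z)"
      proof eventually_elim
        case (elim z)
        then obtain x where x: "z = complex_of_real x" "0 < x" by auto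
        then obtain n where n: "z \<in> dyadic_block n" using ex_dyadic_block by blast
        then have nx: "2 powi n \<le> x" "x \<le> 2 powi (n + 1)" using x by (auto simp: dyadic_block_def)
        define k where "k = nat \<bar>n\<bar>"
        have nk: "n \<in> J k" by (auto simp: J_def k_def)
        have "ennreal ((cmod (f z))\<^sup>2) \<le> ennreal ((cmod (f (of_real (s n))))\<^sup>2) * indicator (dyadic_block n) z"
          using n smax[OF nx] x by (auto intro!: ennreal_leI power_mono)
        also have "\<dots> \<le> G k z" unfolding G_def using nk by (intro member_le_sum) (auto simp: J_def)
        also have "\<dots> \<le> (SUP k. G k z)" by (rule SUP_upper) simp
        finally show ?case .
      qed
    qed
    also have "\<dots> \<le> ennreal (9216 * (2 * c) * (h2_norm f)\<^sup>2)"
      unfolding SUPint by (intro SUP_least Gint)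
    also have "\<dots> = ennreal ((sqrt (9216 * (2 * c)) * h2_norm f)\<^sup>2)" using c0 by (simp add: power_mult_distrib)
    finally show "(\<integral>\<^sup>+ z. ennreal ((cmod (f z))\<^sup>2) \<partial>\<mu>) \<le> ennreal ((sqrt (9216 * (2 * c)) * h2_norm f)\<^sup>2)" .
  qed
qed

end

section \<open>Regular boundary points\<close>

lemma cauchy_integral_lipschitz:
  fixes \<phi> z :: "real \<Rightarrow> complex"
  assumes ab: "a \<le> b" and c: "continuous_on {a..b} \<phi>" "continuous_on {a..b} z"
    and M: "\<And>t. t \<in> {a..b} \<Longrightarrow> cmod (\<phi> t) \<le> M"
    and r: "0 < r" "\<And>t. t \<in> {a..b} \<Longrightarrow> r \<le> cmod (z t - w)" "\<And>t. t \<in> {a..b} \<Longrightarrow> r \<le> cmod (z t - w')"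
  shows "cmod (integral {a..b} (\<lambda>t. \<phi> t / (z t - w)) - integral {a..b} (\<lambda>t. \<phi> t / (z t - w')))
    \<le> (M * cmod (w - w') / r\<^sup>2) * (b - a)"
proof -
  have ne: "z t \<noteq> w" "z t \<noteq> w'" if "t \<in> {a..b}" for t using r(1) r(2)[OF that] r(3)[OF that] by auto
  have i: "(\<lambda>t. \<phi> t / (z t - w)) integrable_on {a..b}" "(\<lambda>t. \<phi> t / (z t - w')) integrable_on {a..b}"
    using c ne by (auto intro!: integrable_continuous_real continuous_intros)
  have "cmod (integral {a..b} (\<lambda>t. \<phi> t / (z t - w) - \<phi> t / (z t - w'))) \<le> (M * cmod (w - w') / r\<^sup>2) * (b - a)"
  proof (rule integral_bound[OF ab])
    show "continuous_on {a..b} (\<lambda>t. \<phi> t / (z t - w) - \<phi> t / (z t - w'))"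
      using c ne by (intro continuous_intros) auto
    fix t assume t: "t \<in> {a..b}"
    have M0: "0 \<le> M" using M[OF t] norm_ge_zero order_trans by blast
    have "\<phi> t / (z t - w) - \<phi> t / (z t - w') = \<phi> t * (w - w') / ((z t - w) * (z t - w'))"
      using ne[OF t] by (simp add: field_simps)
    then have "cmod (\<phi> t / (z t - w) - \<phi> t / (z t - w')) = cmod (\<phi> t) * cmod (w - w') / (cmod (z t - w) * cmod (z t - w'))"
      by (simp add: norm_mult norm_divide)
    also have "\<dots> \<le> M * cmod (w - w') / (r * r)"
      by (rule frac_le[OF mult_nonneg_nonneg[OF M0 norm_ge_zero] mult_right_mono[OF M[OF t] norm_ge_zero] _ mult_mono[OF r(2)[OF t] r(3)[OF t]]])
        (use r(1) in auto)
    finally show "cmod (\<phi> t / (z t - w) - \<phi> t / (z t - w')) \<le> M * cmod (w - w') / r\<^sup>2" by (simp add: power2_eq_square)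
  qed
  then show ?thesis using i by (simp add: Henstock_Kurzweil_Integration.integral_diff)
qed

lemma three_edges_lipschitz:
  fixes h :: "complex \<Rightarrow> complex"
  assumes x: "0 < x" "x < \<rho>" and c: "continuous_on (cbox (Complex x (- \<rho>)) (Complex \<rho> \<rho>)) h"
    and M: "\<And>z. z \<in> cbox (Complex x (- \<rho>)) (Complex \<rho> \<rho>) \<Longrightarrow> cmod (h z) \<le> M"
    and w: "w < \<rho> / 2" "w' < \<rho> / 2"
    and R: "\<And>v. R v = integral {x..\<rho>} (\<lambda>u. h (Complex u (- \<rho>)) / (Complex u (- \<rho>) - of_real v)) - integral {x..\<rho>} (\<lambda>u. h (Complex u \<rho>) / (Complex u \<rho> - of_real v))
          + \<i> * integral {- \<rho>..\<rho>} (\<lambda>y. h (Complex \<rho> y) / (Complex \<rho> y - of_real v))"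
  shows "cmod (R w - R w') \<le> 16 * M / \<rho> * \<bar>w - w'\<bar>"
proof -
  have \<rho>: "0 < \<rho>" using x by simp
  have r: "0 < \<rho> / 2" using \<rho> by simp
  have M0: "0 \<le> M" using order_trans[OF norm_ge_zero M[of "Complex \<rho> 0"]] x \<rho> by (simp add: in_cbox_complex_iff)
  let ?K = "M * cmod (of_real w - of_real w' :: complex) / (\<rho> / 2)\<^sup>2"
  have h1: "cmod (integral {x..\<rho>} (\<lambda>u. h (Complex u t) / (Complex u t - of_real w)) - integral {x..\<rho>} (\<lambda>u. h (Complex u t) / (Complex u t - of_real w')))
    \<le> ?K * \<rho>" if t: "t = \<rho> \<or> t = - \<rho>" for t
  proof -
    have "cmod (integral {x..\<rho>} (\<lambda>u. h (Complex u t) / (Complex u t - of_real w)) - integral {x..\<rho>} (\<lambda>u. h (Complex u t) / (Complex u t - of_real w')))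
      \<le> ?K * (\<rho> - x)"
    proof (rule cauchy_integral_lipschitz[OF _ _ _ _ r])
      show "continuous_on {x..\<rho>} (\<lambda>u. h (Complex u t))"
        by (rule continuous_on_compose2[OF c continuous_on_Complex(2)]) (use x t in \<open>auto simp: in_cbox_complex_iff\<close>)
      have "\<rho> / 2 \<le> cmod (Complex u t - of_real v)" for u v
        using abs_Im_le_cmod[of "Complex u t - of_real v"] t \<rho> by auto
      then show "\<rho> / 2 \<le> cmod (Complex u t - of_real w)" "\<rho> / 2 \<le> cmod (Complex u t - of_real w')" for u by blast+
      show "cmod (h (Complex u t)) \<le> M" if "u \<in> {x..\<rho>}" for u
        by (rule M) (use that t \<rho> in \<open>auto simp: in_cbox_complex_iff\<close>)
    qed (use x continuous_on_Complex in auto)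
    also have "\<dots> \<le> ?K * \<rho>" using x M0 by (intro mult_left_mono) auto
    finally show ?thesis .
  qed
  have h2: "cmod (integral {- \<rho>..\<rho>} (\<lambda>y. h (Complex \<rho> y) / (Complex \<rho> y - of_real w)) - integral {- \<rho>..\<rho>} (\<lambda>y. h (Complex \<rho> y) / (Complex \<rho> y - of_real w')))
    \<le> ?K * (\<rho> - (- \<rho>))"
  proof (rule cauchy_integral_lipschitz[OF _ _ _ _ r])
    show "continuous_on {- \<rho>..\<rho>} (\<lambda>y. h (Complex \<rho> y))"
      by (rule continuous_on_compose2[OF c continuous_on_Complex(1)]) (use x in \<open>auto simp: in_cbox_complex_iff\<close>)
    have "\<rho> / 2 \<le> cmod (Complex \<rho> y - of_real v)" if "v < \<rho> / 2" for y v
      using abs_Re_le_cmod[of "Complex \<rho> y - of_real v"] that by auto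
    then show "\<rho> / 2 \<le> cmod (Complex \<rho> y - of_real w)" "\<rho> / 2 \<le> cmod (Complex \<rho> y - of_real w')" for y using w by auto
    show "cmod (h (Complex \<rho> y)) \<le> M" if "y \<in> {- \<rho>..\<rho>}" for y
      by (rule M) (use that x in \<open>auto simp: in_cbox_complex_iff\<close>)
  qed (use \<rho> continuous_on_Complex in auto)
  have tri: "cmod ((a - b + \<i> * c) - (a' - b' + \<i> * c')) \<le> cmod (a - a') + cmod (b - b') + cmod (c - c')" for a b c a' b' c'
  proof -
    have "(a - b + \<i> * c) - (a' - b' + \<i> * c') = ((a - a') - (b - b')) + \<i> * (c - c')" by (simp add: algebra_simps)
    also have "cmod \<dots> \<le> cmod ((a - a') - (b - b')) + cmod (\<i> * (c - c'))" by (rule norm_triangle_ineq)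
    also have "\<dots> \<le> cmod (a - a') + cmod (b - b') + cmod (c - c')"
      using norm_triangle_ineq4[of "a - a'" "b - b'"] by (simp add: norm_mult)
    finally show ?thesis .
  qed
  have "cmod (R w - R w') \<le> ?K * \<rho> + ?K * \<rho> + ?K * (\<rho> - (- \<rho>))"
    unfolding R by (rule order_trans[OF tri]) (intro add_mono h1 h2; simp)
  also have "\<dots> = 16 * M / \<rho> * \<bar>w - w'\<bar>"
    using \<rho> by (simp add: field_simps power2_eq_square flip: of_real_diff)
  finally show ?thesis .
qed

text \<open>Apply Cauchy's formula to \<open>g\<close> at \<open>w\<close> on the rectangle from \<open>x - i\<rho>\<close> to \<open>\<rho> + i\<rho>\<close>, and Cauchy's theorem to
  \<open>1 / g\<close> with the Cauchy kernel at the mirror image \<open>- w\<close>. Where \<open>|g| = 1\<close> one has \<open>g = 1 / cnj g\<close>; so in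
  the limit \<open>x \<rightarrow> 0\<close> the left edge of the first integral is cancelled by the left edge of the conjugate
  of the second. This is Schwarz's reflection principle for boundary values that exist in a mean sense
  only. The remaining three edges have distance at least \<open>\<rho> / 2\<close> from \<open>w\<close>, and their contribution is a
  Lipschitz function of \<open>w\<close>.\<close>
lemma boundary_lipschitz:
  fixes g :: "complex \<Rightarrow> complex"
  assumes hol: "g holomorphic_on \<complex>\<^sub>+" and \<rho>: "0 < \<rho>" and \<delta>: "0 < \<delta>"
    and lower: "\<And>z. 0 < Re z \<Longrightarrow> Re z \<le> \<rho> \<Longrightarrow> \<bar>Im z\<bar> \<le> \<rho> \<Longrightarrow> \<delta> \<le> cmod (g z)"
    and upper: "\<And>z. 0 < Re z \<Longrightarrow> cmod (g z) \<le> 1"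
    and lim: "((\<lambda>x. integral {- \<rho>..\<rho>} (\<lambda>y. 1 - (cmod (g (Complex x y)))\<^sup>2)) \<longlongrightarrow> 0) (at_right 0)"
    and w: "0 < w" "w < \<rho> / 2" "0 < w'" "w' < \<rho> / 2"
  shows "cmod (g (of_real w) - g (of_real w')) \<le> 3 / \<rho> * (1 + 1 / \<delta>) * \<bar>w - w'\<bar>"
proof -
  have cont: "continuous_on \<complex>\<^sub>+ g" using hol by (rule holomorphic_on_imp_continuous_on)
  define D where "D x = integral {- \<rho>..\<rho>} (\<lambda>y. 1 - (cmod (g (Complex x y)))\<^sup>2)" for x
  define R where "R h x v = integral {x..\<rho>} (\<lambda>u. h (Complex u (- \<rho>)) / (Complex u (- \<rho>) - of_real v)) - integral {x..\<rho>} (\<lambda>u. h (Complex u \<rho>) / (Complex u \<rho> - of_real v))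
          + \<i> * integral {- \<rho>..\<rho>} (\<lambda>y. h (Complex \<rho> y) / (Complex \<rho> y - of_real v))"
    for h :: "complex \<Rightarrow> complex" and x v :: real
  let ?g' = "\<lambda>z. 1 / g z"
  define L where "L x v = integral {- \<rho>..\<rho>} (\<lambda>y. g (Complex x y) / (Complex x y - of_real v) - cnj (1 / g (Complex x y)) / (Complex (- x) y - of_real v))"
    for x v :: real
  have box: "cbox (Complex x (- \<rho>)) (Complex \<rho> \<rho>) \<subseteq> \<complex>\<^sub>+" if "0 < x" for x using that by (auto simp: in_cbox_complex_iff)
  have gne: "g z \<noteq> 0" "cmod (1 / g z) \<le> 1 / \<delta>" if "0 < Re z" "Re z \<le> \<rho>" "\<bar>Im z\<bar> \<le> \<rho>" for z
    using lower[OF that] \<delta> by (auto simp: norm_divide intro!: divide_left_mono mult_pos_pos)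
  have hg': "?g' holomorphic_on cbox (Complex x (- \<rho>)) (Complex \<rho> \<rho>)" if "0 < x" for x
    using that gne by (intro holomorphic_intros holomorphic_on_subset[OF hol box]) (auto simp: in_cbox_complex_iff)
  have vc: "continuous_on {- \<rho>..\<rho>} (\<lambda>y. g (Complex x y))" if "0 < x" for x
    by (rule continuous_on_compose2[OF cont continuous_on_Complex(1)]) (use that in auto)
  have iden: "2 * pi * \<i> * g (of_real v) = R g x v - cnj (R ?g' x (- v)) - \<i> * L x v"
    if x: "0 < x" "x < v" and v: "v < \<rho> / 2" for x v
  proof -
    have xr: "x < \<rho>" "- \<rho> < \<rho>" using x v \<rho> by auto
    have g0: "g (Complex x y) \<noteq> 0" if "y \<in> {- \<rho>..\<rho>}" for y by (rule gne) (use that x v \<rho> in auto)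
    have ne1: "Complex x y \<noteq> of_real v" "Complex (- x) y \<noteq> of_real v" "Complex x y \<noteq> of_real (- v)" for y using x by (auto simp: complex_eq_iff)
    have "(if of_real v \<in> box (Complex x (- \<rho>)) (Complex \<rho> \<rho>) then 2 * pi * \<i> * g (of_real v) else 0)
      = R g x v - \<i> * integral {- \<rho>..\<rho>} (\<lambda>y. g (Complex x y) / (Complex x y - of_real v))"
      unfolding R_def
      by (subst Cauchy_rectangle[OF xr, of "cbox (Complex x (- \<rho>)) (Complex \<rho> \<rho>)"])
        (use x v \<rho> in \<open>auto simp: path_image_rectpath in_cbox_complex_iff algebra_simps intro!: holomorphic_on_subset[OF hol box]\<close>)
    then have 1: "2 * pi * \<i> * g (of_real v) = R g x v - \<i> * integral {- \<rho>..\<rho>} (\<lambda>y. g (Complex x y) / (Complex x y - of_real v))"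
      using x v \<rho> by (simp add: in_box_complex_iff)
    have "(if of_real (- v) \<in> box (Complex x (- \<rho>)) (Complex \<rho> \<rho>) then 2 * pi * \<i> * ?g' (of_real (- v)) else 0)
      = R ?g' x (- v) - \<i> * integral {- \<rho>..\<rho>} (\<lambda>y. ?g' (Complex x y) / (Complex x y - of_real (- v)))"
      unfolding R_def
      by (subst Cauchy_rectangle[OF xr, of "cbox (Complex x (- \<rho>)) (Complex \<rho> \<rho>)" ?g'])
        (use x v \<rho> hg'[OF x(1)] in \<open>auto simp: path_image_rectpath in_cbox_complex_iff algebra_simps\<close>)
    then have "0 = R ?g' x (- v) - \<i> * integral {- \<rho>..\<rho>} (\<lambda>y. ?g' (Complex x y) / (Complex x y - of_real (- v)))"
      using x v \<rho> by (simp add: in_box_complex_iff)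
    then have "0 = cnj (R ?g' x (- v) - \<i> * integral {- \<rho>..\<rho>} (\<lambda>y. ?g' (Complex x y) / (Complex x y - of_real (- v))))"
      by (metis complex_cnj_zero)
    also have "\<dots> = cnj (R ?g' x (- v)) + \<i> * integral {- \<rho>..\<rho>} (\<lambda>y. cnj (?g' (Complex x y) / (Complex x y - of_real (- v))))"
      by (simp add: Henstock_Kurzweil_Integration.integral_cnj)
    also have "integral {- \<rho>..\<rho>} (\<lambda>y. cnj (?g' (Complex x y) / (Complex x y - of_real (- v))))
      = integral {- \<rho>..\<rho>} (\<lambda>y. - (cnj (?g' (Complex x y)) / (Complex (- x) y - of_real v)))"
    proof (rule integral_cong)
      fix y
      have "cnj (Complex x y - of_real (- v)) = - (Complex (- x) y - of_real v)" by (simp add: complex_eq_iff)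
      then show "cnj (?g' (Complex x y) / (Complex x y - of_real (- v))) = - (cnj (?g' (Complex x y)) / (Complex (- x) y - of_real v))"
        by (simp only: complex_cnj_divide divide_minus_right)
    qed
    finally have 2: "cnj (R ?g' x (- v)) = \<i> * integral {- \<rho>..\<rho>} (\<lambda>y. cnj (?g' (Complex x y)) / (Complex (- x) y - of_real v))"
      by (simp add: algebra_simps)
    have i1: "(\<lambda>y. g (Complex x y) / (Complex x y - of_real v)) integrable_on {- \<rho>..\<rho>}"
      using vc[OF x(1)] ne1 by (intro integrable_continuous_real continuous_intros continuous_on_Complex) auto
    have i2: "(\<lambda>y. cnj (?g' (Complex x y)) / (Complex (- x) y - of_real v)) integrable_on {- \<rho>..\<rho>}"
      using vc[OF x(1)] ne1 g0 by (intro integrable_continuous_real continuous_intros continuous_on_Complex) auto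
    have E: "L x v = integral {- \<rho>..\<rho>} (\<lambda>y. g (Complex x y) / (Complex x y - of_real v))
      - integral {- \<rho>..\<rho>} (\<lambda>y. cnj (?g' (Complex x y)) / (Complex (- x) y - of_real v))"
      unfolding L_def using i1 i2 by (rule Henstock_Kurzweil_Integration.integral_diff)
    show ?thesis unfolding 1 2 E right_diff_distrib by simp
  qed
  have Lb: "cmod (L x v) \<le> 2 / (v * \<delta>) * D x + 8 * \<rho> * x / (\<delta> * v\<^sup>2)" if x: "0 < x" "x < v / 2" and v: "v < \<rho> / 2" for x v
  proof -
    have v0: "0 < v" using x by simp
    have ne1: "Complex x y \<noteq> of_real v" "Complex (- x) y \<noteq> of_real v" for y using x by (auto simp: complex_eq_iff)
    have g0: "g (Complex x y) \<noteq> 0" "cmod (1 / g (Complex x y)) \<le> 1 / \<delta>" if "y \<in> {- \<rho>..\<rho>}" for y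
    proof -
      have "0 < Re (Complex x y)" "Re (Complex x y) \<le> \<rho>" "\<bar>Im (Complex x y)\<bar> \<le> \<rho>" using that x v \<rho> by auto
      then show "g (Complex x y) \<noteq> 0" "cmod (1 / g (Complex x y)) \<le> 1 / \<delta>" by (rule gne)+
    qed
    have "cmod (L x v) \<le> integral {- \<rho>..\<rho>} (\<lambda>y. 2 / (v * \<delta>) * (1 - (cmod (g (Complex x y)))\<^sup>2) + 4 * x / (\<delta> * v\<^sup>2))"
      unfolding L_def
    proof (rule integral_norm_bound_integral)
      show "(\<lambda>y. g (Complex x y) / (Complex x y - of_real v) - cnj (1 / g (Complex x y)) / (Complex (- x) y - of_real v)) integrable_on {- \<rho>..\<rho>}"
        using vc[OF x(1)] ne1 g0(1) by (intro integrable_continuous_real continuous_intros continuous_on_Complex) auto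
      show "(\<lambda>y. 2 / (v * \<delta>) * (1 - (cmod (g (Complex x y)))\<^sup>2) + 4 * x / (\<delta> * v\<^sup>2)) integrable_on {- \<rho>..\<rho>}"
        using vc[OF x(1)] by (intro integrable_continuous_real continuous_intros) auto
      fix y assume y: "y \<in> {- \<rho>..\<rho>}"
      define G p q where "G = g (Complex x y)" and "p = Complex x y - of_real v" and "q = Complex (- x) y - of_real v"
      have G: "G \<noteq> 0" "cmod (1 / G) \<le> 1 / \<delta>" "cmod G \<le> 1" using g0[OF y] upper[of "Complex x y"] x by (auto simp: G_def)
      have p: "v / 2 \<le> cmod p" using abs_Re_le_cmod[of p] x by (auto simp: p_def)
      have q: "v \<le> cmod q" using abs_Re_le_cmod[of q] x by (auto simp: q_def)
      have pq: "p \<noteq> 0" "q \<noteq> 0" using p q v0 by auto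
      have qp: "q - p = of_real (- 2 * x)" by (simp add: p_def q_def complex_eq_iff)
      have "cnj (1 / G) * (G * cnj G) = (cnj (1 / G) * cnj G) * G" by (simp only: mult_ac)
      also have "cnj (1 / G) * cnj G = 1" using G(1) by simp
      finally have cG: "cnj (1 / G) * of_real ((cmod G)\<^sup>2) = G" by (simp only: complex_norm_square mult_1_left)
      have "- (of_real (1 - (cmod G)\<^sup>2) * cnj (1 / G)) = cnj (1 / G) * of_real ((cmod G)\<^sup>2) - cnj (1 / G)"
        by (simp only: of_real_diff of_real_1 left_diff_distrib mult_1_left minus_diff_eq) (simp only: mult.commute)
      then have e1: "G - cnj (1 / G) = - (of_real (1 - (cmod G)\<^sup>2) * cnj (1 / G))" unfolding cG by (rule sym)
      have "(q - p) / (p * q) = q / (p * q) - p / (p * q)" by (rule diff_divide_distrib)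
      then have e2: "1 / p - 1 / q = of_real (- 2 * x) / (p * q)" unfolding qp using pq by simp
      have e3: "G / p - c / q = (G - c) / p + c * (1 / p - 1 / q)" for c
        unfolding diff_divide_distrib right_diff_distrib by simp
      have eq: "G / p - cnj (1 / G) / q = - (of_real (1 - (cmod G)\<^sup>2) * cnj (1 / G)) / p + cnj (1 / G) * (of_real (- 2 * x) / (p * q))"
        unfolding e3 e1 e2 by (rule refl)
      have d0: "0 \<le> 1 - (cmod G)\<^sup>2" using G(3) by (simp add: power_le_one)
      have tri: "cmod (G / p - cnj (1 / G) / q) \<le> cmod (- (of_real (1 - (cmod G)\<^sup>2) * cnj (1 / G)) / p) + cmod (cnj (1 / G) * (of_real (- 2 * x) / (p * q)))"
        unfolding eq by (rule norm_triangle_ineq)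
      have "cmod (- (of_real (1 - (cmod G)\<^sup>2) * cnj (1 / G)) / p) = (1 - (cmod G)\<^sup>2) * cmod (1 / G) / cmod p"
        using d0 by (simp only: norm_divide norm_minus_cancel norm_mult norm_of_real abs_of_nonneg complex_mod_cnj)
      also have "\<dots> \<le> (1 - (cmod G)\<^sup>2) * (1 / \<delta>) / (v / 2)"
        by (rule frac_le[OF mult_nonneg_nonneg[OF d0] mult_left_mono[OF G(2) d0] _ p]) (use v0 \<delta> in auto)
      also have "\<dots> = 2 / (v * \<delta>) * (1 - (cmod G)\<^sup>2)" using v0 \<delta> by (simp add: field_simps)
      finally have t1: "cmod (- (of_real (1 - (cmod G)\<^sup>2) * cnj (1 / G)) / p) \<le> 2 / (v * \<delta>) * (1 - (cmod G)\<^sup>2)" .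
      have pq': "v / 2 * v \<le> cmod p * cmod q" using p q v0 by (intro mult_mono) auto
      have "cmod (cnj (1 / G) * (of_real (- 2 * x) / (p * q))) = cmod (1 / G) * (2 * x / (cmod p * cmod q))"
        unfolding norm_mult[of "cnj (1 / G)"] norm_divide[of "of_real (- 2 * x)"] norm_mult[of p] complex_mod_cnj norm_of_real
        using x by simp
      also have "\<dots> \<le> (1 / \<delta>) * (2 * x / (v / 2 * v))"
        by (rule mult_mono[OF G(2) frac_le[OF _ _ _ pq']]) (use v0 x \<delta> in auto)
      also have "\<dots> = 4 * x / (\<delta> * v\<^sup>2)" by (simp add: power2_eq_square)
      finally have t2: "cmod (cnj (1 / G) * (of_real (- 2 * x) / (p * q))) \<le> 4 * x / (\<delta> * v\<^sup>2)" .
      show "cmod (g (Complex x y) / (Complex x y - of_real v) - cnj (1 / g (Complex x y)) / (Complex (- x) y - of_real v))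
          \<le> 2 / (v * \<delta>) * (1 - (cmod (g (Complex x y)))\<^sup>2) + 4 * x / (\<delta> * v\<^sup>2)"
        using order_trans[OF tri add_mono[OF t1 t2]] unfolding G_def p_def q_def .
    qed
    also have "\<dots> = 2 / (v * \<delta>) * D x + 8 * \<rho> * x / (\<delta> * v\<^sup>2)"
    proof -
      have i: "(\<lambda>y. 1 - (cmod (g (Complex x y)))\<^sup>2) integrable_on {- \<rho>..\<rho>}"
        using vc[OF x(1)] by (intro integrable_continuous_real continuous_intros) auto
      have "integral {- \<rho>..\<rho>} (\<lambda>y. 2 / (v * \<delta>) * (1 - (cmod (g (Complex x y)))\<^sup>2) + 4 * x / (\<delta> * v\<^sup>2))
        = integral {- \<rho>..\<rho>} (\<lambda>y. 2 / (v * \<delta>) * (1 - (cmod (g (Complex x y)))\<^sup>2)) + integral {- \<rho>..\<rho>} (\<lambda>y. 4 * x / (\<delta> * v\<^sup>2))"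
        using integrable_on_mult_right[OF i, of "2 / (v * \<delta>)"] by (intro Henstock_Kurzweil_Integration.integral_add) auto
      also have "integral {- \<rho>..\<rho>} (\<lambda>y. 2 / (v * \<delta>) * (1 - (cmod (g (Complex x y)))\<^sup>2)) = 2 / (v * \<delta>) * D x"
        unfolding D_def by (rule Henstock_Kurzweil_Integration.integral_mult_right)
      finally show ?thesis using \<rho> by (simp add: algebra_simps)
    qed
    finally show ?thesis .
  qed
  have L0: "((\<lambda>x. 2 / (v * \<delta>) * D x + 8 * \<rho> * x / (\<delta> * v\<^sup>2)) \<longlongrightarrow> 0) (at_right 0)" for v
  proof -
    have "((\<lambda>x. 2 / (v * \<delta>) * D x + 8 * \<rho> * x / (\<delta> * v\<^sup>2)) \<longlongrightarrow> 2 / (v * \<delta>) * 0 + 8 * \<rho> * 0 / (\<delta> * v\<^sup>2)) (at_right 0)"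
      unfolding divide_inverse using lim unfolding D_def[symmetric] by (intro tendsto_intros) auto
    then show ?thesis by simp
  qed
  let ?B = "16 * 1 / \<rho> * \<bar>w - w'\<bar> + 16 * (1 / \<delta>) / \<rho> * \<bar>w - w'\<bar>"
  have "\<forall>\<^sub>F x in at_right 0. cmod (2 * pi * \<i> * g (of_real w) - 2 * pi * \<i> * g (of_real w'))
     \<le> ?B + (2 / (w * \<delta>) * D x + 8 * \<rho> * x / (\<delta> * w\<^sup>2)) + (2 / (w' * \<delta>) * D x + 8 * \<rho> * x / (\<delta> * w'\<^sup>2))"
  proof -
    have "\<forall>\<^sub>F x in at_right 0. 0 < x \<and> x < w / 2 \<and> x < w' / 2"
      using w by (auto simp: eventually_at_right_field intro!: exI[of _ "min (w / 2) (w' / 2)"])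
    then show ?thesis
    proof eventually_elim
      case (elim x)
      then have x: "0 < x" "x < w / 2" "x < w' / 2" "x < w" "x < w'" "x < \<rho>" using w by auto
      have a1: "cmod (R g x w - R g x w') \<le> 16 * 1 / \<rho> * \<bar>w - w'\<bar>"
        by (rule three_edges_lipschitz[where x=x and h=g and R="R g x"])
          (use x w upper in \<open>auto simp: R_def in_cbox_complex_iff intro!: continuous_on_subset[OF cont box]\<close>)
      have a2: "cmod (R ?g' x (- w) - R ?g' x (- w')) \<le> 16 * (1 / \<delta>) / \<rho> * \<bar>- w - (- w')\<bar>"
      proof (rule three_edges_lipschitz[where x=x and h="?g'" and R="R ?g' x"])
        show "continuous_on (cbox (Complex x (- \<rho>)) (Complex \<rho> \<rho>)) ?g'"
          by (rule holomorphic_on_imp_continuous_on[OF hg'[OF x(1)]])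
        show "cmod (1 / g z) \<le> 1 / \<delta>" if "z \<in> cbox (Complex x (- \<rho>)) (Complex \<rho> \<rho>)" for z
          using that x by (intro gne) (auto simp: in_cbox_complex_iff)
      qed (use x w in \<open>auto simp: R_def\<close>)
      have a3: "2 * pi * \<i> * g (of_real w) - 2 * pi * \<i> * g (of_real w')
         = (R g x w - R g x w') - cnj (R ?g' x (- w) - R ?g' x (- w')) - \<i> * L x w + \<i> * L x w'"
        unfolding iden[OF x(1,4) w(2)] iden[OF x(1,5) w(4)] by simp
      have tri: "cmod (A - cnj B - \<i> * l + \<i> * l') \<le> cmod A + cmod B + cmod l + cmod l'" for A B l l'
      proof -
        have "cmod (A - cnj B - \<i> * l + \<i> * l') \<le> cmod (A - cnj B - \<i> * l) + cmod (\<i> * l')" by (rule norm_triangle_ineq)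
        also have "cmod (A - cnj B - \<i> * l) \<le> cmod (A - cnj B) + cmod (\<i> * l)" by (rule norm_triangle_ineq4)
        also have "cmod (A - cnj B) \<le> cmod A + cmod (cnj B)" by (rule norm_triangle_ineq4)
        finally show ?thesis by (simp add: norm_mult)
      qed
      have "cmod (2 * pi * \<i> * g (of_real w) - 2 * pi * \<i> * g (of_real w'))
         \<le> cmod (R g x w - R g x w') + cmod (R ?g' x (- w) - R ?g' x (- w')) + cmod (L x w) + cmod (L x w')"
        unfolding a3 by (rule tri)
      moreover have "\<bar>- w - (- w')\<bar> = \<bar>w - w'\<bar>" by simp
      ultimately show ?case
        using a1 a2 Lb[OF x(1,2) w(2)] Lb[OF x(1,3) w(4)] by (simp only:)
    qed
  qed
  moreover have "((\<lambda>x. ?B + (2 / (w * \<delta>) * D x + 8 * \<rho> * x / (\<delta> * w\<^sup>2)) + (2 / (w' * \<delta>) * D x + 8 * \<rho> * x / (\<delta> * w'\<^sup>2))) \<longlongrightarrow> ?B + 0 + 0) (at_right 0)"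
    by (rule tendsto_add[OF tendsto_add[OF tendsto_const L0[of w]] L0[of w']])
  ultimately have fin: "cmod (2 * pi * \<i> * g (of_real w) - 2 * pi * \<i> * g (of_real w')) \<le> ?B + 0 + 0"
    by (intro tendsto_lowerbound) auto
  define X where "X = cmod (g (of_real w) - g (of_real w'))"
  define K where "K = 1 / \<rho> * (1 + 1 / \<delta>) * \<bar>w - w'\<bar>"
  have "2 * pi * \<i> * g (of_real w) - 2 * pi * \<i> * g (of_real w') = 2 * pi * \<i> * (g (of_real w) - g (of_real w'))"
    by (rule right_diff_distrib[symmetric])
  then have "cmod (2 * pi * \<i> * g (of_real w) - 2 * pi * \<i> * g (of_real w')) = 2 * pi * X"
    by (simp add: norm_mult X_def)
  moreover have "?B + 0 + 0 = 16 * K" by (simp add: K_def distrib_left distrib_right)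
  ultimately have "2 * pi * X \<le> 16 * K" using fin by (simp only:)
  moreover have "3 * X \<le> pi * X" using pi_gt3 by (intro mult_right_mono) (auto simp: X_def)
  moreover have "0 \<le> K" using \<rho> \<delta> by (simp add: K_def)
  ultimately have "X \<le> 3 * K" by linarith
  moreover have "3 / \<rho> * (1 + 1 / \<delta>) * \<bar>w - w'\<bar> = 3 * K" using \<rho> \<delta> by (simp add: K_def field_simps)
  ultimately show ?thesis unfolding X_def by (simp only:)
qed

lemma integral_defect_tendsto:
  fixes g :: "complex \<Rightarrow> complex"
  assumes hol: "g holomorphic_on \<complex>\<^sub>+" and upper: "\<And>z. 0 < Re z \<Longrightarrow> cmod (g z) \<le> 1"
    and lim: "AE y in lborel. \<bar>y\<bar> \<le> \<rho> \<longrightarrow> ((\<lambda>x. cmod (g (Complex x y))) \<longlongrightarrow> 1) (at_right 0)"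
  shows "((\<lambda>x. integral {- \<rho>..\<rho>} (\<lambda>y. 1 - (cmod (g (Complex x y)))\<^sup>2)) \<longlongrightarrow> 0) (at_right 0)"
proof (rule tendsto_at_right_sequentially[of 0 1])
  fix X :: "nat \<Rightarrow> real" assume X: "\<And>n. 0 < X n" "X \<longlonglongrightarrow> 0"
  then have fl: "filterlim X (at_right 0) sequentially"
    by (auto simp: filterlim_at less_imp_neq[OF X(1), symmetric] intro!: always_eventually)
  have cont: "continuous_on \<complex>\<^sub>+ g" using hol by (rule holomorphic_on_imp_continuous_on)
  define h where "h n y = indicator {- \<rho>..\<rho>} y *\<^sub>R (1 - (cmod (g (Complex (X n) y)))\<^sup>2)" for n y
  have hm: "h n \<in> borel_measurable lborel" for n
  proof -
    note [measurable] = measurable_vertical_line[OF cont X(1)[of n]]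
    show ?thesis unfolding h_def by measurable
  qed
  have "(\<lambda>n. \<integral>y. h n y \<partial>lborel) \<longlonglongrightarrow> (\<integral>y. 0 \<partial>(lborel :: real measure))"
  proof (rule integral_dominated_convergence[where w="indicator {- \<rho>..\<rho>}" and s=h and f="\<lambda>_. 0"])
    show "integrable lborel (indicator {- \<rho>..\<rho>} :: real \<Rightarrow> real)" by (simp add: emeasure_lborel_Icc_eq)
    show "AE y in lborel. (\<lambda>n. h n y) \<longlonglongrightarrow> 0"
      using lim
    proof eventually_elim
      case (elim y)
      show ?case
      proof (cases "\<bar>y\<bar> \<le> \<rho>")
        case True
        then have "(\<lambda>n. cmod (g (Complex (X n) y))) \<longlonglongrightarrow> 1" using elim filterlim_compose[OF _ fl] by blast
        then have "(\<lambda>n. indicator {- \<rho>..\<rho>} y *\<^sub>R (1 - (cmod (g (Complex (X n) y)))\<^sup>2)) \<longlonglongrightarrow> indicator {- \<rho>..\<rho>} y *\<^sub>R (1 - 1\<^sup>2)"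
          by (intro tendsto_intros)
        then show ?thesis by (simp add: h_def)
      next
        case False
        then have "y \<notin> {- \<rho>..\<rho>}" by auto
        then show ?thesis by (simp add: h_def)
      qed
    qed
    show "AE y in lborel. norm (h n y) \<le> indicator {- \<rho>..\<rho>} y" for n
    proof (rule AE_I2)
      fix y
      have "(cmod (g (Complex (X n) y)))\<^sup>2 \<le> 1" using upper[of "Complex (X n) y"] X(1)[of n] by (simp add: power_le_one)
      then show "norm (h n y) \<le> indicator {- \<rho>..\<rho>} y" by (auto simp: h_def split: split_indicator)
    qed
  qed (use hm in auto)
  moreover have "(\<integral>y. h n y \<partial>lborel) = integral {- \<rho>..\<rho>} (\<lambda>y. 1 - (cmod (g (Complex (X n) y)))\<^sup>2)" for n
  proof -
    have "continuous_on {- \<rho>..\<rho>} (\<lambda>y. g (Complex (X n) y))"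
      by (rule continuous_on_compose2[OF cont continuous_on_Complex(1)]) (use X(1) in auto)
    then have "set_integrable lborel {- \<rho>..\<rho>} (\<lambda>y. 1 - (cmod (g (Complex (X n) y)))\<^sup>2)"
      by (intro borel_integrable_atLeastAtMost' continuous_intros)
    from set_borel_integral_eq_integral(2)[OF this] show ?thesis unfolding set_lebesgue_integral_def h_def .
  qed
  ultimately show "(\<lambda>n. integral {- \<rho>..\<rho>} (\<lambda>y. 1 - (cmod (g (Complex (X n) y)))\<^sup>2)) \<longlonglongrightarrow> 0" by simp
qed simp

lemma AE_ex_small:
  assumes "AE y in lborel. P (y::real)" "0 < \<epsilon>"
  shows "\<exists>y. 0 < y \<and> y < \<epsilon> \<and> P y"
proof (rule ccontr)
  assume "\<not> ?thesis"
  then have "AE y in lborel. y \<notin> {0<..<\<epsilon>}" using assms(1) by (auto elim!: eventually_mono)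
  then have "{0<..<\<epsilon>} \<in> null_sets lborel" by (subst (asm) AE_iff_null_sets[symmetric]) auto
  then show False using assms(2) by (simp add: null_sets_def)
qed

text \<open>The Lipschitz bound is applied on lines \<open>Im z = t\<close> along which \<open>|g|\<close> tends to 1 at the boundary. The line
  \<open>t = 0\<close> need not have this property, but almost all nearby lines do, and \<open>t\<close> can tend to 0 because \<open>g\<close> is
  continuous at \<open>w\<close>.\<close>
lemma modulus_near_regular_point:
  fixes g :: "complex \<Rightarrow> complex"
  assumes hol: "g holomorphic_on \<complex>\<^sub>+" and upper: "\<And>z. 0 < Re z \<Longrightarrow> cmod (g z) \<le> 1"
    and r: "0 < r" and \<delta>: "0 < \<delta>"
    and lower: "\<And>z. 0 < Re z \<Longrightarrow> Re z \<le> r \<Longrightarrow> \<bar>Im z\<bar> \<le> r \<Longrightarrow> \<delta> \<le> cmod (g z)"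
    and lim: "AE y in lborel. \<bar>y\<bar> \<le> r \<longrightarrow> ((\<lambda>x. cmod (g (Complex x y))) \<longlongrightarrow> 1) (at_right 0)"
    and w: "0 < w" "w < r / 4"
  shows "1 - cmod (g (of_real w)) \<le> 6 / r * (1 + 1 / \<delta>) * w"
proof -
  define \<rho> where "\<rho> = r / 2"
  define K where "K = 3 / \<rho> * (1 + 1 / \<delta>)"
  have \<rho>: "0 < \<rho>" "w < \<rho> / 2" using r w by (auto simp: \<rho>_def)
  have cont: "continuous_on \<complex>\<^sub>+ g" using hol by (rule holomorphic_on_imp_continuous_on)
  have shifted: "1 - cmod (g (Complex w t)) \<le> K * w"
    if t: "\<bar>t\<bar> < \<rho>" and tl: "((\<lambda>x. cmod (g (Complex x t))) \<longlongrightarrow> 1) (at_right 0)" for t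
  proof -
    define gt where "gt z = g (z + Complex 0 t)" for z
    have gC: "gt (Complex x y) = g (Complex x (y + t))" for x y by (simp add: gt_def Complex_eq algebra_simps)
    have gR: "gt (of_real x) = g (Complex x t)" for x by (simp add: gt_def Complex_eq algebra_simps)
    have AEt: "AE y in lborel. \<bar>y + t\<bar> \<le> r \<longrightarrow> ((\<lambda>x. cmod (g (Complex x (y + t)))) \<longlongrightarrow> 1) (at_right 0)"
    proof -
      have "AE y in distr lborel borel ((+) t). \<bar>y\<bar> \<le> r \<longrightarrow> ((\<lambda>x. cmod (g (Complex x y))) \<longlongrightarrow> 1) (at_right 0)"
        using lim unfolding lborel_distr_plus .
      then have "AE y in lborel. \<bar>t + y\<bar> \<le> r \<longrightarrow> ((\<lambda>x. cmod (g (Complex x (t + y)))) \<longlongrightarrow> 1) (at_right 0)"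
        by (rule AE_distrD[rotated]) simp
      then show ?thesis by (simp add: add.commute)
    qed
    have lip: "cmod (gt (of_real w) - gt (of_real x)) \<le> K * \<bar>w - x\<bar>" if x: "0 < x" "x < \<rho> / 2" for x
      unfolding K_def
    proof (rule boundary_lipschitz[OF _ \<rho>(1) \<delta>])
      show "gt holomorphic_on \<complex>\<^sub>+"
        unfolding gt_def by (rule holomorphic_on_compose_gen[OF _ hol, unfolded o_def]) (auto intro!: holomorphic_intros)
      show "\<delta> \<le> cmod (gt z)" if "0 < Re z" "Re z \<le> \<rho>" "\<bar>Im z\<bar> \<le> \<rho>" for z
        unfolding gt_def using that t by (intro lower) (auto simp: \<rho>_def)
      show up: "cmod (gt z) \<le> 1" if "0 < Re z" for z unfolding gt_def using that by (intro upper) auto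
      show "((\<lambda>x. integral {- \<rho>..\<rho>} (\<lambda>y. 1 - (cmod (gt (Complex x y)))\<^sup>2)) \<longlongrightarrow> 0) (at_right 0)"
      proof (rule integral_defect_tendsto)
        show "gt holomorphic_on \<complex>\<^sub>+" by fact
        show "AE y in lborel. \<bar>y\<bar> \<le> \<rho> \<longrightarrow> ((\<lambda>x. cmod (gt (Complex x y))) \<longlongrightarrow> 1) (at_right 0)"
          using AEt by eventually_elim (use t in \<open>auto simp: gC \<rho>_def\<close>)
      qed (use up in auto)
    qed (use w \<rho> x in auto)
    have "\<forall>\<^sub>F x in at_right 0. cmod (g (Complex x t)) - cmod (g (Complex w t)) \<le> K * \<bar>w - x\<bar>"
    proof -
      have "\<forall>\<^sub>F x in at_right 0. 0 < x \<and> x < \<rho> / 2" using \<rho>(1) by (auto simp: eventually_at_right_field intro!: exI[of _ "\<rho> / 2"])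
      then show ?thesis
      proof eventually_elim
        case (elim x)
        have "cmod (g (Complex x t)) - cmod (g (Complex w t)) \<le> cmod (g (Complex x t) - g (Complex w t))" by (rule norm_triangle_ineq2)
        also have "\<dots> = cmod (gt (of_real w) - gt (of_real x))" unfolding gR by (rule norm_minus_commute)
        finally show ?case using lip[of x] elim by simp
      qed
    qed
    moreover have "((\<lambda>x. cmod (g (Complex x t)) - cmod (g (Complex w t))) \<longlongrightarrow> 1 - cmod (g (Complex w t))) (at_right 0)"
      by (intro tendsto_intros tl)
    moreover have "((\<lambda>x. K * \<bar>w - x\<bar>) \<longlongrightarrow> K * \<bar>w - 0\<bar>) (at_right 0)" by (intro tendsto_intros)
    ultimately have "1 - cmod (g (Complex w t)) \<le> K * \<bar>w - 0\<bar>" by (intro tendsto_le[of "at_right (0::real)"]) auto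
    then show ?thesis using w by simp
  qed
  have "\<exists>t. 0 < t \<and> t < \<rho> / real (Suc n) \<and> (\<bar>t\<bar> \<le> r \<longrightarrow> ((\<lambda>x. cmod (g (Complex x t))) \<longlongrightarrow> 1) (at_right 0))" for n
    by (rule AE_ex_small[OF lim]) (use \<rho> in simp)
  then obtain t where t: "\<And>n. 0 < t n" "\<And>n. t n < \<rho> / real (Suc n)"
    and tl: "\<And>n. \<bar>t n\<bar> \<le> r \<Longrightarrow> ((\<lambda>x. cmod (g (Complex x (t n)))) \<longlongrightarrow> 1) (at_right 0)" by metis
  have t\<rho>: "\<bar>t n\<bar> < \<rho>" for n
  proof -
    have "\<rho> / real (Suc n) \<le> \<rho> / 1" using \<rho>(1) by (intro divide_left_mono) auto
    then show ?thesis using t(1)[of n] t(2)[of n] by simp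
  qed
  have "t \<longlonglongrightarrow> 0"
  proof (rule tendsto_sandwich[of "\<lambda>_. 0" _ _ "\<lambda>n. \<rho> / real (Suc n)"])
    show "(\<lambda>n. \<rho> / real (Suc n)) \<longlonglongrightarrow> 0" by real_asymp
  qed (use t in \<open>auto intro!: always_eventually less_imp_le\<close>)
  then have "(\<lambda>n. Complex w (t n)) \<longlonglongrightarrow> Complex w 0" unfolding Complex_eq by (intro tendsto_intros tendsto_eq_intros) auto
  moreover have "isCont g (Complex w 0)"
    using cont open_halfspace_Re_gt[of 0] w by (simp add: continuous_on_eq_continuous_at)
  ultimately have "(\<lambda>n. g (Complex w (t n))) \<longlonglongrightarrow> g (Complex w 0)" by (rule isCont_tendsto_compose[rotated])
  then have "(\<lambda>n. 1 - cmod (g (Complex w (t n)))) \<longlonglongrightarrow> 1 - cmod (g (Complex w 0))" by (intro tendsto_intros)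
  moreover have "1 - cmod (g (Complex w (t n))) \<le> K * w" for n
    using t\<rho>[of n] r by (intro shifted t\<rho> tl) (auto simp: \<rho>_def)
  ultimately have "1 - cmod (g (Complex w 0)) \<le> K * w" by (intro LIMSEQ_le_const2) auto
  moreover have "Complex w 0 = of_real w" by (simp add: complex_eq_iff)
  ultimately show ?thesis by (simp add: K_def \<rho>_def)
qed

lemma bounded_below_off_spectrum:
  assumes \<zeta>: "\<zeta> \<in> insert None (Some ` closure \<complex>\<^sub>+)" "\<zeta> \<notin> inner_spectrum \<theta>"
  shows "\<exists>\<delta>>0. \<forall>\<^sub>F z in half_plane_approach \<zeta>. \<delta> < cmod (\<theta> z)"
proof -
  have "Liminf (half_plane_approach \<zeta>) (\<lambda>z. ennreal (cmod (\<theta> z))) \<noteq> 0"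
    using \<zeta> by (auto simp: inner_spectrum_def)
  then obtain d where d: "0 < d" "d < Liminf (half_plane_approach \<zeta>) (\<lambda>z. ennreal (cmod (\<theta> z)))"
    using dense[of 0 "Liminf (half_plane_approach \<zeta>) (\<lambda>z. ennreal (cmod (\<theta> z)))"] by (auto simp: zero_less_iff_neq_zero)
  then have "d < top" by (auto simp: less_top[symmetric] intro: order.strict_trans2)
  then have dd: "d = ennreal (enn2real d)" "0 < enn2real d" using d(1) by (auto simp: enn2real_positive_iff)
  have "\<forall>\<^sub>F z in half_plane_approach \<zeta>. enn2real d < cmod (\<theta> z)"
    using less_LiminfD[OF d(2)]
  proof eventually_elim
    case (elim z)
    then have "ennreal (enn2real d) < ennreal (cmod (\<theta> z))" using dd(1) by simp
    then show ?case using dd(2) by (subst (asm) ennreal_less_iff) auto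
  qed
  then show ?thesis using dd(2) by blast
qed

context inner_fun
begin

lemma modulus_radial_limit:
  "AE y in lborel. ((\<lambda>x. cmod (\<theta> (Complex x y))) \<longlongrightarrow> 1) (at_right 0)"
proof -
  have "AE y in lborel. \<exists>l. ((\<lambda>x. \<theta> (Complex x y)) \<longlongrightarrow> l) (at_right 0) \<and> cmod l = 1"
    using inner by (simp add: inner_function_def)
  then show ?thesis by eventually_elim (auto dest: tendsto_norm)
qed

lemma modulus_at_zero:
  assumes "Some 0 \<notin> inner_spectrum \<theta>"
  obtains C \<eta> where "0 < C" "0 < \<eta>" "\<And>w. 0 < w \<Longrightarrow> w < \<eta> \<Longrightarrow> 1 - cmod (\<theta> (of_real w)) \<le> C * w"
proof -
  have "0 \<in> closure \<complex>\<^sub>+"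
    unfolding closure_approachable
  proof (intro allI impI)
    fix e :: real assume "0 < e"
    then show "\<exists>y\<in>\<complex>\<^sub>+. dist y 0 < e" by (intro bexI[of _ "of_real (e / 2)"]) auto
  qed
  then obtain \<delta> e where \<delta>: "0 < \<delta>" and e: "0 < e" "\<And>z. z \<in> \<complex>\<^sub>+ \<Longrightarrow> z \<noteq> 0 \<Longrightarrow> dist z 0 < e \<Longrightarrow> \<delta> < cmod (\<theta> z)"
    using bounded_below_off_spectrum[OF _ assms] by (auto simp: eventually_at)
  \<comment> \<open>The square \<open>0 < Re z \<le> r\<close>, \<open>|Im z| \<le> r\<close> lies in the disc of radius \<open>e\<close> about 0.\<close>
  define r where "r = e / 3"
  have r: "0 < r" using e by (simp add: r_def)
  have low: "\<delta> \<le> cmod (\<theta> z)" if "0 < Re z" "Re z \<le> r" "\<bar>Im z\<bar> \<le> r" for z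
  proof -
    have "cmod z \<le> \<bar>Re z\<bar> + \<bar>Im z\<bar>" by (rule cmod_le)
    then have "dist z 0 < e" using that e(1) by (simp add: r_def dist_norm)
    then show ?thesis using that by (intro less_imp_le e(2)) auto
  qed
  show ?thesis
  proof (rule that[of "6 / r * (1 + 1 / \<delta>)" "r / 4"])
    show "0 < 6 / r * (1 + 1 / \<delta>)" using r \<delta> by (intro mult_pos_pos add_pos_pos) auto
    show "1 - cmod (\<theta> (of_real w)) \<le> 6 / r * (1 + 1 / \<delta>) * w" if "0 < w" "w < r / 4" for w
      using modulus_radial_limit
      by (intro modulus_near_regular_point[OF hol cmod_le_1 r \<delta> low _ that]) auto
  qed (use r in auto)
qed

text \<open>The map \<open>z \<mapsto> 1/z\<close> moves the point at infinity to 0. It does not preserve horizontal lines: the point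
  \<open>1 / (x + iy)\<close> runs through a circle. Since only the modulus matters, Harnack's inequality for the defect
  allows one to replace this point by \<open>x - i/y\<close>, which lies on a horizontal line.\<close>
lemma modulus_at_infinity:
  assumes "None \<notin> inner_spectrum \<theta>"
  obtains C R where "0 < C" "0 < R" "\<And>w. R < w \<Longrightarrow> 1 - cmod (\<theta> (of_real w)) \<le> C / w"
proof -
  obtain \<delta> b where \<delta>: "0 < \<delta>" and b: "\<And>z. 0 < Re z \<Longrightarrow> b \<le> cmod z \<Longrightarrow> \<delta> < cmod (\<theta> z)"
    using bounded_below_off_spectrum[OF _ assms] by (auto simp: eventually_inf_principal eventually_at_infinity)
  define B where "B = max b 1"
  have B: "0 < B" "\<And>z. 0 < Re z \<Longrightarrow> B \<le> cmod z \<Longrightarrow> \<delta> < cmod (\<theta> z)" using b by (auto simp: B_def)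
  define r where "r = 1 / (2 * B)"
  have r: "0 < r" using B by (simp add: r_def)
  define g where "g z = \<theta> (1 / z)" for z
  have rinv: "0 < Re (1 / z)" if "0 < Re z" for z :: complex
    using that by (auto simp: Re_divide intro!: divide_pos_pos add_pos_nonneg)
  have low: "\<delta> \<le> cmod (g z)" if "0 < Re z" "Re z \<le> r" "\<bar>Im z\<bar> \<le> r" for z
    unfolding g_def
  proof (rule less_imp_le[OF B(2)[OF rinv[OF that(1)]]])
    have z: "0 < cmod z" using that by auto
    have "cmod z \<le> \<bar>Re z\<bar> + \<bar>Im z\<bar>" by (rule cmod_le)
    also have "\<dots> \<le> 1 / B" using that B by (simp add: r_def)
    finally show "B \<le> cmod (1 / z)" using z B(1) by (simp add: norm_divide field_simps)
  qed
  have ghol: "g holomorphic_on \<complex>\<^sub>+"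
    unfolding g_def
    by (rule holomorphic_on_compose_gen[OF _ hol, unfolded o_def]) (use rinv in \<open>auto intro!: holomorphic_intros\<close>)
  have gle: "cmod (g z) \<le> 1" if "0 < Re z" for z unfolding g_def by (intro cmod_le_1 rinv that)
  have transfer: "((\<lambda>x. cmod (g (Complex x y))) \<longlongrightarrow> 1) (at_right 0)"
    if y: "y \<noteq> 0" and l: "((\<lambda>x. cmod (\<theta> (Complex x (- 1 / y)))) \<longlongrightarrow> 1) (at_right 0)" for y
  proof -
    define Q where "Q x = (x\<^sup>2 + y\<^sup>2) * (1 + 1 / (x\<^sup>2 + y\<^sup>2))\<^sup>2 + x\<^sup>2 / (y\<^sup>2 * (x\<^sup>2 + y\<^sup>2))" for x
    have bound: "defect (1 / Complex x y) \<le> defect (Complex x (- 1 / y)) * Q x" if x: "0 < x" for x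
    proof -
      define m where "m = x\<^sup>2 + y\<^sup>2"
      have m: "0 < m" using x by (simp add: m_def add_pos_nonneg)
      have e: "1 / Complex x y = Complex (x / m) (- y / m)"
        by (simp add: complex_eq_iff m_def Re_divide Im_divide)
      have "(cmod (1 / Complex x y + cnj (Complex x (- 1 / y))))\<^sup>2 / (Re (Complex x (- 1 / y)) * Re (1 / Complex x y)) = Q x"
      proof -
        have "1 / y - y / m = (m - y * y) / (y * m)" using y m by (simp add: diff_divide_distrib)
        also have "m - y * y = x\<^sup>2" by (simp add: m_def power2_eq_square)
        finally have i: "1 / y - y / m = x\<^sup>2 / (y * m)" .
        have xm: "x / m + x = x * (1 + 1 / m)" by (simp add: distrib_left)
        have "(cmod (1 / Complex x y + cnj (Complex x (- 1 / y))))\<^sup>2 = (x / m + x)\<^sup>2 + (1 / y - y / m)\<^sup>2"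
          unfolding e cmod_power2 by (simp add: algebra_simps)
        also have "\<dots> = x\<^sup>2 * (1 + 1 / m)\<^sup>2 + x\<^sup>2 * (x\<^sup>2 / (y * m)\<^sup>2)"
          unfolding i xm by (simp add: power_mult_distrib power_divide power2_eq_square)
        finally have num: "(cmod (1 / Complex x y + cnj (Complex x (- 1 / y))))\<^sup>2 = x\<^sup>2 * ((1 + 1 / m)\<^sup>2 + x\<^sup>2 / (y * m)\<^sup>2)"
          by (simp only: distrib_left)
        have d1: "Re (Complex x (- 1 / y)) * Re (1 / Complex x y) = x\<^sup>2 / m" unfolding e by (simp add: power2_eq_square)
        have d2: "x\<^sup>2 * B / (x\<^sup>2 / m) = m * B" for B using x m by simp
        have d3: "m * (x\<^sup>2 / (y * m)\<^sup>2) = x\<^sup>2 / (y\<^sup>2 * m)" using m by (simp add: power2_eq_square)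
        show ?thesis unfolding num d1 d2 unfolding Q_def m_def[symmetric] unfolding distrib_left d3 ..
      qed
      then show ?thesis using defect_Harnack[of "Complex x (- 1 / y)" "1 / Complex x y"] x rinv[of "Complex x y"] by simp
    qed
    have l1: "((\<lambda>x. defect (Complex x (- 1 / y))) \<longlongrightarrow> 1 - 1\<^sup>2) (at_right 0)"
      unfolding defect_def using l by (intro tendsto_intros)
    have l2: "(Q \<longlongrightarrow> (0\<^sup>2 + y\<^sup>2) * (1 + 1 / (0\<^sup>2 + y\<^sup>2))\<^sup>2 + 0\<^sup>2 / (y\<^sup>2 * (0\<^sup>2 + y\<^sup>2))) (at_right 0)"
      unfolding Q_def using y by (intro tendsto_intros) auto
    have upper: "((\<lambda>x. defect (Complex x (- 1 / y)) * Q x) \<longlongrightarrow> 0) (at_right 0)"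
      using tendsto_mult[OF l1 l2] by simp
    have "\<forall>\<^sub>F x in at_right 0. defect (1 / Complex x y) \<le> defect (Complex x (- 1 / y)) * Q x"
      by (rule eventually_at_right_0[OF bound])
    moreover have "\<forall>\<^sub>F x in at_right 0. 0 \<le> defect (1 / Complex x y)"
      by (rule eventually_at_right_0) (intro defect_nonneg rinv, simp)
    ultimately have "((\<lambda>x. defect (1 / Complex x y)) \<longlongrightarrow> 0) (at_right 0)"
      by (rule tendsto_sandwich[OF _ _ tendsto_const upper, rotated])
    then have "((\<lambda>x. sqrt (1 - defect (1 / Complex x y))) \<longlongrightarrow> sqrt (1 - 0)) (at_right 0)" by (intro tendsto_intros)
    then show ?thesis by (simp add: defect_def g_def)
  qed
  have AEg: "AE y in lborel. ((\<lambda>x. cmod (g (Complex x y))) \<longlongrightarrow> 1) (at_right 0)"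
  proof (rule AE_E3[OF modulus_radial_limit])
    fix N :: "real set"
    assume N: "N \<in> null_sets lborel" "\<And>y. y \<in> space lborel - N \<Longrightarrow> ((\<lambda>x. cmod (\<theta> (Complex x y))) \<longlongrightarrow> 1) (at_right 0)"
    have "negligible (N - {0})" using N(1) by (intro negligible_diff) (simp add: negligible_iff_null_sets null_sets_completionI)
    then have neg: "negligible ((\<lambda>t. - 1 / t) ` (N - {0}))"
      by (intro negligible_differentiable_image_negligible) (auto simp: differentiable_on_def intro!: derivative_intros)
    have "AE y in lebesgue. y \<notin> insert 0 ((\<lambda>t. - 1 / t) ` (N - {0}))"
      using neg by (intro AE_not_in) (simp add: negligible_iff_null_sets[symmetric])
    then have "AE y in lebesgue. ((\<lambda>x. cmod (g (Complex x y))) \<longlongrightarrow> 1) (at_right 0)"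
    proof eventually_elim
      case (elim y)
      then have y: "y \<noteq> 0" by auto
      have "- 1 / y \<notin> N"
      proof
        assume "- 1 / y \<in> N"
        then have "- 1 / (- 1 / y) \<in> (\<lambda>t. - 1 / t) ` (N - {0})" using y by (intro imageI) auto
        then show False using elim y by simp
      qed
      then show ?case by (intro transfer y N(2)) simp
    qed
    then show ?thesis by (simp add: AE_completion_iff)
  qed
  show ?thesis
  proof (rule that[of "6 / r * (1 + 1 / \<delta>)" "4 / r"])
    show "0 < 6 / r * (1 + 1 / \<delta>)" using r \<delta> by (intro mult_pos_pos add_pos_pos) auto
    show "1 - cmod (\<theta> (of_real w)) \<le> 6 / r * (1 + 1 / \<delta>) / w" if w: "4 / r < w" for w
    proof -
      have "0 < 4 / r" using r by simp
      then have w0: "0 < w" using w by linarith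
      have "1 / w < r / 4" using w w0 r by (simp add: field_simps)
      then have "1 - cmod (g (of_real (1 / w))) \<le> 6 / r * (1 + 1 / \<delta>) * (1 / w)"
        using AEg w0 by (intro modulus_near_regular_point[OF ghol gle r \<delta> low]) auto
      then show ?thesis by (simp add: g_def)
    qed
  qed (use r in auto)
qed

end

section \<open>Restricting the range of test points\<close>

context inner_fun
begin

lemma kernel_condition_of_unimodular:
  assumes "\<And>w. 0 < w \<Longrightarrow> cmod (\<theta> (of_real w)) = 1"
  shows "kernel_condition \<theta> \<mu> {0<..}"
  unfolding kernel_condition_def using assms by (intro exI[of _ 1]) auto

lemma unimodular_of_point:
  assumes "0 < Re w" "cmod (\<theta> w) = 1" "0 < Re s"
  shows "cmod (\<theta> s) = 1"
proof -
  have "defect s \<le> 0" using defect_Harnack[OF assms(1,3)] assms(2) by (simp add: defect_def)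
  then have "defect s = 0" using defect_nonneg[OF assms(3)] by simp
  then show ?thesis by (simp add: defect_def power2_eq_1_iff) (smt (verit) norm_ge_zero)
qed

text \<open>Passing from \<open>w0\<close> to a smaller \<open>w\<close> multiplies the integrand by at most \<open>w0 / w\<close>, passing to a larger \<open>w\<close> by
  at most \<open>w / w0\<close>. Both factors are compensated if \<open>1 - |\<theta> w|\<close> is of order \<open>w\<close> and \<open>1 / w\<close>, respectively.\<close>
lemma kernel_condition_extend:
  assumes sets: "sets \<mu> = sets (restrict_space borel \<complex>\<^sub>+)"
    and kc: "kernel_condition \<theta> \<mu> W" and w0: "0 < w0" "w0 \<in> W" and C: "0 < C"
    and cover: "\<And>w. 0 < w \<Longrightarrow> w \<notin> W \<Longrightarrow>
        w \<le> w0 \<and> 1 - cmod (\<theta> (of_real w)) \<le> C * w \<or> w0 \<le> w \<and> 1 - cmod (\<theta> (of_real w)) \<le> C / w"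
  shows "kernel_condition \<theta> \<mu> {0<..}"
proof (cases "cmod (\<theta> (of_real w0)) = 1")
  case True
  then show ?thesis using unimodular_of_point[of "of_real w0"] w0 by (intro kernel_condition_of_unimodular) auto
next
  case False
  have space: "space \<mu> = \<complex>\<^sub>+" using sets_eq_imp_space_eq[OF sets] by (simp add: space_restrict_space)
  let ?I = "\<lambda>w. \<integral>\<^sup>+ s. ennreal (w / (cmod (of_real w + s))\<^sup>2) \<partial>\<mu>"
  let ?d = "\<lambda>w. 1 - cmod (\<theta> (of_real w))"
  obtain c where c: "0 < c" "\<And>w. w \<in> W \<Longrightarrow> ?I w \<le> ennreal c / ennreal (?d w)"
    using kc by (auto simp: kernel_condition_def)
  have d0: "0 \<le> ?d w" if "0 < w" for w using cmod_le_1[of "of_real w"] that by simp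
  define B where "B = c / ?d w0"
  have dw0: "0 < ?d w0" using d0[OF w0(1)] False by linarith
  have B: "0 < B" using c dw0 by (simp add: B_def)
  have IB: "?I w0 \<le> ennreal B" using c(2)[OF w0(2)] c(1) dw0 by (simp add: B_def divide_ennreal)
  have scale: "?I w \<le> ennreal (k * B)" if k: "0 \<le> k" and le: "\<And>s. 0 < Re s \<Longrightarrow> w / (cmod (of_real w + s))\<^sup>2 \<le> k * (w0 / (cmod (of_real w0 + s))\<^sup>2)" for w k
  proof -
    have "?I w \<le> (\<integral>\<^sup>+ s. ennreal k * ennreal (w0 / (cmod (of_real w0 + s))\<^sup>2) \<partial>\<mu>)"
    proof (rule nn_integral_mono)
      fix s assume "s \<in> space \<mu>"
      then have "w / (cmod (of_real w + s))\<^sup>2 \<le> k * (w0 / (cmod (of_real w0 + s))\<^sup>2)" by (intro le) (simp add: space)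
      then show "ennreal (w / (cmod (of_real w + s))\<^sup>2) \<le> ennreal k * ennreal (w0 / (cmod (of_real w0 + s))\<^sup>2)"
        using k by (simp add: ennreal_leI flip: ennreal_mult')
    qed
    also have "\<dots> = ennreal k * ?I w0"
    proof (rule nn_integral_cmult)
      have "(\<lambda>s. ennreal (w0 / (cmod (of_real w0 + s))\<^sup>2)) \<in> borel_measurable (restrict_space borel \<complex>\<^sub>+)"
        by (rule measurable_restrict_space1) measurable
      then show "(\<lambda>s. ennreal (w0 / (cmod (of_real w0 + s))\<^sup>2)) \<in> borel_measurable \<mu>"
        using measurable_cong_sets[OF sets refl] by blast
    qed
    also have "\<dots> \<le> ennreal k * ennreal B" by (intro mult_left_mono IB) simp
    also have "\<dots> = ennreal (k * B)" using k by (simp add: ennreal_mult')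
    finally show ?thesis .
  qed
  have small: "w / (cmod (of_real w + s))\<^sup>2 \<le> w0 / w * (w0 / (cmod (of_real w0 + s))\<^sup>2)" if w: "0 < w" "w \<le> w0" and s: "0 < Re s" for w s
  proof -
    have p: "0 < cmod (of_real w + s)" "0 < cmod (of_real w0 + s)" using w w0 s by (auto simp: complex_eq_iff)
    have "(w * cmod (of_real w0 + s))\<^sup>2 \<le> (w0 * cmod (of_real w + s))\<^sup>2"
    proof -
      have "(w0 * cmod (of_real w + s))\<^sup>2 - (w * cmod (of_real w0 + s))\<^sup>2
        = (w0 - w) * (2 * w0 * w * Re s + (w0 + w) * ((Re s)\<^sup>2 + (Im s)\<^sup>2))"
        unfolding power_mult_distrib cmod_power2 by (simp add: power2_eq_square algebra_simps)
      also have "\<dots> \<ge> 0" using w w0 s by (intro mult_nonneg_nonneg add_nonneg_nonneg) auto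
      finally show ?thesis by simp
    qed
    then have "w\<^sup>2 / (cmod (of_real w + s))\<^sup>2 \<le> w0\<^sup>2 / (cmod (of_real w0 + s))\<^sup>2"
      using p by (simp add: divide_le_eq le_divide_eq power_mult_distrib mult.commute)
    then have "1 / w * (w\<^sup>2 / (cmod (of_real w + s))\<^sup>2) \<le> 1 / w * (w0\<^sup>2 / (cmod (of_real w0 + s))\<^sup>2)"
      using w by (intro mult_left_mono) auto
    then show ?thesis using w by (simp add: power2_eq_square)
  qed
  have large: "w / (cmod (of_real w + s))\<^sup>2 \<le> w / w0 * (w0 / (cmod (of_real w0 + s))\<^sup>2)" if w: "w0 \<le> w" and s: "0 < Re s" for w s
  proof -
    have p: "0 < cmod (of_real w0 + s)" using w0 s by (auto simp: complex_eq_iff)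
    have "(w0 + Re s)\<^sup>2 \<le> (w + Re s)\<^sup>2" using w w0 s by (intro power_mono) auto
    then have "(cmod (of_real w0 + s))\<^sup>2 \<le> (cmod (of_real w + s))\<^sup>2" unfolding cmod_power2 by simp
    then have "w / (cmod (of_real w + s))\<^sup>2 \<le> w / (cmod (of_real w0 + s))\<^sup>2"
      using p w w0 by (intro divide_left_mono mult_pos_pos) (auto intro: less_le_trans)
    then show ?thesis using w0 by simp
  qed
  define c' where "c' = c + (w0 * B * C + B * C / w0)"
  have q: "0 < w0 * B * C" "0 < B * C / w0" using w0 B C by auto
  have c': "0 < c'" "c \<le> c'" "w0 * B * C \<le> c'" "B * C / w0 \<le> c'" using c q by (auto simp: c'_def)
  have "?I w \<le> ennreal c' / ennreal (?d w)" if w: "0 < w" for w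
  proof (cases "w \<in> W")
    case True
    then have "?I w \<le> ennreal c / ennreal (?d w)" by (rule c)
    also have "\<dots> \<le> ennreal c' / ennreal (?d w)" using c' by (intro divide_right_mono_ennreal ennreal_leI)
    finally show ?thesis .
  next
    case nW: False
    show ?thesis
    proof (cases "?d w = 0")
      case True
      then show ?thesis using c'(1) by simp
    next
      case False
      then have d: "0 < ?d w" using d0[OF w] by linarith
      consider "w \<le> w0" "?d w \<le> C * w" | "w0 \<le> w" "?d w \<le> C / w" using cover[OF w nW] by blast
      then have "\<exists>k\<ge>0. ?I w \<le> ennreal (k * B) \<and> k * B * ?d w \<le> c'"
      proof cases
        case 1
        have "w0 / w * B * ?d w \<le> w0 / w * B * (C * w)" using w w0 B 1 by (intro mult_left_mono) auto
        also have "\<dots> = w0 * B * C" using w by simp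
        finally show ?thesis using c'(3) w w0 scale[OF _ small[OF w 1(1)]] by (intro exI[of _ "w0 / w"]) auto
      next
        case 2
        have "w / w0 * B * ?d w \<le> w / w0 * B * (C / w)" using w w0 B 2 by (intro mult_left_mono) auto
        also have "\<dots> = B * C / w0" using w by simp
        finally show ?thesis using c'(4) w w0 scale[OF _ large[OF 2(1)]] by (intro exI[of _ "w / w0"]) auto
      qed
      then obtain k where k: "?I w \<le> ennreal (k * B)" "k * B * ?d w \<le> c'" by blast
      have "k * B \<le> c' / ?d w" using k(2) d by (simp add: pos_le_divide_eq)
      then have "ennreal (k * B) \<le> ennreal c' / ennreal (?d w)" using c'(1) d by (simp add: divide_ennreal ennreal_leI)
      then show ?thesis using k(1) by (rule order_trans[rotated])
    qed
  qed
  then show ?thesis unfolding kernel_condition_def using c'(1) by (intro exI[of _ c']) auto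
qed

text \<open>The closed half-plane together with the point at infinity is compact.\<close>
lemma bounded_below_of_empty_spectrum:
  assumes "inner_spectrum \<theta> = {}"
  shows "\<exists>\<delta>>0. \<forall>z. 0 < Re z \<longrightarrow> \<delta> \<le> cmod (\<theta> z)"
proof (rule ccontr)
  assume neg: "\<not> ?thesis"
  have pos: "\<exists>d>0. \<forall>\<^sub>F z in half_plane_approach \<zeta>. d < cmod (\<theta> z)" if "\<zeta> \<in> insert None (Some ` closure \<complex>\<^sub>+)" for \<zeta>
    using bounded_below_off_spectrum[OF that] assms by simp
  have "\<exists>z. 0 < Re z \<and> cmod (\<theta> z) < 1 / real (Suc n)" for n
    using neg by (metis not_less of_nat_0_less_iff zero_less_Suc zero_less_divide_1_iff)
  then obtain z where z: "\<And>n. 0 < Re (z n)" "\<And>n. cmod (\<theta> (z n)) < 1 / real (Suc n)" by metis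
  have small: "(\<lambda>n. cmod (\<theta> (z n))) \<longlonglongrightarrow> 0"
  proof (rule tendsto_sandwich[of "\<lambda>_. 0" _ _ "\<lambda>n. 1 / real (Suc n)"])
    show "(\<lambda>n. 1 / real (Suc n)) \<longlonglongrightarrow> 0" by real_asymp
  qed (use z in \<open>auto intro!: always_eventually less_imp_le\<close>)
  obtain d b where d: "0 < d" "\<And>v. 0 < Re v \<Longrightarrow> b \<le> cmod v \<Longrightarrow> d < cmod (\<theta> v)"
    using pos[of None] by (auto simp: eventually_inf_principal eventually_at_infinity)
  obtain N where N: "\<And>n. n \<ge> N \<Longrightarrow> cmod (\<theta> (z n)) < d"
    using order_tendstoD(2)[OF small d(1)] by (auto simp: eventually_sequentially)
  have "cmod (z (n + N)) \<le> b" for n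
    using d(2)[OF z(1)[of "n + N"]] N[of "n + N"] by (meson le_add2 less_asym linear)
  then have "\<forall>n. z (n + N) \<in> cball 0 b" by simp
  then obtain l r where l: "strict_mono r" "((\<lambda>n. z (n + N)) \<circ> r) \<longlonglongrightarrow> l"
    using compact_cball[of "0::complex" b, unfolded compact_def, THEN spec, of "\<lambda>n. z (n + N)"] by blast
  have zl: "(\<lambda>n. z (r n + N)) \<longlonglongrightarrow> l" using l(2) by (simp add: o_def)
  have lc: "l \<in> closure \<complex>\<^sub>+" unfolding closure_sequential using z(1) zl by (intro exI[of _ "\<lambda>n. z (r n + N)"]) auto
  have smallr: "(\<lambda>n. cmod (\<theta> (z (r n + N)))) \<longlonglongrightarrow> 0"
  proof -
    have "filterlim (\<lambda>n. r n + N) at_top sequentially"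
      by (rule filterlim_at_top_mono[OF filterlim_subseq[OF l(1)]]) simp
    then show ?thesis by (rule filterlim_compose[OF small])
  qed
  obtain e where e: "0 < e" "\<forall>\<^sub>F v in at l within \<complex>\<^sub>+. e < cmod (\<theta> v)"
    using pos[of "Some l"] lc by auto
  have "\<exists>e'>0. \<forall>\<^sub>F v in nhds l. v \<in> \<complex>\<^sub>+ \<longrightarrow> e' < cmod (\<theta> v)"
  proof (cases "0 < Re l")
    case False
    then show ?thesis using e by (intro exI[of _ e]) (auto simp: eventually_at_filter elim: eventually_mono)
  next
    case True
    then have li: "l \<in> \<complex>\<^sub>+" by simp
    have op: "open \<complex>\<^sub>+" by (rule open_halfspace_Re_gt)
    have atl: "at l within \<complex>\<^sub>+ = at l" by (rule at_within_open[OF li op])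
    have "isCont (\<lambda>v. cmod (\<theta> v)) l"
      using holomorphic_on_imp_continuous_on[OF hol] op li by (auto simp: continuous_on_eq_continuous_at intro!: continuous_intros)
    then have t: "((\<lambda>v. cmod (\<theta> v)) \<longlongrightarrow> cmod (\<theta> l)) (at l)" by (simp add: isCont_def)
    have "e \<le> cmod (\<theta> l)" using e(2) unfolding atl by (intro tendsto_lowerbound[OF t]) (auto elim: eventually_mono)
    then show ?thesis using e
      by (intro exI[of _ "e / 2"]) (auto simp: eventually_at_filter elim!: eventually_mono)
  qed
  then obtain e' where e': "0 < e'" "\<forall>\<^sub>F v in nhds l. v \<in> \<complex>\<^sub>+ \<longrightarrow> e' < cmod (\<theta> v)" by blast
  have "\<forall>\<^sub>F n in sequentially. z (r n + N) \<in> \<complex>\<^sub>+ \<longrightarrow> e' < cmod (\<theta> (z (r n + N)))"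
    using zl e'(2) by (rule eventually_compose_filterlim[rotated])
  moreover have "\<forall>\<^sub>F n in sequentially. cmod (\<theta> (z (r n + N))) < e'" using order_tendstoD(2)[OF smallr e'(1)] .
  ultimately have "\<forall>\<^sub>F n in sequentially. False" by eventually_elim (use z(1) in fastforce)
  then show False by simp
qed

text \<open>Now \<open>1 / \<theta>\<close> is an inner function too, so that both \<open>|\<theta>|\<close> and \<open>1 / |\<theta>|\<close> are at most 1.\<close>
lemma unimodular_of_empty_spectrum:
  assumes "inner_spectrum \<theta> = {}" "0 < Re w"
  shows "cmod (\<theta> w) = 1"
proof -
  obtain \<delta> where \<delta>: "0 < \<delta>" "\<And>z. 0 < Re z \<Longrightarrow> \<delta> \<le> cmod (\<theta> z)"
    using bounded_below_of_empty_spectrum[OF assms(1)] by blast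
  have ne: "\<theta> z \<noteq> 0" if "0 < Re z" for z using \<delta>(2)[OF that] \<delta>(1) by auto
  have "inner_function (\<lambda>z. 1 / \<theta> z)"
    unfolding inner_function_def
  proof (intro conjI)
    show "(\<lambda>z. 1 / \<theta> z) holomorphic_on \<complex>\<^sub>+" using ne by (intro holomorphic_intros hol) auto
    have "cmod (1 / \<theta> z) \<le> 1 / \<delta>" if "0 < Re z" for z
      using \<delta>(2)[OF that] \<delta>(1) by (auto simp: norm_divide intro!: divide_left_mono mult_pos_pos)
    then show "bounded ((\<lambda>z. 1 / \<theta> z) ` \<complex>\<^sub>+)" by (auto simp: bounded_iff)
    have "AE y in lborel. \<exists>l. ((\<lambda>x. \<theta> (Complex x y)) \<longlongrightarrow> l) (at_right 0) \<and> cmod l = 1"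
      using inner by (simp add: inner_function_def)
    then show "AE y in lborel. \<exists>l. ((\<lambda>x. 1 / \<theta> (Complex x y)) \<longlongrightarrow> l) (at_right 0) \<and> cmod l = 1"
    proof eventually_elim
      case (elim y)
      then obtain l where l: "((\<lambda>x. \<theta> (Complex x y)) \<longlongrightarrow> l) (at_right 0)" "cmod l = 1" by blast
      then have "((\<lambda>x. 1 / \<theta> (Complex x y)) \<longlongrightarrow> 1 / l) (at_right 0)" by (intro tendsto_intros) auto
      then show ?case using l(2) by (intro exI[of _ "1 / l"]) (simp add: norm_divide)
    qed
  qed
  then interpret inv: inner_fun "\<lambda>z. 1 / \<theta> z" by unfold_locales
  have "1 \<le> cmod (\<theta> w)" using inv.cmod_le_1[OF assms(2)] ne[OF assms(2)] by (simp add: norm_divide field_simps)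
  then show ?thesis using cmod_le_1[OF assms(2)] by simp
qed

end

lemma kernel_condition_mono: "kernel_condition \<theta> \<mu> V \<Longrightarrow> W \<subseteq> V \<Longrightarrow> kernel_condition \<theta> \<mu> W"
  unfolding kernel_condition_def by blast

theorem theorem3p7:
  fixes \<theta> :: "complex \<Rightarrow> complex" and \<mu> :: "complex measure"
  assumes "inner_function \<theta>"
    and "regular_borel_measure_on \<complex>\<^sub>+ \<mu>"
    and "emeasure \<mu> (\<complex>\<^sub>+ - complex_of_real ` {0..}) = 0"
  shows "(carleson_measure_for (model_space \<theta>) \<mu> \<longleftrightarrow> kernel_condition \<theta> \<mu> {0<..})
    \<and> (Some 0 \<notin> inner_spectrum \<theta> \<longrightarrow>
        (carleson_measure_for (model_space \<theta>) \<mu> \<longleftrightarrow>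
          kernel_condition \<theta> \<mu> {w. 0 < w \<and> min (spectrum_dist0 \<theta> / 2) 1 \<le> ennreal w}))
    \<and> (None \<notin> inner_spectrum \<theta> \<and> inner_spectrum \<theta> \<noteq> {Some 0} \<longrightarrow>
        (carleson_measure_for (model_space \<theta>) \<mu> \<longleftrightarrow>
          kernel_condition \<theta> \<mu> {w. 0 < w \<and> ennreal w \<le> 2 * spectrum_radius \<theta>}))"
proof -
  interpret inner_fun \<theta> by unfold_locales (rule assms(1))
  have sets: "sets \<mu> = sets (restrict_space borel \<complex>\<^sub>+)"
    using assms(2) by (simp add: regular_borel_measure_on_def)
  have main: "carleson_measure_for (model_space \<theta>) \<mu> \<longleftrightarrow> kernel_condition \<theta> \<mu> {0<..}"
    using carleson_imp_kernel_condition[OF sets] kernel_condition_imp_carleson[OF sets assms(3)] by blast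
  have zero: "kernel_condition \<theta> \<mu> {0<..} \<longleftrightarrow> kernel_condition \<theta> \<mu> {w. 0 < w \<and> min (spectrum_dist0 \<theta> / 2) 1 \<le> ennreal w}" (is "_ \<longleftrightarrow> kernel_condition \<theta> \<mu> ?W")
    if no0: "Some 0 \<notin> inner_spectrum \<theta>"
  proof
    show "kernel_condition \<theta> \<mu> {0<..} \<Longrightarrow> kernel_condition \<theta> \<mu> ?W" by (rule kernel_condition_mono) auto
    assume kc: "kernel_condition \<theta> \<mu> ?W"
    obtain C \<eta> where C: "0 < C" "0 < \<eta>" "\<And>w. 0 < w \<Longrightarrow> w < \<eta> \<Longrightarrow> 1 - cmod (\<theta> (of_real w)) \<le> C * w"
      using modulus_at_zero[OF no0] by blast
    \<comment> \<open>Whatever the distance is, the point 1 belongs to the range, and so does every larger one.\<close>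
    show "kernel_condition \<theta> \<mu> {0<..}"
    proof (rule kernel_condition_extend[OF sets kc, of 1 "max C (1 / \<eta>)"])
      show "1 \<in> ?W" by simp
      fix w :: real assume w: "0 < w" "w \<notin> ?W"
      have "w < 1"
      proof (rule ccontr)
        assume "\<not> w < 1"
        then have "min (spectrum_dist0 \<theta> / 2) 1 \<le> ennreal w" by (intro min.coboundedI2) simp
        then show False using w by simp
      qed
      moreover have "1 - cmod (\<theta> (of_real w)) \<le> max C (1 / \<eta>) * w"
      proof (cases "w < \<eta>")
        case True
        have "C * w \<le> max C (1 / \<eta>) * w" using w by (intro mult_right_mono) auto
        then show ?thesis using C(3)[OF w(1) True] by linarith
      next
        case False
        then have "1 \<le> 1 / \<eta> * w" using C(2) by (simp add: field_simps)
        also have "\<dots> \<le> max C (1 / \<eta>) * w" using w by (intro mult_right_mono) auto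
        finally show ?thesis using norm_ge_zero[of "\<theta> (of_real w)"] by linarith
      qed
      ultimately show "w \<le> 1 \<and> 1 - cmod (\<theta> (of_real w)) \<le> max C (1 / \<eta>) * w \<or> 1 \<le> w \<and> 1 - cmod (\<theta> (of_real w)) \<le> max C (1 / \<eta>) / w" by simp
    qed (use C in auto)
  qed
  have infinity: "kernel_condition \<theta> \<mu> {0<..} \<longleftrightarrow> kernel_condition \<theta> \<mu> {w. 0 < w \<and> ennreal w \<le> 2 * spectrum_radius \<theta>}" (is "_ \<longleftrightarrow> kernel_condition \<theta> \<mu> ?W")
    if noi: "None \<notin> inner_spectrum \<theta>" and ne0: "inner_spectrum \<theta> \<noteq> {Some 0}"
  proof
    show "kernel_condition \<theta> \<mu> {0<..} \<Longrightarrow> kernel_condition \<theta> \<mu> ?W" by (rule kernel_condition_mono) auto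
    assume kc: "kernel_condition \<theta> \<mu> ?W"
    consider "spectrum_radius \<theta> = 0" | "spectrum_radius \<theta> = top" | "0 < spectrum_radius \<theta>" "spectrum_radius \<theta> < top"
      using less_top zero_less_iff_neq_zero by blast
    then show "kernel_condition \<theta> \<mu> {0<..}"
    proof cases
      case 1
      \<comment> \<open>The range is empty, and so is the spectrum.\<close>
      have "inner_spectrum \<theta> \<subseteq> {Some 0}"
      proof
        fix \<zeta> assume z: "\<zeta> \<in> inner_spectrum \<theta>"
        then obtain v where v: "\<zeta> = Some v" using noi by (cases \<zeta>) auto
        have "ennreal (cmod v) \<le> spectrum_radius \<theta>"
          unfolding spectrum_radius_def using z v by (intro SUP_upper) auto
        then show "\<zeta> \<in> {Some 0}" using 1 v by simp
      qed
      then have "inner_spectrum \<theta> = {}" using ne0 by blast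
      then show ?thesis by (intro kernel_condition_of_unimodular unimodular_of_empty_spectrum) auto
    next
      case 2
      then have "?W = {0<..}" by (auto simp: ennreal_mult_top)
      then show ?thesis using kc by simp
    next
      case 3
      define \<rho> where "\<rho> = enn2real (spectrum_radius \<theta>)"
      have \<rho>: "spectrum_radius \<theta> = ennreal \<rho>" "0 < \<rho>" using 3 by (auto simp: \<rho>_def enn2real_positive_iff)
      have W: "?W = {w. 0 < w \<and> w \<le> 2 * \<rho>}"
      proof -
        have "2 * spectrum_radius \<theta> = ennreal (2 * \<rho>)" using \<rho> by (simp add: ennreal_mult')
        then show ?thesis using \<rho>(2) by simp
      qed
      obtain C R where C: "0 < C" "0 < R" "\<And>w. R < w \<Longrightarrow> 1 - cmod (\<theta> (of_real w)) \<le> C / w"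
        using modulus_at_infinity[OF noi] by blast
      show ?thesis
      proof (rule kernel_condition_extend[OF sets kc, of "2 * \<rho>" "max C R"])
        show "2 * \<rho> \<in> ?W" unfolding W using \<rho>(2) by simp
        fix w :: real assume w: "0 < w" "w \<notin> ?W"
        then have "2 * \<rho> \<le> w" unfolding W by simp
        moreover have "1 - cmod (\<theta> (of_real w)) \<le> max C R / w"
        proof (cases "R < w")
          case True
          have "C / w \<le> max C R / w" using w by (intro divide_right_mono) auto
          then show ?thesis using C(3)[OF True] by linarith
        next
          case False
          then have "1 \<le> R / w" using w by simp
          also have "\<dots> \<le> max C R / w" using w by (intro divide_right_mono) auto
          finally show ?thesis using norm_ge_zero[of "\<theta> (of_real w)"] by linarith
        qed
        ultimately show "w \<le> 2 * \<rho> \<and> 1 - cmod (\<theta> (of_real w)) \<le> max C R * w \<or> 2 * \<rho> \<le> w \<and> 1 - cmod (\<theta> (of_real w)) \<le> max C R / w" by simp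
      qed (use C \<rho> in auto)
    qed
  qed
  show ?thesis using main zero infinity by blast
qed

end
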